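(* Fix an integer $p\ge 2$, an integer $d\ge 1$, a real number $\nu\ge 1$, $\omega\in\mathbb{R}^d$, $\mathbb{T}^d=\mathbb{R}^d/\frac{2\pi}{\omega}\mathbb{Z}^d$, and a real analytic function $f:\mathbb{C}\to\mathbb{C}$ with $f(0)\neq 0$. Consider the equation $$-iu_t=\triangle u+u^pf(u),\qquad x\in\mathbb{T}^d.$$ There exists a constant $\delta>0$, depending on $p$ and $f$, such that for all $u_0\in A_\nu(\mathbb{T}^d)$ and $z_0\in\mathbb{C}$ satisfying $$|z_0|<\delta,\qquad \|u_0\|<\delta|z_0|^{p-1},$$ the following holds: (depending on $z_0$) the solution $u(t)$ with initial data $u(0,x)=z_0+u_0(x)$ exists for all $t\ge 0$ and converges to $0$ as $t\to+\infty$, or exists for all $t\le 0$ and converges to $0$ as $t\to-\infty$. Furthermore, let $\zeta(t)$ denote the solution of $\dot z=iz^pf(z)$ with initial condition $\zeta(0)=z_0$. Then there exists a constant $K>0$, depending on $z_0$ and $u_0$, such that $$|\zeta(t)|\le K|t|^{-1/(p-1)},\qquad \|u(t)-\zeta(t)\|\le K|t|^{-p/(p-1)}$$ as $t\to+\infty$ (in the first case) or as $t\to-\infty$ (in the second case).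
   Context: $\mathbb{T}^d=\mathbb{R}^d/\frac{2\pi}{\omega}\mathbb{Z}^d$ is the torus with period $2\pi/\omega_j$ in the $j$-th coordinate. For $k\in\mathbb{Z}^d$ put $|k|=|k_1|+\dots+|k_d|$ and $k\omega x=\sum_j k_j\omega_jx_j$. For $u\in L^1(\mathbb{T}^d)$ let $\hat u(k)=\frac{1}{\mathrm{vol}(\mathbb{T}^d)}\int_{\mathbb{T}^d}u(x)e^{-i\omega kx}dx$ and $\|u\|=\sum_{k\in\mathbb{Z}^d}|\hat u(k)|\nu^{|k|}$. The weighted Wiener algebra $A_\nu(\mathbb{T}^d)$ is the set of complex valued $u\in L^1(\mathbb{T}^d)$ with $\|u\|<\infty$. "Real analytic $f:\mathbb{C}\to\mathbb{C}$" means that $f$ may be written as a (convergent) power series in $u$ and its complex conjugate $u^*$. Complex numbers are identified with constant functions; convergence of $u(t)$ is in $A_\nu(\mathbb{T}^d)$. Solutions are curves $t\mapsto u(t)\in A_\nu(\mathbb{T}^d)$ whose Fourier coefficients satisfy the system of ODEs obtained from the equation (equivalently, its variation of constants formula). *)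

theory Defs
  imports "HOL-Analysis.Analysis"
begin

text \<open>
  The dimension \<open>d\<close> is an explicit natural number rather than a type, so that constants can be
  required not to depend on it. Points of the torus and frequencies are functions on the index
  set \<open>{..<d}\<close> (extensional, i.e. \<open>undefined\<close> elsewhere). The torus is represented, as a measure
  space, by a fundamental cell of the lattice of periods; a function on the torus is a function
  whose values outside this cell are ignored, and elements of \<open>L\<^sup>1\<close> are considered up to almost
  everywhere equality.
\<close>

definition torus :: "nat \<Rightarrow> (nat \<Rightarrow> real) \<Rightarrow> (nat \<Rightarrow> real) measure" where
  "torus d \<omega> = Pi\<^sub>M {..<d} (\<lambda>j. restrict_space lborel {0..<2 * pi / \<bar>\<omega> j\<bar>})"

definition freqs :: "nat \<Rightarrow> (nat \<Rightarrow> int) set" where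
  "freqs d = {..<d} \<rightarrow>\<^sub>E UNIV"

definition fourier_coeff ::
  "nat \<Rightarrow> (nat \<Rightarrow> real) \<Rightarrow> ((nat \<Rightarrow> real) \<Rightarrow> complex) \<Rightarrow> (nat \<Rightarrow> int) \<Rightarrow> complex" where
  "fourier_coeff d \<omega> u k =
     (\<integral>x. u x * exp (- \<i> * complex_of_real (\<Sum>j<d. of_int (k j) * \<omega> j * x j)) \<partial>torus d \<omega>)
       / complex_of_real (measure (torus d \<omega>) (space (torus d \<omega>)))"

definition wiener_weight :: "nat \<Rightarrow> real \<Rightarrow> (nat \<Rightarrow> int) \<Rightarrow> real" where
  "wiener_weight d \<nu> k = \<nu> ^ nat (\<Sum>j<d. \<bar>k j\<bar>)"

definition wiener_algebra ::
  "nat \<Rightarrow> (nat \<Rightarrow> real) \<Rightarrow> real \<Rightarrow> ((nat \<Rightarrow> real) \<Rightarrow> complex) set" where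
  "wiener_algebra d \<omega> \<nu> =
     {u. integrable (torus d \<omega>) u \<and>
         (\<lambda>k. cmod (fourier_coeff d \<omega> u k) * wiener_weight d \<nu> k) summable_on freqs d}"

text \<open>The following is meaningful only for elements of \<^const>\<open>wiener_algebra\<close>.\<close>

definition wiener_norm ::
  "nat \<Rightarrow> (nat \<Rightarrow> real) \<Rightarrow> real \<Rightarrow> ((nat \<Rightarrow> real) \<Rightarrow> complex) \<Rightarrow> real" where
  "wiener_norm d \<omega> \<nu> u =
     (\<Sum>\<^sub>\<infinity>k\<in>freqs d. cmod (fourier_coeff d \<omega> u k) * wiener_weight d \<nu> k)"

text \<open>Power series in \<open>u\<close> and its conjugate, converging (absolutely) to \<open>f\<close> on all of the plane.\<close>

definition real_analytic :: "(complex \<Rightarrow> complex) \<Rightarrow> bool" where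
  "real_analytic f \<longleftrightarrow>
     (\<exists>a :: nat \<Rightarrow> nat \<Rightarrow> complex.
        \<forall>u. ((\<lambda>(m, n). a m n * u ^ m * cnj u ^ n) has_sum f u) UNIV)"

text \<open>
  Solutions of \<open>-\<i> u\<^sub>t = \<triangle>u + u\<^sup>p f(u)\<close> on a time interval \<open>J\<close>: continuous curves in the Wiener
  algebra whose Fourier coefficients satisfy the resulting system of ordinary differential
  equations. On the mode \<open>k\<close> the Laplacian is multiplication by \<open>- (\<Sum>j<d. (k j * \<omega> j)\<^sup>2)\<close>.
\<close>

definition nls_solution ::
  "nat \<Rightarrow> (nat \<Rightarrow> real) \<Rightarrow> real \<Rightarrow> nat \<Rightarrow> (complex \<Rightarrow> complex) \<Rightarrow> real set
    \<Rightarrow> ((nat \<Rightarrow> real) \<Rightarrow> complex) \<Rightarrow> (real \<Rightarrow> (nat \<Rightarrow> real) \<Rightarrow> complex) \<Rightarrow> bool" where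
  "nls_solution d \<omega> \<nu> p f J w u \<longleftrightarrow>
     (\<forall>t\<in>J. u t \<in> wiener_algebra d \<omega> \<nu>) \<and>
     (\<forall>t\<in>J. ((\<lambda>s. wiener_norm d \<omega> \<nu> (\<lambda>x. u s x - u t x)) \<longlongrightarrow> 0) (at t within J)) \<and>
     (\<forall>k\<in>freqs d. \<forall>t\<in>J.
        ((\<lambda>s. fourier_coeff d \<omega> (u s) k) has_vector_derivative
          \<i> * (- complex_of_real (\<Sum>j<d. (of_int (k j) * \<omega> j)\<^sup>2) * fourier_coeff d \<omega> (u t) k
               + fourier_coeff d \<omega> (\<lambda>x. u t x ^ p * f (u t x)) k)) (at t within J)) \<and>
     (AE x in torus d \<omega>. u 0 x = w x)"

definition scalar_solution ::
  "nat \<Rightarrow> (complex \<Rightarrow> complex) \<Rightarrow> real set \<Rightarrow> complex \<Rightarrow> (real \<Rightarrow> complex) \<Rightarrow> bool" where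
  "scalar_solution p f J z \<zeta> \<longleftrightarrow>
     (\<forall>t\<in>J. (\<zeta> has_vector_derivative \<i> * \<zeta> t ^ p * f (\<zeta> t)) (at t within J)) \<and> \<zeta> 0 = z"

text \<open>
  ``The'' solution on \<open>J\<close>: a solution on \<open>J\<close> with which every solution with the same initial
  data on a subinterval of \<open>J\<close> containing \<open>0\<close> agrees.
\<close>

definition the_nls_solution ::
  "nat \<Rightarrow> (nat \<Rightarrow> real) \<Rightarrow> real \<Rightarrow> nat \<Rightarrow> (complex \<Rightarrow> complex) \<Rightarrow> real set
    \<Rightarrow> ((nat \<Rightarrow> real) \<Rightarrow> complex) \<Rightarrow> (real \<Rightarrow> (nat \<Rightarrow> real) \<Rightarrow> complex) \<Rightarrow> bool" where
  "the_nls_solution d \<omega> \<nu> p f J w u \<longleftrightarrow>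
     nls_solution d \<omega> \<nu> p f J w u \<and>
     (\<forall>J' v. is_interval J' \<and> 0 \<in> J' \<and> J' \<subseteq> J \<and> nls_solution d \<omega> \<nu> p f J' w v \<longrightarrow>
        (\<forall>t\<in>J'. AE x in torus d \<omega>. v t x = u t x))"

definition the_scalar_solution ::
  "nat \<Rightarrow> (complex \<Rightarrow> complex) \<Rightarrow> real set \<Rightarrow> complex \<Rightarrow> (real \<Rightarrow> complex) \<Rightarrow> bool" where
  "the_scalar_solution p f J z \<zeta> \<longleftrightarrow>
     scalar_solution p f J z \<zeta> \<and>
     (\<forall>J' \<xi>. is_interval J' \<and> 0 \<in> J' \<and> J' \<subseteq> J \<and> scalar_solution p f J' z \<xi> \<longrightarrow>
        (\<forall>t\<in>J'. \<xi> t = \<zeta> t))"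

text \<open>
  Existence, convergence to \<open>0\<close> and decay rates on the unbounded interval \<open>J\<close> along the filter
  \<open>F\<close>; used with \<open>{0..}\<close>, \<^const>\<open>at_top\<close> and with \<open>{..0}\<close>, \<^const>\<open>at_bot\<close>.
\<close>

definition global_decay ::
  "nat \<Rightarrow> (nat \<Rightarrow> real) \<Rightarrow> real \<Rightarrow> nat \<Rightarrow> (complex \<Rightarrow> complex) \<Rightarrow> real set \<Rightarrow> real filter
    \<Rightarrow> complex \<Rightarrow> ((nat \<Rightarrow> real) \<Rightarrow> complex) \<Rightarrow> bool" where
  "global_decay d \<omega> \<nu> p f J F z0 u0 \<longleftrightarrow>
     (\<exists>u \<zeta>.
        the_nls_solution d \<omega> \<nu> p f J (\<lambda>x. z0 + u0 x) u \<and>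
        ((\<lambda>t. wiener_norm d \<omega> \<nu> (u t)) \<longlongrightarrow> 0) F \<and>
        the_scalar_solution p f J z0 \<zeta> \<and>
        (\<exists>K>0. \<forall>\<^sub>F t in F.
           cmod (\<zeta> t) \<le> K * \<bar>t\<bar> powr (- 1 / (real p - 1)) \<and>
           wiener_norm d \<omega> \<nu> (\<lambda>x. u t x - \<zeta> t) \<le> K * \<bar>t\<bar> powr (- real p / (real p - 1))))"

end

theory Submission
  imports Defs
begin

text \<open>
  The solution is compared with the spatially constant one. Let \<open>N u = u\<^sup>p f(u)\<close> and let \<open>\<zeta>\<close>
  solve \<open>\<zeta>' = \<i> N \<zeta>\<close>, \<open>\<zeta>(0) = z0\<close>. The function \<open>q = (z0 / \<zeta>)\<^sup>p\<^sup>-\<^sup>1\<close> satisfies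
  \<open>q' = c f(\<zeta>) / f(0)\<close> with \<open>c = - \<i> (p - 1) f(0) z0\<^sup>p\<^sup>-\<^sup>1\<close>, and so it stays relatively
  close to \<open>1 + c t\<close> as long as \<open>\<zeta>\<close> is small. If \<open>Re c \<ge> 0\<close>, then \<open>1 + c t\<close> avoids the branch
  cut of the root and is at least \<open>(1 + \<bar>c\<bar> t) / 2\<close> in modulus for \<open>t \<ge> 0\<close>; hence \<open>\<zeta>\<close> decays
  forward in time like \<open>t\<close> to the power \<open>-1 / (p - 1)\<close>. If \<open>Re c < 0\<close>, the same happens backward
  in time. So the direction is determined by \<open>z0\<close> alone; a sign \<open>\<sigma>\<close> turns both cases into one
  on the half-line \<open>t \<ge> 0\<close>. This is \<open>decaying_scalar_solution\<close>.

  For \<open>u = \<zeta> + v\<close> the linear term \<open>p \<zeta>\<^sup>p\<^sup>-\<^sup>1 f(\<zeta>) v\<close> has size \<open>v / t\<close>, which is not integrable in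
  time. But \<open>\<zeta>\<^sup>p\<close> solves \<open>g' = \<i> p \<zeta>\<^sup>p\<^sup>-\<^sup>1 f(\<zeta>) g\<close>, so the substitution \<open>v = \<zeta>\<^sup>p exp(\<i> t \<triangle>) y\<close>
  removes this term exactly and leaves \<open>y' = \<i> exp(- \<i> t \<triangle>) (R / \<zeta>\<^sup>p)\<close> with the remainder
  \<open>R = N(\<zeta> + v) - N(\<zeta>) - p \<zeta>\<^sup>p\<^sup>-\<^sup>1 f(\<zeta>) v\<close>. On the ball of radius \<open>\<rho>\<close> the right-hand side is
  Lipschitz in \<open>y\<close> with constant \<open>C (\<bar>\<zeta>\<bar>\<^sup>p + \<rho> \<bar>\<zeta>\<bar>\<^sup>2\<^sup>p\<^sup>-\<^sup>2)\<close> (\<open>wbound_scaled_remainder_diff\<close>), and the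
  integral of this over the half-line is of order \<open>\<bar>z0\<bar> + \<rho> \<bar>z0\<bar>\<^sup>p\<^sup>-\<^sup>1\<close>. The data give
  \<open>\<parallel>y(0)\<parallel> < \<delta> / \<bar>z0\<bar>\<close>, so with \<open>\<rho> = 2 \<delta> / \<bar>z0\<bar>\<close> the integral equation is a contraction on
  bounded continuous curves on the whole half-line (\<open>profile_exists\<close>). The bound \<open>\<parallel>y\<parallel> \<le> \<rho>\<close> gives
  \<open>\<parallel>u - \<zeta>\<parallel> \<le> \<rho> \<bar>\<zeta>\<bar>\<^sup>p\<close>, which is the asserted rate. All constants come from the power series of
  \<open>f\<close> and from the fact that the Wiener norm is submultiplicative and invariant under conjugation
  and under the free evolution, for all \<open>d\<close>, \<open>\<omega>\<close> and \<open>\<nu> \<ge> 1\<close>; therefore \<open>\<delta>\<close> depends on \<open>p\<close> and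
  \<open>f\<close> only.

  Since \<open>d\<close>, \<open>\<omega>\<close> and \<open>\<nu>\<close> are terms, curves are taken in one Banach space, the absolutely
  summable families of complex numbers, into which the Wiener algebra is mapped isometrically by
  multiplying Fourier coefficients with their weights; products and power series are estimated
  for functions, through the predicate \<open>wbound\<close>. That an integrable function is determined
  almost everywhere by its Fourier coefficients (\<open>fourier_coeff_eq_0_imp_AE_eq_0\<close>) follows
  from the Stone--Weierstrass theorem on the circle and a generator of the product sigma-algebra.
  A solution satisfies its equations only coefficient by coefficient, and so uniqueness rests on
  a Gronwall estimate for finite sums of coefficients (\<open>coefficientwise_gronwall\<close>).
\<close>

section \<open>Absolutely summable families\<close>

lemma abs_summable_on_leI:
  fixes a :: "'a \<Rightarrow> 'b::real_normed_vector"
  assumes "\<And>F. finite F \<Longrightarrow> F \<subseteq> A \<Longrightarrow> (\<Sum>k\<in>F. norm (a k)) \<le> B"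
  shows "(\<lambda>k. norm (a k)) summable_on A" and "(\<Sum>\<^sub>\<infinity>k\<in>A. norm (a k)) \<le> B"
proof -
  show *: "(\<lambda>k. norm (a k)) summable_on A"
    by (rule nonneg_bounded_partial_sums_imp_summable_on[where C=B])
       (auto intro!: eventually_finite_subsets_at_top_weakI assms)
  show "(\<Sum>\<^sub>\<infinity>k\<in>A. norm (a k)) \<le> B"
    by (rule infsum_le_finite_sums[OF *]) (use assms in auto)
qed

lemma abs_summable_on_add:
  fixes a b :: "'a \<Rightarrow> 'b::real_normed_vector"
  assumes "(\<lambda>k. norm (a k)) summable_on A" "(\<lambda>k. norm (b k)) summable_on A"
  shows "(\<lambda>k. norm (a k + b k)) summable_on A" "(\<lambda>k. norm (a k - b k)) summable_on A"
  using summable_on_add[OF assms]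
  by (rule summable_on_comparison_test; auto intro: norm_triangle_ineq norm_triangle_ineq4)+

text \<open>
  The Banach space in which all curves live. It is shared by the Wiener algebras of all dimensions
  and weights: a family holds the Fourier coefficients already multiplied by their weights.
\<close>
typedef 'a ell1 = "{a :: 'a \<Rightarrow> complex. (\<lambda>k. norm (a k)) summable_on UNIV}"
  morphisms coord Abs_ell1
  by (rule exI[of _ "\<lambda>_. 0"]) simp

setup_lifting type_definition_ell1

lemma coord_summable: "(\<lambda>k. norm (coord A k)) summable_on UNIV"
  using coord[of A] by simp

lemma ell1_eqI: "(\<And>k. coord A k = coord B k) \<Longrightarrow> A = B"
  by (simp add: coord_inject[symmetric] ext)

instantiation ell1 :: (type) real_normed_vector
begin

lift_definition zero_ell1 :: "'a ell1" is "\<lambda>_. 0" by simp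

lift_definition plus_ell1 :: "'a ell1 \<Rightarrow> 'a ell1 \<Rightarrow> 'a ell1" is "\<lambda>a b k. a k + b k"
  by (rule abs_summable_on_add)

lift_definition uminus_ell1 :: "'a ell1 \<Rightarrow> 'a ell1" is "\<lambda>a k. - a k" by simp

lift_definition minus_ell1 :: "'a ell1 \<Rightarrow> 'a ell1 \<Rightarrow> 'a ell1" is "\<lambda>a b k. a k - b k"
  by (rule abs_summable_on_add)

lift_definition scaleR_ell1 :: "real \<Rightarrow> 'a ell1 \<Rightarrow> 'a ell1" is "\<lambda>r a k. r *\<^sub>R a k"
  by (auto simp: norm_mult intro!: summable_on_cmult_right)

lift_definition norm_ell1 :: "'a ell1 \<Rightarrow> real" is "\<lambda>a. \<Sum>\<^sub>\<infinity>k. norm (a k)" .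

definition "dist (A :: 'a ell1) B = norm (A - B)"
definition "sgn (A :: 'a ell1) = inverse (norm A) *\<^sub>R A"
definition [code del]:
  "(uniformity :: ('a ell1 \<times> 'a ell1) filter) = (INF e\<in>{0<..}. principal {(x, y). dist x y < e})"
definition open_ell1 :: "'a ell1 set \<Rightarrow> bool" where [code del]:
  "open_ell1 S \<longleftrightarrow> (\<forall>x\<in>S. \<forall>\<^sub>F (x', y) in uniformity. x' = x \<longrightarrow> y \<in> S)"

instance
proof
  fix A B C :: "'a ell1" and r s :: real
  show "A + B + C = A + (B + C)" "A + B = B + A" "0 + A = A" "- A + A = 0" "A - B = A + - B"
    "r *\<^sub>R (A + B) = r *\<^sub>R A + r *\<^sub>R B" "(r + s) *\<^sub>R A = r *\<^sub>R A + s *\<^sub>R A"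
    "r *\<^sub>R s *\<^sub>R A = (r * s) *\<^sub>R A" "1 *\<^sub>R A = A"
    by (transfer; simp add: algebra_simps)+
  show "dist A B = norm (A - B)" "sgn A = inverse (norm A) *\<^sub>R A"
    by (simp_all add: dist_ell1_def sgn_ell1_def)
  show "norm A = 0 \<longleftrightarrow> A = 0"
  proof
    assume "norm A = 0"
    then show "A = 0"
      by transfer (auto intro!: ext dest: nonneg_infsum_le_0D[OF eq_refl])
  qed (transfer, simp)
  show "norm (A + B) \<le> norm A + norm B"
  proof transfer
    fix a b :: "'a \<Rightarrow> complex"
    assume s: "(\<lambda>k. norm (a k)) summable_on UNIV" "(\<lambda>k. norm (b k)) summable_on UNIV"
    show "(\<Sum>\<^sub>\<infinity>k. norm (a k + b k)) \<le> (\<Sum>\<^sub>\<infinity>k. norm (a k)) + (\<Sum>\<^sub>\<infinity>k. norm (b k))"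
    proof (rule abs_summable_on_leI(2))
      fix F :: "'a set" assume "finite F"
      have "(\<Sum>k\<in>F. norm (a k + b k)) \<le> (\<Sum>k\<in>F. norm (a k)) + (\<Sum>k\<in>F. norm (b k))"
        by (simp add: sum.distrib[symmetric] sum_mono norm_triangle_ineq)
      also have "\<dots> \<le> (\<Sum>\<^sub>\<infinity>k. norm (a k)) + (\<Sum>\<^sub>\<infinity>k. norm (b k))"
        using s \<open>finite F\<close> by (intro add_mono finite_sum_le_infsum) auto
      finally show "(\<Sum>k\<in>F. norm (a k + b k)) \<le> \<dots>" .
    qed
  qed
  show "norm (r *\<^sub>R A) = \<bar>r\<bar> * norm A"
    by transfer (simp add: infsum_cmult_right')
qed (simp_all add: uniformity_ell1_def open_ell1_def)

end

lemma coord_simps [simp]: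
  "coord 0 k = 0" "coord (A + B) k = coord A k + coord B k" "coord (- A) k = - coord A k"
  "coord (A - B) k = coord A k - coord B k" "coord (r *\<^sub>R A) k = r *\<^sub>R coord A k"
  by (transfer; simp)+

lemma norm_ell1_eq: "norm A = (\<Sum>\<^sub>\<infinity>k. norm (coord A k))"
  by transfer simp

lemma sum_coord_le_norm: "finite F \<Longrightarrow> (\<Sum>k\<in>F. norm (coord A k)) \<le> norm A"
  unfolding norm_ell1_eq by (rule finite_sum_le_infsum) (auto intro: coord_summable)

lemma norm_coord_le: "norm (coord A k) \<le> norm A"
  using sum_coord_le_norm[of "{k}" A] by simp

lemma norm_ell1_leI:
  assumes "\<And>F. finite F \<Longrightarrow> (\<Sum>k\<in>F. norm (coord A k)) \<le> B"
  shows "norm A \<le> B"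
  unfolding norm_ell1_eq by (rule abs_summable_on_leI(2)) (use assms in auto)

lemma bounded_linear_coord: "bounded_linear (\<lambda>A. coord A k)"
  by (rule bounded_linear_intro[where K=1]) (auto simp: norm_coord_le)

instance ell1 :: (type) banach
proof
  fix X :: "nat \<Rightarrow> 'a ell1" assume X: "Cauchy X"
  have "\<exists>l. (\<lambda>n. coord (X n) k) \<longlonglongrightarrow> l" for k
    using bounded_linear.Cauchy[OF bounded_linear_coord X, of k] Cauchy_convergent
    unfolding convergent_def by blast
  then obtain a where a: "\<And>k. (\<lambda>n. coord (X n) k) \<longlonglongrightarrow> a k" by metis
  have bnd: "\<exists>N. \<forall>n\<ge>N. \<forall>F. finite F \<longrightarrow> (\<Sum>k\<in>F. norm (coord (X n) k - a k)) \<le> e" if "e > 0" for e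
  proof -
    obtain N where N: "\<And>m n. m \<ge> N \<Longrightarrow> n \<ge> N \<Longrightarrow> norm (X m - X n) < e"
      using X \<open>e > 0\<close> unfolding Cauchy_iff by blast
    have "(\<Sum>k\<in>F. norm (coord (X n) k - a k)) \<le> e" if "n \<ge> N" "finite F" for n F
    proof (rule tendsto_upperbound)
      show "(\<lambda>m. \<Sum>k\<in>F. norm (coord (X n) k - coord (X m) k)) \<longlonglongrightarrow> (\<Sum>k\<in>F. norm (coord (X n) k - a k))"
        by (intro tendsto_intros a)
      show "\<forall>\<^sub>F m in sequentially. (\<Sum>k\<in>F. norm (coord (X n) k - coord (X m) k)) \<le> e"
        using eventually_ge_at_top[of N]
      proof eventually_elim
        case (elim m)
        have "(\<Sum>k\<in>F. norm (coord (X n - X m) k)) \<le> norm (X n - X m)"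
          by (rule sum_coord_le_norm) fact
        also have "\<dots> \<le> e" using N[of n m] elim that by simp
        finally show ?case by simp
      qed
    qed simp
    then show ?thesis by blast
  qed
  obtain N where N: "\<And>F. finite F \<Longrightarrow> (\<Sum>k\<in>F. norm (coord (X N) k - a k)) \<le> 1"
    using bnd[of 1] by auto
  have "(\<lambda>k. norm (a k)) summable_on UNIV"
  proof (rule abs_summable_on_leI(1))
    fix F :: "'a set" assume F: "finite F"
    have "(\<Sum>k\<in>F. norm (a k)) \<le> (\<Sum>k\<in>F. norm (coord (X N) k - a k) + norm (coord (X N) k))"
      by (rule sum_mono) (metis norm_minus_commute norm_triangle_sub add.commute)
    also have "\<dots> \<le> 1 + norm (X N)"
      using N[OF F] sum_coord_le_norm[OF F, of "X N"] by (simp add: sum.distrib)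
    finally show "(\<Sum>k\<in>F. norm (a k)) \<le> 1 + norm (X N)" .
  qed
  then have c: "coord (Abs_ell1 a) k = a k" for k by (simp add: Abs_ell1_inverse)
  have "X \<longlonglongrightarrow> Abs_ell1 a"
  proof (rule LIMSEQ_I)
    fix r :: real assume "r > 0"
    then obtain N where N: "\<And>n F. n \<ge> N \<Longrightarrow> finite F \<Longrightarrow> (\<Sum>k\<in>F. norm (coord (X n) k - a k)) \<le> r/2"
      using bnd[of "r/2"] by auto
    have "norm (X n - Abs_ell1 a) < r" if "n \<ge> N" for n
    proof -
      have "norm (X n - Abs_ell1 a) \<le> r/2"
        by (rule norm_ell1_leI) (use N that in \<open>simp add: c\<close>)
      then show ?thesis using \<open>r > 0\<close> by simp
    qed
    then show "\<exists>no. \<forall>n\<ge>no. norm (X n - Abs_ell1 a) < r" by blast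
  qed
  then show "convergent X" by (auto simp: convergent_def)
qed


text \<open>
  Bounded Fourier multipliers: the free evolution and the multiplication by scalars.
\<close>
definition multiplier :: "('a \<Rightarrow> complex) \<Rightarrow> 'a ell1 \<Rightarrow> 'a ell1" where
  "multiplier m A = Abs_ell1 (\<lambda>k. m k * coord A k)"

lemma
  assumes "\<And>k. norm (m k) \<le> B"
  shows coord_multiplier: "coord (multiplier m A) k = m k * coord A k" and norm_multiplier_le: "norm (multiplier m A) \<le> B * norm A"
proof -
  have s: "(\<Sum>k\<in>F. norm (m k * coord A k)) \<le> B * norm A" if "finite F" for F
  proof -
    have "(\<Sum>k\<in>F. norm (m k * coord A k)) \<le> B * (\<Sum>k\<in>F. norm (coord A k))"
      unfolding sum_distrib_left by (intro sum_mono) (simp add: norm_mult assms mult_right_mono)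
    also have "\<dots> \<le> B * norm A"
      using assms norm_ge_zero order_trans sum_coord_le_norm[OF that] by (intro mult_left_mono) blast+
    finally show ?thesis .
  qed
  show c: "coord (multiplier m A) k = m k * coord A k" for k
    unfolding multiplier_def using abs_summable_on_leI(1)[OF s] by (subst Abs_ell1_inverse) auto
  show "norm (multiplier m A) \<le> B * norm A"
    by (rule norm_ell1_leI) (use s in \<open>simp add: c\<close>)
qed

lemma multiplier_diff:
  assumes "\<And>k. norm (m k) \<le> B"
  shows "multiplier m (A - A') = multiplier m A - multiplier m A'"
  by (rule ell1_eqI) (simp add: coord_multiplier[OF assms] algebra_simps)

text \<open>
  The multipliers need not be continuous in the operator norm, only coefficient by coefficient;
  for the free evolution this is its strong continuity.
\<close>
lemma continuous_on_multiplier: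
  fixes A :: "'t::metric_space \<Rightarrow> 'a ell1"
  assumes A: "continuous_on T A" and m: "\<And>k. continuous_on T (\<lambda>t. m t k)"
    and B: "\<And>t k. t \<in> T \<Longrightarrow> norm (m t k) \<le> B"
  shows "continuous_on T (\<lambda>t. multiplier (m t) (A t))"
  unfolding continuous_on_def
proof
  fix s assume s: "s \<in> T"
  \<comment> \<open>The family is dominated by \<open>2 B \<bar>A(s)\<^sub>k\<bar>\<close>, so the sum converges uniformly in \<open>t\<close>.\<close>
  have mc: "continuous_on T (\<lambda>t. \<Sum>\<^sub>\<infinity>k. norm ((m t k - m s k) * coord (A s) k))"
  proof (rule uniform_limit_theorem)
    show "uniform_limit T (\<lambda>F t. \<Sum>k\<in>F. norm ((m t k - m s k) * coord (A s) k))
       (\<lambda>t. \<Sum>\<^sub>\<infinity>k. norm ((m t k - m s k) * coord (A s) k)) (finite_subsets_at_top UNIV)"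
    proof (rule Weierstrass_m_test_general)
      fix k t assume "t \<in> T"
      then have "norm (m t k - m s k) \<le> 2 * B"
        using norm_triangle_ineq4[of "m t k" "m s k"] B[of t k] B[of s k] s by simp
      then show "norm (norm ((m t k - m s k) * coord (A s) k)) \<le> 2 * B * norm (coord (A s) k)"
        by (simp add: norm_mult mult_right_mono)
    qed (intro summable_on_cmult_right coord_summable)
    show "\<forall>\<^sub>F F in finite_subsets_at_top UNIV. continuous_on T (\<lambda>t. \<Sum>k\<in>F. norm ((m t k - m s k) * coord (A s) k))"
      by (intro always_eventually allI continuous_intros m)
  qed simp
  then have lim: "((\<lambda>t. B * norm (A t - A s) + (\<Sum>\<^sub>\<infinity>k. norm ((m t k - m s k) * coord (A s) k))) \<longlongrightarrow> 0) (at s within T)"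
    using A s unfolding continuous_on_def
    by (auto intro!: tendsto_eq_intros simp del: norm_mult)
  show "((\<lambda>t. multiplier (m t) (A t)) \<longlongrightarrow> multiplier (m s) (A s)) (at s within T)"
  proof (rule Lim_null_comparison[THEN Lim_null[THEN iffD2], OF _ lim])
    show "\<forall>\<^sub>F t in at s within T. norm (multiplier (m t) (A t) - multiplier (m s) (A s)) \<le>
       B * norm (A t - A s) + (\<Sum>\<^sub>\<infinity>k. norm ((m t k - m s k) * coord (A s) k))"
      unfolding eventually_at_filter
    proof (rule always_eventually, intro allI impI)
      fix t assume t: "t \<in> T"
      have "norm (m t k - m s k) \<le> 2 * B" for k
        using norm_triangle_ineq4[of "m t k" "m s k"] B[of t k] B[of s k] s t by simp
      note d = coord_multiplier[of "\<lambda>k. m t k - m s k", OF this]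
      have "multiplier (m t) (A t) - multiplier (m s) (A s) = multiplier (m t) (A t - A s) + multiplier (\<lambda>k. m t k - m s k) (A s)"
        by (rule ell1_eqI)
           (simp add: d coord_multiplier[OF B[OF t]] coord_multiplier[OF B[OF s]] algebra_simps)
      also have "norm \<dots> \<le> norm (multiplier (m t) (A t - A s)) + norm (multiplier (\<lambda>k. m t k - m s k) (A s))"
        by (rule norm_triangle_ineq)
      also have "\<dots> \<le> B * norm (A t - A s) + (\<Sum>\<^sub>\<infinity>k. norm ((m t k - m s k) * coord (A s) k))"
        using norm_multiplier_le[of "m t", OF B[OF t]]
        by (intro add_mono) (simp_all add: norm_ell1_eq[of "multiplier (\<lambda>k. m t k - m s k) (A s)"] d)
      finally show "norm (multiplier (m t) (A t) - multiplier (m s) (A s)) \<le> \<dots>" .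
    qed
  qed
qed

section \<open>Fourier coefficients on the torus\<close>

text \<open>
  Dominated convergence, transported from series over the natural numbers by an enumeration of
  the index set.
\<close>
lemma integral_infsum:
  fixes f :: "'i \<Rightarrow> 'a \<Rightarrow> complex"
  assumes I: "countable I"
    and f: "\<And>i. i \<in> I \<Longrightarrow> integrable M (f i)"
    and le: "\<And>i x. i \<in> I \<Longrightarrow> norm (f i x) \<le> b i"
    and b: "b summable_on I"
    and fin: "finite_measure M"
  shows "integrable M (\<lambda>x. \<Sum>\<^sub>\<infinity>i\<in>I. f i x)"
    and "integral\<^sup>L M (\<lambda>x. \<Sum>\<^sub>\<infinity>i\<in>I. f i x) = (\<Sum>\<^sub>\<infinity>i\<in>I. integral\<^sup>L M (f i))"
proof -
  interpret finite_measure M by fact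
  define N where "N = to_nat_on I ` I"
  define g where "g n x = (if n \<in> N then f (from_nat_into I n) x else 0)" for n x
  define c where "c n = (if n \<in> N then b (from_nat_into I n) else 0)" for n
  have bij: "bij_betw (from_nat_into I) N I"
    unfolding N_def using I
    by (intro bij_betwI[where g="to_nat_on I"]) auto
  have re: "(\<Sum>\<^sub>\<infinity>n. if n \<in> N then h (from_nat_into I n) else 0) = (\<Sum>\<^sub>\<infinity>i\<in>I. h i)"
    "(\<lambda>n. if n \<in> N then h (from_nat_into I n) else 0) summable_on UNIV \<longleftrightarrow> h summable_on I"
    for h :: "'i \<Rightarrow> 'c::{comm_monoid_add,t2_space}"
  proof -
    have "(\<Sum>\<^sub>\<infinity>n. if n \<in> N then h (from_nat_into I n) else 0) = (\<Sum>\<^sub>\<infinity>n\<in>N. h (from_nat_into I n))"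
      by (rule infsum_cong_neutral) auto
    then show "(\<Sum>\<^sub>\<infinity>n. if n \<in> N then h (from_nat_into I n) else 0) = (\<Sum>\<^sub>\<infinity>i\<in>I. h i)"
      by (simp add: infsum_reindex_bij_betw[OF bij])
    have "(\<lambda>n. if n \<in> N then h (from_nat_into I n) else 0) summable_on UNIV \<longleftrightarrow>
        (\<lambda>n. h (from_nat_into I n)) summable_on N"
      by (rule summable_on_cong_neutral) auto
    then show "(\<lambda>n. if n \<in> N then h (from_nat_into I n) else 0) summable_on UNIV \<longleftrightarrow> h summable_on I"
      by (simp add: summable_on_reindex_bij_betw[OF bij])
  qed
  have bI: "n \<in> N \<Longrightarrow> from_nat_into I n \<in> I" for n
    using bij by (auto dest: bij_betw_apply)
  have c: "c summable_on UNIV" using b unfolding c_def re(2) .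
  then have cs: "summable c" by (rule summable_on_imp_summable)
  have gc: "norm (g n x) \<le> c n" for n x
    using le[OF bI] by (auto simp: g_def c_def)
  have gi: "integrable M (g n)" for n
    unfolding g_def using f[OF bI] by (cases "n \<in> N") auto
  have gs: "summable (\<lambda>n. norm (g n x))" for x
    by (rule summable_comparison_test'[OF cs, of 0]) (use gc in auto)
  have gsum: "(\<Sum>n. g n x) = (\<Sum>\<^sub>\<infinity>i\<in>I. f i x)" for x
  proof -
    have "(\<lambda>n. g n x) summable_on UNIV"
      by (rule abs_summable_summable[OF summable_on_comparison_test[OF c]]) (use gc in auto)
    then have "(\<lambda>n. g n x) sums (\<Sum>\<^sub>\<infinity>n. g n x)"
      by (intro has_sum_imp_sums has_sum_infsum)
    then show ?thesis
      unfolding re(1)[of "\<lambda>i. f i x", symmetric] g_def by (simp add: sums_iff)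
  qed
  have ic: "norm (integral\<^sup>L M (h :: 'a \<Rightarrow> complex)) \<le> measure M (space M) * C"
    "integral\<^sup>L M (\<lambda>x. norm (h x)) \<le> measure M (space M) * C"
    if "integrable M h" "\<And>x. norm (h x) \<le> C" for h C
  proof -
    have "integral\<^sup>L M (\<lambda>x. norm (h x)) \<le> integral\<^sup>L M (\<lambda>x. C)"
      by (rule integral_mono) (use that in auto)
    then show "integral\<^sup>L M (\<lambda>x. norm (h x)) \<le> measure M (space M) * C" by simp
    then show "norm (integral\<^sup>L M h) \<le> measure M (space M) * C"
      using integral_norm_bound[of M h] by linarith
  qed
  have ints: "summable (\<lambda>n. integral\<^sup>L M (\<lambda>x. norm (g n x)))"
    by (rule summable_comparison_test'[OF summable_mult[OF cs], of 0])
       (use ic(2)[OF gi gc] in auto)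
  show "integrable M (\<lambda>x. \<Sum>\<^sub>\<infinity>i\<in>I. f i x)"
    using integrable_suminf[OF gi _ ints] gs by (simp add: gsum)
  have "(\<lambda>n. integral\<^sup>L M (g n)) sums integral\<^sup>L M (\<lambda>x. \<Sum>\<^sub>\<infinity>i\<in>I. f i x)"
    using sums_integral[OF gi _ ints] gs by (simp add: gsum)
  moreover have "(\<lambda>n. integral\<^sup>L M (g n)) sums (\<Sum>\<^sub>\<infinity>i\<in>I. integral\<^sup>L M (f i))"
  proof -
    have "(\<lambda>n. integral\<^sup>L M (g n)) summable_on UNIV"
      by (rule abs_summable_summable[OF summable_on_comparison_test[OF summable_on_cmult_right[OF c]]])
         (use ic(1)[OF gi gc] in auto)
    then have "(\<lambda>n. integral\<^sup>L M (g n)) sums (\<Sum>\<^sub>\<infinity>n. integral\<^sup>L M (g n))"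
      by (intro has_sum_imp_sums has_sum_infsum)
    moreover have "integral\<^sup>L M (g n) = (if n \<in> N then integral\<^sup>L M (f (from_nat_into I n)) else 0)" for n
      by (simp add: g_def[abs_def])
    ultimately show ?thesis by (simp add: re(1)[of "\<lambda>i. integral\<^sup>L M (f i)"])
  qed
  ultimately show "integral\<^sup>L M (\<lambda>x. \<Sum>\<^sub>\<infinity>i\<in>I. f i x) = (\<Sum>\<^sub>\<infinity>i\<in>I. integral\<^sup>L M (f i))"
    by (rule sums_unique2)
qed

lemma integral_period_exp:
  assumes "\<omega> \<noteq> (0::real)"
  defines "M \<equiv> restrict_space lborel {0..<2 * pi / \<bar>\<omega>\<bar>}"
  shows "integrable M (\<lambda>x. exp (\<i> * complex_of_real (of_int m * \<omega> * x)))" (is "integrable M ?f")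
    and "integral\<^sup>L M (\<lambda>x. exp (\<i> * complex_of_real (of_int m * \<omega> * x)))
      = (if m = 0 then complex_of_real (2 * pi / \<bar>\<omega>\<bar>) else 0)"
proof -
  define L where "L = 2 * pi / \<bar>\<omega>\<bar>"
  have L: "L > 0" "\<omega> * L = 2 * pi \<or> \<omega> * L = - 2 * pi" using assms by (auto simp: L_def abs_if)
  define F where "F x = (if m = 0 then complex_of_real x else ?f x / (\<i> * complex_of_real (of_int m * \<omega>)))" for x
  have F: "(F has_vector_derivative ?f x) (at x within {0..L})" for x
  proof (cases "m = 0")
    case True
    then show ?thesis unfolding F_def
      by (auto intro!: derivative_eq_intros simp: has_real_derivative_iff_has_vector_derivative[symmetric])
  next
    case False
    then have nz: "\<i> * complex_of_real (of_int m * \<omega>) \<noteq> 0" using assms by simp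
    have "((\<lambda>z. exp (\<i> * complex_of_real (of_int m * \<omega>) * z) / (\<i> * complex_of_real (of_int m * \<omega>)))
        has_field_derivative exp (\<i> * complex_of_real (of_int m * \<omega>) * of_real x)) (at (of_real x))"
      using nz by (auto intro!: derivative_eq_intros)
    from has_vector_derivative_real_field[OF this, of "{0..L}"]
    show ?thesis unfolding F_def using False by (simp add: o_def mult.assoc)
  qed
  have cont: "continuous_on {0..L} ?f" by (intro continuous_intros)
  note FTC = has_bochner_integral_FTC_Icc[OF less_imp_le[OF L(1)] F cont]
  have ae: "AE x in lborel. indicator {0..L} x *\<^sub>R ?f x = indicator {0..<L} x *\<^sub>R ?f x"
    using AE_lborel_singleton[of L] by eventually_elim (auto split: split_indicator)
  have int: "has_bochner_integral lborel (\<lambda>x. indicator {0..<L} x *\<^sub>R ?f x) (F L - F 0)"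
    using FTC ae by (subst (asm) has_bochner_integral_cong_AE) (auto simp: borel_measurable_continuous_onI continuous_intros)
  have FL: "F L - F 0 = (if m = 0 then complex_of_real L else 0)"
  proof (cases "m = 0")
    case False
    have "of_int m * \<omega> * L = of_int (2 * m) * pi \<or> of_int m * \<omega> * L = of_int (2 * (- m)) * pi"
      using L(2) by (auto simp: mult.assoc)
    then have "\<exists>n::int. of_int m * \<omega> * L = of_int (2 * n) * pi" by blast
    then have "?f L = 1" unfolding exp_eq_1 by simp
    then show ?thesis using False by (simp add: F_def)
  qed (simp add: F_def)
  show "integrable M ?f" "integral\<^sup>L M ?f = (if m = 0 then complex_of_real (2 * pi / \<bar>\<omega>\<bar>) else 0)"
    using int FL unfolding M_def L_def[symmetric]
    by (auto simp: integrable_restrict_space integral_restrict_space has_bochner_integral_iff)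
qed

locale wiener_torus =
  fixes d :: nat and \<omega> :: "nat \<Rightarrow> real" and \<nu> :: real
  assumes \<omega>_nonzero: "j < d \<Longrightarrow> \<omega> j \<noteq> 0" and \<nu>_ge_1: "1 \<le> \<nu>"
begin

abbreviation side :: "nat \<Rightarrow> real set" where
  "side j \<equiv> {0..<2 * pi / \<bar>\<omega> j\<bar>}"

abbreviation \<T> :: "(nat \<Rightarrow> real) measure" where
  "\<T> \<equiv> torus d \<omega>"

abbreviation \<F> :: "((nat \<Rightarrow> real) \<Rightarrow> complex) \<Rightarrow> (nat \<Rightarrow> int) \<Rightarrow> complex" where
  "\<F> \<equiv> fourier_coeff d \<omega>"

abbreviation \<A> :: "((nat \<Rightarrow> real) \<Rightarrow> complex) set" where
  "\<A> \<equiv> wiener_algebra d \<omega> \<nu>"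

abbreviation wnorm :: "((nat \<Rightarrow> real) \<Rightarrow> complex) \<Rightarrow> real" where
  "wnorm \<equiv> wiener_norm d \<omega> \<nu>"

abbreviation cell :: "nat \<Rightarrow> real measure" where
  "cell j \<equiv> restrict_space lborel (side j)"

lemma finite_cell: "finite_measure (cell j)"
  by (rule finite_measureI) (subst emeasure_restrict_space, auto simp: space_restrict_space)

sublocale product_sigma_finite cell
  unfolding product_sigma_finite_def by (intro allI finite_measure.axioms(1)[OF finite_cell])

lemma space_torus: "space \<T> = (\<Pi>\<^sub>E j\<in>{..<d}. side j)"
  by (simp add: torus_def space_PiM space_restrict_space)

definition vol :: real where "vol = (\<Prod>j<d. 2 * pi / \<bar>\<omega> j\<bar>)"

lemma vol_pos: "vol > 0"
  unfolding vol_def using \<omega>_nonzero by (intro prod_pos) auto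

lemma emeasure_torus: "emeasure \<T> (space \<T>) = ennreal vol"
proof -
  have "emeasure \<T> (space \<T>) = (\<Prod>j<d. emeasure (cell j) (space (cell j)))"
    unfolding torus_def space_PiM by (rule emeasure_PiM) (rule finite_lessThan, rule sets.top)
  also have "\<dots> = (\<Prod>j<d. ennreal (2 * pi / \<bar>\<omega> j\<bar>))"
    by (intro prod.cong) (auto simp: emeasure_restrict_space space_restrict_space)
  also have "\<dots> = ennreal vol" unfolding vol_def by (intro prod_ennreal) auto
  finally show ?thesis .
qed

sublocale T: finite_measure "\<T>"
  by (rule finite_measureI) (simp add: emeasure_torus)

lemma measure_torus: "measure \<T> (space \<T>) = vol"
  using vol_pos by (simp add: measure_def emeasure_torus)

definition wchar :: "(nat \<Rightarrow> int) \<Rightarrow> (nat \<Rightarrow> real) \<Rightarrow> complex" where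
  "wchar k x = exp (\<i> * complex_of_real (\<Sum>j<d. of_int (k j) * \<omega> j * x j))"

lemma norm_wchar [simp]: "norm (wchar k x) = 1"
  by (simp add: wchar_def)

lemma wchar_prod: "wchar k x = (\<Prod>j<d. exp (\<i> * complex_of_real (of_int (k j) * \<omega> j * x j)))"
  unfolding wchar_def by (simp add: sum_distrib_left exp_sum)

lemma wchar_cong:
  assumes "\<And>j. j < d \<Longrightarrow> k j = l j"
  shows "wchar k x = wchar l x"
  unfolding wchar_prod using assms by (intro prod.cong) auto

lemma wchar_add: "wchar (\<lambda>j. k j + l j) x = wchar k x * wchar l x"
  unfolding wchar_def by (simp add: exp_add[symmetric] algebra_simps sum.distrib)

lemma wchar_uminus: "wchar (\<lambda>j. - k j) x = cnj (wchar k x)"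
  unfolding wchar_def by (simp add: exp_cnj sum_negf)

lemma wchar_diff: "wchar (\<lambda>j. k j - l j) x = wchar k x * cnj (wchar l x)"
  using wchar_add[of k "\<lambda>j. - l j" x] by (simp add: wchar_uminus)

lemma wchar_0: "wchar (\<lambda>j. 0) x = 1" by (simp add: wchar_def)

lemma wchar_measurable [measurable]: "wchar k \<in> borel_measurable \<T>"
proof -
  have [measurable]: "(\<lambda>x. x j) \<in> borel_measurable \<T>" if "j < d" for j
  proof -
    have "(\<lambda>x. x j) \<in> measurable \<T> (cell j)"
      unfolding torus_def using that by (intro measurable_component_singleton) auto
    then have "(\<lambda>x. x j) \<in> measurable \<T> lborel"
      unfolding measurable_restrict_space2_iff by blast
    then show ?thesis by simp
  qed
  show ?thesis unfolding wchar_def by measurable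
qed

lemma integral_wchar:
  "integral\<^sup>L \<T> (wchar k) = (if \<forall>j<d. k j = 0 then complex_of_real vol else 0)"
proof -
  have "integral\<^sup>L \<T> (wchar k) = (\<Prod>j<d. integral\<^sup>L (cell j) (\<lambda>x. exp (\<i> * complex_of_real (of_int (k j) * \<omega> j * x))))"
    unfolding wchar_prod[abs_def] torus_def
    by (rule product_integral_prod) (rule finite_lessThan, rule integral_period_exp, rule \<omega>_nonzero, simp)
  also have "\<dots> = (\<Prod>j<d. if k j = 0 then complex_of_real (2 * pi / \<bar>\<omega> j\<bar>) else 0)"
    by (intro prod.cong refl integral_period_exp \<omega>_nonzero) auto
  also have "\<dots> = (if \<forall>j<d. k j = 0 then complex_of_real vol else 0)"
    by (auto simp: vol_def prod_zero_iff)
  finally show ?thesis .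
qed

lemma integral_wchar_wchar:
  assumes "k \<in> freqs d" "l \<in> freqs d"
  shows "(\<integral>x. wchar k x * cnj (wchar l x) \<partial>\<T>) = (if k = l then complex_of_real vol else 0)"
proof -
  have "(\<forall>j<d. k j - l j = 0) \<longleftrightarrow> k = l"
    using assms PiE_ext[of k "{..<d}" "\<lambda>_. UNIV" l] unfolding freqs_def by auto
  then show ?thesis unfolding wchar_diff[symmetric] integral_wchar by simp
qed

lemma fourier_coeff_eq:
  "\<F> u k = (\<integral>x. u x * cnj (wchar k x) \<partial>\<T>) / complex_of_real vol"
  unfolding fourier_coeff_def measure_torus wchar_def by (simp add: exp_cnj)

lemma countable_freqs: "countable (freqs d)"
  unfolding freqs_def by (intro countable_PiE) auto

text \<open>
  Used for absolutely summable coefficients only, so that the sum exists at every point.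
\<close>
definition series :: "((nat \<Rightarrow> int) \<Rightarrow> complex) \<Rightarrow> (nat \<Rightarrow> real) \<Rightarrow> complex" where
  "series a x = (\<Sum>\<^sub>\<infinity>k\<in>freqs d. a k * wchar k x)"

lemma series_has_sum:
  assumes "(\<lambda>k. norm (a k)) summable_on freqs d"
  shows "((\<lambda>k. a k * wchar k x) has_sum series a x) (freqs d)"
  unfolding series_def
  by (rule has_sum_infsum[OF abs_summable_summable]) (simp add: norm_mult assms)

lemma integrable_wchar [simp]: "integrable \<T> (wchar k)"
  by (rule T.integrable_const_bound[where B=1]) auto

lemma integrable_mult_wchar:
  assumes "integrable \<T> u"
  shows "integrable \<T> (\<lambda>x. u x * cnj (wchar l x))"
  unfolding wchar_uminus[symmetric]
  by (rule Bochner_Integration.integrable_bound[OF assms]) (use assms in \<open>auto simp: norm_mult\<close>)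

lemma integrable_series:
  assumes "(\<lambda>k. norm (a k)) summable_on freqs d"
  shows "integrable \<T> (series a)"
  unfolding series_def[abs_def]
  by (rule integral_infsum(1)[OF countable_freqs _ _ assms T.finite_measure_axioms]) (auto simp: norm_mult)

lemma fourier_coeff_series:
  assumes a: "(\<lambda>k. norm (a k)) summable_on freqs d" and l: "l \<in> freqs d"
  shows "\<F> (series a) l = a l"
proof -
  have "(\<integral>x. series a x * cnj (wchar l x) \<partial>\<T>) =
      (\<integral>x. (\<Sum>\<^sub>\<infinity>k\<in>freqs d. a k * (wchar k x * cnj (wchar l x))) \<partial>\<T>)"
    unfolding series_def by (subst infsum_cmult_left'[symmetric]) (simp only: mult.assoc)
  also have "\<dots> = (\<Sum>\<^sub>\<infinity>k\<in>freqs d. (\<integral>x. a k * (wchar k x * cnj (wchar l x)) \<partial>\<T>))"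
    by (rule integral_infsum(2)[OF countable_freqs _ _ a T.finite_measure_axioms])
       (auto simp: norm_mult intro!: integrable_mult_right integrable_mult_wchar)
  also have "\<dots> = (\<Sum>\<^sub>\<infinity>k\<in>{l}. a k * complex_of_real vol)"
    using l by (intro infsum_cong_neutral) (auto simp: integral_wchar_wchar)
  finally show ?thesis using vol_pos by (simp add: fourier_coeff_eq)
qed

end

section \<open>Uniqueness of Fourier coefficients\<close>

text \<open>
  The cells are half-open, and yet these arcs are closed: an initial segment of a cell is either
  compact or the whole cell, whose image is the whole circle.
\<close>
lemma cis_image_closed_initial_arc:
  assumes "\<omega> \<noteq> (0::real)"
  shows "closed ((\<lambda>t. cis (\<omega> * t)) ` ({..a} \<inter> {0..<2 * pi / \<bar>\<omega>\<bar>}))"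
proof -
  define L where "L = 2 * pi / \<bar>\<omega>\<bar>"
  have L: "L > 0" "\<omega> * L = 2 * pi \<or> \<omega> * L = - (2 * pi)" using assms by (auto simp: L_def abs_if)
  then have cL: "cis (\<omega> * L) = 1" by (auto simp: cis.ctr complex_eq_iff)
  have cl: "closed ((\<lambda>t. cis (\<omega> * t)) ` {0..b})" for b
    by (intro compact_imp_closed compact_continuous_image continuous_intros) auto
  show ?thesis
  proof (cases "a < L")
    case True
    then have "{..a} \<inter> {0..<L} = {0..a}" by auto
    then show ?thesis using cl unfolding L_def by simp
  next
    case False
    then have "{..a} \<inter> {0..<L} = {0..<L}" by auto
    moreover have "(\<lambda>t. cis (\<omega> * t)) ` {0..<L} = (\<lambda>t. cis (\<omega> * t)) ` {0..L}"
    proof -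
      have "{0..L} = insert L {0..<L}" using L by auto
      moreover have "cis (\<omega> * L) \<in> (\<lambda>t. cis (\<omega> * t)) ` {0..<L}"
        unfolding cL using L by (auto intro!: image_eqI[of _ _ 0])
      ultimately show ?thesis by (metis image_insert insert_absorb)
    qed
    ultimately show ?thesis using cl unfolding L_def by simp
  qed
qed

lemma cis_inj_on_period:
  assumes "\<omega> \<noteq> (0::real)"
  shows "inj_on (\<lambda>t. cis (\<omega> * t)) {0..<2 * pi / \<bar>\<omega>\<bar>}"
proof
  fix s t assume st: "s \<in> {0..<2 * pi / \<bar>\<omega>\<bar>}" "t \<in> {0..<2 * pi / \<bar>\<omega>\<bar>}" "cis (\<omega> * s) = cis (\<omega> * t)"
  then obtain n :: int where "\<omega> * s = \<omega> * t + of_int (2 * n) * pi"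
    unfolding cis_conv_exp exp_eq by (auto simp: complex_eq_iff)
  then have n: "\<omega> * (s - t) = 2 * pi * of_int n" by (simp add: algebra_simps)
  have "\<bar>s - t\<bar> < 2 * pi / \<bar>\<omega>\<bar>" using st by auto
  then have "\<bar>\<omega> * (s - t)\<bar> < 2 * pi" using assms by (subst abs_mult) (simp add: field_simps)
  then have "\<bar>of_int n\<bar> < (1::real)" unfolding n by (simp add: abs_mult)
  then have "n = 0" by linarith
  then show "s = t" using n assms by simp
qed

text \<open>
  The functions \<open>max 0 (1 - n \<sdot> infdist z C)\<close> decrease to the indicator of \<open>C\<close>; each of them is
  replaced by a polynomial at distance less than \<open>1 / (n + 1)\<close> on the circle.
\<close>
lemma circle_polynomials_approximate_closed:
  fixes C :: "complex set"
  assumes "closed C" "C \<noteq> {}"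
  shows "\<exists>g. (\<forall>n::nat. real_polynomial_function (g n)) \<and> (\<forall>n. \<forall>z\<in>sphere 0 1. \<bar>g n z\<bar> \<le> 2) \<and>
     (\<forall>z\<in>sphere 0 1. (\<lambda>n. g n z) \<longlonglongrightarrow> indicator C z)"
proof -
  define h where "h n z = max 0 (1 - real n * infdist z C)" for n z
  have "\<exists>g. real_polynomial_function g \<and> (\<forall>z\<in>sphere 0 1. \<bar>h n z - g z\<bar> < 1 / real (Suc n))" for n
  proof -
    obtain g where "real_polynomial_function g" "\<And>z. z \<in> sphere 0 1 \<Longrightarrow> \<bar>h n z - g z\<bar> < 1 / real (Suc n)"
      by (rule Stone_Weierstrass_real_polynomial_function[of "sphere 0 1" "h n" "1 / real (Suc n)"])
         (auto simp: h_def intro!: continuous_intros)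
    then show ?thesis by blast
  qed
  then obtain g where g: "\<And>n. real_polynomial_function (g n)"
    "\<And>n z. z \<in> sphere 0 1 \<Longrightarrow> \<bar>h n z - g n z\<bar> < 1 / real (Suc n)" by metis
  have h01: "0 \<le> h n z" "h n z \<le> 1" for n z by (auto simp: h_def infdist_nonneg)
  have "\<bar>g n z\<bar> \<le> 2" if "z \<in> sphere 0 1" for n z
  proof -
    have "1 / real (Suc n) \<le> 1" by simp
    then show ?thesis using g(2)[OF that, of n] h01[of n z] by linarith
  qed
  moreover have "(\<lambda>n. g n z) \<longlonglongrightarrow> indicator C z" if z: "z \<in> sphere 0 1" for z
  proof -
    have h: "(\<lambda>n. h n z) \<longlonglongrightarrow> indicator C z"
    proof (cases "z \<in> C")
      case True
      then show ?thesis by (simp add: h_def)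
    next
      case False
      then have pos: "infdist z C > 0"
        using assms in_closed_iff_infdist_zero[of C z] infdist_nonneg[of z C] by (simp add: less_le)
      obtain N where N: "1 < real N * infdist z C" using reals_Archimedean3[OF pos] by auto
      have "\<forall>\<^sub>F n in sequentially. h n z = 0"
        using eventually_ge_at_top[of N]
      proof eventually_elim
        case (elim n)
        then have "real N * infdist z C \<le> real n * infdist z C" using pos by (intro mult_right_mono) auto
        then show ?case using N by (simp add: h_def)
      qed
      then show ?thesis using False by (simp add: tendsto_eventually)
    qed
    have "(\<lambda>n. h n z - g n z) \<longlonglongrightarrow> 0"
    proof (rule Lim_null_comparison[OF _ LIMSEQ_inverse_real_of_nat])
      show "\<forall>\<^sub>F n in sequentially. norm (h n z - g n z) \<le> inverse (real (Suc n))"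
        using g(2)[OF z] by (intro always_eventually) (simp add: less_imp_le inverse_eq_divide)
    qed
    from tendsto_diff[OF h this] show ?thesis by simp
  qed
  ultimately show ?thesis using g(1) by blast
qed

context wiener_torus
begin

text \<open>
  The functions against which an integrable function with vanishing Fourier coefficients integrates
  to zero. They form an algebra, so that products over the coordinates need no expansion.
\<close>
inductive trigpoly :: "((nat \<Rightarrow> real) \<Rightarrow> complex) \<Rightarrow> bool" where
  wchar: "trigpoly (wchar k)"
| add: "trigpoly F \<Longrightarrow> trigpoly G \<Longrightarrow> trigpoly (\<lambda>x. F x + G x)"
| scale: "trigpoly F \<Longrightarrow> trigpoly (\<lambda>x. c * F x)"

lemma trigpoly_const: "trigpoly (\<lambda>x. c)"
  using trigpoly.scale[OF trigpoly.wchar[of "\<lambda>_. 0"], of c] by (simp add: wchar_0)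

lemma trigpoly_mult:
  assumes "trigpoly F" "trigpoly G"
  shows "trigpoly (\<lambda>x. F x * G x)"
  using assms(1)
proof induction
  case (wchar k)
  show ?case using assms(2)
  proof induction
    case (wchar l)
    show ?case using trigpoly.wchar[of "\<lambda>j. k j + l j"] by (simp add: wchar_add[abs_def])
  next
    case (add F G)
    then show ?case using trigpoly.add by (simp add: distrib_left)
  next
    case (scale F c)
    then show ?case using trigpoly.scale[of "\<lambda>x. wchar k x * F x" c] by (simp add: mult_ac)
  qed
next
  case (add F G)
  then show ?case using trigpoly.add by (simp add: distrib_right)
next
  case (scale F c)
  then show ?case using trigpoly.scale[of "\<lambda>x. F x * G x" c] by (simp add: mult_ac)
qed

lemma trigpoly_prod:
  assumes "finite I" "\<And>i. i \<in> I \<Longrightarrow> trigpoly (F i)"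
  shows "trigpoly (\<lambda>x. \<Prod>i\<in>I. F i x)"
  using assms by (induction I rule: finite_induct) (auto intro: trigpoly_const trigpoly_mult)

text \<open>
  A real linear functional on the plane is a combination of \<open>z\<close> and its conjugate, and on the circle
  these are the characters of frequency \<open>1\<close> and \<open>-1\<close> in the coordinate \<open>j\<close>.
\<close>
lemma trigpoly_polynomial:
  assumes "real_polynomial_function g" "j < d"
  shows "trigpoly (\<lambda>x. of_real (g (cis (\<omega> j * x j))))"
  using assms(1)
proof induction
  case (linear f)
  interpret bounded_linear f by fact
  define k where "k = (\<lambda>i. if i = j then 1 else 0 :: int)"
  have s: "(\<Sum>i<d. of_int (k i) * \<omega> i * x i) = \<omega> j * x j" for x
  proof -
    have "(\<Sum>i<d. of_int (k i) * \<omega> i * x i) = (\<Sum>i<d. if i = j then \<omega> j * x j else 0)"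
      by (rule sum.cong) (auto simp: k_def)
    then show ?thesis using assms(2) by simp
  qed
  have w: "wchar k x = cis (\<omega> j * x j)" "wchar (\<lambda>i. - k i) x = cnj (cis (\<omega> j * x j))" for x
    unfolding wchar_uminus unfolding wchar_def s by (simp_all add: cis_conv_exp)
  have "f z = Re z * f 1 + Im z * f \<i>" for z
  proof -
    have "z = Re z *\<^sub>R 1 + Im z *\<^sub>R \<i>" by (simp add: complex_eq_iff)
    then have "f z = f (Re z *\<^sub>R 1 + Im z *\<^sub>R \<i>)" by simp
    then show ?thesis by (simp add: add scaleR)
  qed
  then have fz: "f z = Re z * f 1 + Im z * f \<i>" for z .
  have fz': "of_real (f z) = (of_real (f 1) - \<i> * of_real (f \<i>)) / 2 * z + (of_real (f 1) + \<i> * of_real (f \<i>)) / 2 * cnj z" for z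
    unfolding fz[of z] by (simp add: complex_eq_iff field_simps)
  have "(\<lambda>x. of_real (f (cis (\<omega> j * x j)))) = (\<lambda>x. (of_real (f 1) - \<i> * of_real (f \<i>)) / 2 * wchar k x
      + (of_real (f 1) + \<i> * of_real (f \<i>)) / 2 * wchar (\<lambda>i. - k i) x)"
    by (rule ext) (simp only: w fz'[of "cis (\<omega> j * _ j)"])
  then show ?case by (simp only:) (rule trigpoly.add[OF trigpoly.scale[OF trigpoly.wchar] trigpoly.scale[OF trigpoly.wchar]])
next
  case (const c)
  then show ?case by (rule trigpoly_const)
next
  case (add f g)
  then show ?case using trigpoly.add by simp
next
  case (mult f g)
  then show ?case using trigpoly_mult by simp
qed

lemma trigpoly_bounded_measurable:
  assumes "trigpoly F"
  shows "F \<in> borel_measurable \<T> \<and> (\<exists>B. \<forall>x. norm (F x) \<le> B)"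
  using assms
proof induction
  case (add F G)
  then obtain B C where "\<And>x. norm (F x) \<le> B" "\<And>x. norm (G x) \<le> C" by auto
  then have "norm (F x + G x) \<le> B + C" for x by (meson norm_triangle_le add_mono)
  then show ?case using add by auto
next
  case (scale F c)
  then obtain B where "\<And>x. norm (F x) \<le> B" by auto
  then have "norm (c * F x) \<le> norm c * B" for x by (simp add: norm_mult mult_left_mono)
  then show ?case using scale by auto
qed auto

lemma integrable_mult_trigpoly:
  assumes "integrable \<T> u" "trigpoly F"
  shows "integrable \<T> (\<lambda>x. u x * F x)"
proof -
  obtain B where B: "\<And>x. norm (F x) \<le> B" and [measurable]: "F \<in> borel_measurable \<T>"
    using trigpoly_bounded_measurable[OF assms(2)] by auto
  have [measurable]: "u \<in> borel_measurable \<T>" using assms(1) by auto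
  have "norm (u x * F x) \<le> norm (of_real B * u x)" for x
  proof -
    have "norm (F x) * norm (u x) \<le> \<bar>B\<bar> * norm (u x)"
      using B[of x] by (intro mult_right_mono) auto
    then show ?thesis by (simp add: norm_mult mult.commute)
  qed
  then show ?thesis
    by (intro Bochner_Integration.integrable_bound[OF integrable_mult_right[OF assms(1), of "of_real B"]]) auto
qed

lemma integral_trigpoly_eq_0:
  assumes u: "integrable \<T> u" and 0: "\<And>k. k \<in> freqs d \<Longrightarrow> \<F> u k = 0"
    and "trigpoly F"
  shows "(\<integral>x. u x * F x \<partial>\<T>) = 0"
  using assms(3)
proof induction
  case (wchar k)
  define l where "l = restrict (\<lambda>j. - k j) {..<d}"
  have "l \<in> freqs d" by (simp add: l_def freqs_def)
  moreover have "cnj (wchar l x) = wchar k x" for x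
    unfolding wchar_uminus[symmetric] by (rule wchar_cong) (simp add: l_def)
  ultimately show ?case using 0[of l] vol_pos by (simp add: fourier_coeff_eq)
next
  case (add F G)
  then show ?case
    by (simp add: distrib_left Bochner_Integration.integral_add integrable_mult_trigpoly[OF u])
next
  case (scale F c)
  then show ?case by (simp add: mult.left_commute)
qed

text \<open>
  A generator of the product sigma-algebra that is stable under intersections and consists of boxes
  whose sides correspond to closed arcs of the circle.
\<close>
definition boxes :: "(nat \<Rightarrow> real) set set" where
  "boxes = {\<Pi>\<^sub>E j\<in>{..<d}. {..a j} \<inter> side j | a. True}"

lemma sets_cell: "sets (cell j) = sigma_sets (side j) (range (\<lambda>a. {..a} \<inter> side j))"
proof -
  have "sets (cell j) = (\<inter>) (side j) ` sigma_sets UNIV (range (\<lambda>a. {..a}))"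
    by (simp add: sets_restrict_space borel_eq_atMost)
  also have "\<dots> = sigma_sets (side j) ((\<inter>) (side j) ` range (\<lambda>a. {..a}))"
    by (rule sigma_sets_Int) (auto simp: borel_eq_atMost[symmetric, THEN arg_cong[of _ _ sets], simplified])
  finally show ?thesis by (simp add: image_image Int_commute)
qed

lemma boxes_subset_sets: "boxes \<subseteq> sets \<T>"
  unfolding boxes_def torus_def
  by (auto intro!: sets_PiM_I_finite simp: sets_cell)

lemma Int_stable_boxes: "Int_stable boxes"
proof (rule Int_stableI)
  fix A B assume "A \<in> boxes" "B \<in> boxes"
  then obtain a b where "A = (\<Pi>\<^sub>E j\<in>{..<d}. {..a j} \<inter> side j)"
    "B = (\<Pi>\<^sub>E j\<in>{..<d}. {..b j} \<inter> side j)" unfolding boxes_def by auto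
  then have "A \<inter> B = (\<Pi>\<^sub>E j\<in>{..<d}. {..min (a j) (b j)} \<inter> side j)"
    by (simp only: PiE_Int) (rule PiE_cong, auto)
  then show "A \<inter> B \<in> boxes"
    unfolding boxes_def by (intro CollectI exI[of _ "\<lambda>j. min (a j) (b j)"] conjI TrueI)
qed

lemma sets_torus_boxes: "sets \<T> = sigma_sets (space \<T>) boxes"
proof (rule antisym)
  show "sigma_sets (space \<T>) boxes \<subseteq> sets \<T>"
    by (rule sets.sigma_sets_subset) (rule boxes_subset_sets)
  let ?S = "space \<T>"
  have "{f \<in> ?S. f i \<in> A} \<in> sigma_sets ?S boxes" if i: "i < d" and A: "A \<in> sets (cell i)" for i A
  proof -
    have X: "(\<lambda>f. f i) \<in> ?S \<rightarrow> side i" using i by (auto simp: space_torus)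
    have "{(\<lambda>f. f i) -` A \<inter> ?S | A. A \<in> sigma_sets (side i) (range (\<lambda>a. {..a} \<inter> side i))}
       = sigma_sets ?S {(\<lambda>f. f i) -` A \<inter> ?S |A. A \<in> range (\<lambda>a. {..a} \<inter> side i)}"
      by (rule sigma_sets_vimage_commute[OF X])
    moreover have "{f \<in> ?S. f i \<in> A} = (\<lambda>f. f i) -` A \<inter> ?S" by auto
    ultimately have "{f \<in> ?S. f i \<in> A} \<in> sigma_sets ?S {(\<lambda>f. f i) -` A \<inter> ?S |A. A \<in> range (\<lambda>a. {..a} \<inter> side i)}"
      using A unfolding sets_cell by blast
    moreover have "{(\<lambda>f. f i) -` A \<inter> ?S |A. A \<in> range (\<lambda>a. {..a} \<inter> side i)} \<subseteq> boxes"
    proof clarify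
      fix a
      define P where "P j = 2 * pi / \<bar>\<omega> j\<bar>" for j
      have "(\<lambda>f. f i) -` ({..a} \<inter> side i) \<inter> ?S =
         (\<Pi>\<^sub>E j\<in>{..<d}. {..(if j = i then a else 2 * pi / \<bar>\<omega> j\<bar>)} \<inter> side j)"
        (is "?A = ?B")
      proof (rule set_eqI)
        fix f
        have "f \<in> ?A \<longleftrightarrow> f \<in> ?S \<and> f i \<in> {..a}" using X by blast
        also have "\<dots> \<longleftrightarrow> f \<in> ?B"
        proof -
          have "f j \<in> {..if j = i then a else P j} \<inter> {0..<P j} \<longleftrightarrow>
              f j \<in> {0..<P j} \<and> (j = i \<longrightarrow> f i \<in> {..a})" for j by (cases "j = i") auto
          then show ?thesis
            unfolding space_torus P_def[symmetric] PiE_iff using i by blast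
        qed
        finally show "f \<in> ?A \<longleftrightarrow> f \<in> ?B" .
      qed
      then show "(\<lambda>f. f i) -` ({..a} \<inter> side i) \<inter> ?S \<in> boxes"
        unfolding boxes_def
        by (intro CollectI exI[of _ "\<lambda>j. if j = i then a else 2 * pi / \<bar>\<omega> j\<bar>"] conjI TrueI)
    qed
    ultimately show ?thesis using sigma_sets_mono' by blast
  qed
  then have "{{f \<in> ?S. f i \<in> A} |i A. i \<in> {..<d} \<and> A \<in> sets (cell i)} \<subseteq> sigma_sets ?S boxes" by auto
  moreover have "sets \<T> = sigma_sets ?S {{f \<in> ?S. f i \<in> A} |i A. i \<in> {..<d} \<and> A \<in> sets (cell i)}"
    unfolding torus_def space_PiM by (rule sets_PiM_single)
  ultimately show "sets \<T> \<subseteq> sigma_sets ?S boxes"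
    by (simp add: sigma_sets_mono)
qed

lemma integral_box_eq_0:
  assumes u: "integrable \<T> u" and 0: "\<And>k. k \<in> freqs d \<Longrightarrow> \<F> u k = 0"
    and A: "A \<in> boxes"
  shows "(\<integral>x. indicator A x *\<^sub>R u x \<partial>\<T>) = 0"
proof (cases "A = {}")
  case False
  obtain a where a: "A = (\<Pi>\<^sub>E j\<in>{..<d}. {..a j} \<inter> side j)" using A unfolding boxes_def by auto
  define C where "C j = (\<lambda>t. cis (\<omega> j * t)) ` ({..a j} \<inter> side j)" for j
  have "C j \<noteq> {}" if "j < d" for j using False that unfolding a C_def by (auto simp: PiE_eq_empty_iff)
  then have "\<exists>g. (\<forall>n::nat. real_polynomial_function (g n)) \<and> (\<forall>n. \<forall>z\<in>sphere 0 1. \<bar>g n z\<bar> \<le> 2) \<and>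
     (\<forall>z\<in>sphere 0 1. (\<lambda>n. g n z) \<longlonglongrightarrow> indicator (C j) z)" if "j < d" for j
    using that unfolding C_def
    by (intro circle_polynomials_approximate_closed cis_image_closed_initial_arc \<omega>_nonzero) auto
  then obtain g where g: "\<And>j n. j < d \<Longrightarrow> real_polynomial_function (g j n)"
     "\<And>j n z. j < d \<Longrightarrow> z \<in> sphere 0 1 \<Longrightarrow> \<bar>g j n z\<bar> \<le> 2"
     "\<And>j z. j < d \<Longrightarrow> z \<in> sphere 0 1 \<Longrightarrow> (\<lambda>n. g j n z) \<longlonglongrightarrow> indicator (C j) z"
    by metis
  define G where "G n x = (\<Prod>j<d. complex_of_real (g j n (cis (\<omega> j * x j))))" for n x
  have G: "trigpoly (G n)" for n
    unfolding G_def by (intro trigpoly_prod trigpoly_polynomial g(1)) auto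
  \<comment> \<open>Inside the cell, injectivity of the parametrisation of the circle makes the indicator of the
    arc agree with the indicator of the side.\<close>
  have lim: "(\<lambda>n. u x * G n x) \<longlonglongrightarrow> indicator A x *\<^sub>R u x" if x: "x \<in> space \<T>" for x
  proof -
    have "(\<lambda>n. G n x) \<longlonglongrightarrow> (\<Prod>j<d. complex_of_real (indicator (C j) (cis (\<omega> j * x j))))"
      unfolding G_def by (intro tendsto_intros g(3)) auto
    also have "(\<Prod>j<d. complex_of_real (indicator (C j) (cis (\<omega> j * x j)))) = (\<Prod>j<d. indicator {..a j} (x j))"
    proof (intro prod.cong refl)
      fix j assume j: "j \<in> {..<d}"
      have xj: "x j \<in> side j" using PiE_mem[OF x[unfolded space_torus] j] .
      have "cis (\<omega> j * x j) \<in> C j \<longleftrightarrow> x j \<in> {..a j} \<inter> side j"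
        unfolding C_def by (rule inj_on_image_mem_iff[OF cis_inj_on_period]) (use xj j \<omega>_nonzero in auto)
      then show "complex_of_real (indicator (C j) (cis (\<omega> j * x j))) = indicator {..a j} (x j)"
        using xj by (auto split: split_indicator)
    qed
    also have "\<dots> = indicator A x"
    proof (cases "x \<in> A")
      case True
      then show ?thesis unfolding a by (auto intro!: prod.neutral simp: PiE_iff)
    next
      case False
      then obtain j where "j < d" "\<not> x j \<le> a j" using x unfolding a space_torus by (auto simp: PiE_iff)
      then have "(\<Prod>j<d. indicator {..a j} (x j)) = (0::complex)"
        by (intro prod_zero) (auto intro!: bexI[of _ j])
      then show ?thesis using False by simp
    qed
    finally have "(\<lambda>n. u x * G n x) \<longlonglongrightarrow> u x * indicator A x" by (intro tendsto_intros)
    then show ?thesis by (cases "x \<in> A") auto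
  qed
  have bound: "norm (u x * G n x) \<le> 2 ^ d * norm (u x)" for n x
  proof -
    have "norm (G n x) \<le> (\<Prod>j<d. 2)"
      unfolding G_def prod_norm[symmetric] by (intro prod_mono) (use g(2) in auto)
    then show ?thesis by (simp add: norm_mult mult.commute[of _ "norm (u x)"] mult_left_mono)
  qed
  have "(\<lambda>n. \<integral>x. u x * G n x \<partial>\<T>) \<longlonglongrightarrow> (\<integral>x. indicator A x *\<^sub>R u x \<partial>\<T>)"
  proof (rule integral_dominated_convergence[where w="\<lambda>x. 2 ^ d * norm (u x)"])
    show "(\<lambda>x. indicat_real A x *\<^sub>R u x) \<in> borel_measurable \<T>"
      using u A boxes_subset_sets by (intro borel_measurable_scaleR borel_measurable_indicator) auto
    show "(\<lambda>x. u x * G n x) \<in> borel_measurable \<T>" for n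
      using integrable_mult_trigpoly[OF u G[of n]] by auto
  qed (use u lim bound in auto)
  moreover have "(\<integral>x. u x * G n x \<partial>\<T>) = 0" for n
    by (rule integral_trigpoly_eq_0[OF u 0 G])
  ultimately show ?thesis by (simp add: LIMSEQ_const_iff)
qed simp

text \<open>
  The sets over which \<open>u\<close> integrates to zero form a Dynkin system, and it contains the boxes.
\<close>
theorem fourier_coeff_eq_0_imp_AE_eq_0:
  assumes u: "integrable \<T> u" and 0: "\<And>k. k \<in> freqs d \<Longrightarrow> \<F> u k = 0"
  shows "AE x in \<T>. u x = 0"
proof (rule T.density_zero[OF u])
  fix A assume A: "A \<in> sets \<T>"
  have int: "integrable \<T> (\<lambda>x. indicator B x *\<^sub>R u x)" if "B \<in> sets \<T>" for B
    using u that by (rule integrable_mult_indicator[rotated])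
  have "boxes \<subseteq> Pow (space \<T>)" using boxes_subset_sets sets.space_closed by blast
  from Int_stable_boxes this A[unfolded sets_torus_boxes]
  show "set_lebesgue_integral \<T> A u = 0"
  proof (induction rule: sigma_sets_induct_disjoint)
    case (basic A)
    then show ?case using integral_box_eq_0[OF u 0] by (simp add: set_lebesgue_integral_def)
  next
    case empty
    then show ?case by (simp add: set_lebesgue_integral_def)
  next
    case (compl A)
    then have As: "A \<in> sets \<T>" by (simp add: sets_torus_boxes)
    have "(\<integral>x. u x * 1 \<partial>\<T>) = 0"
      by (rule integral_trigpoly_eq_0[OF u 0 trigpoly_const])
    moreover have "(\<integral>x. indicator (space \<T> - A) x *\<^sub>R u x \<partial>\<T>)
        = (\<integral>x. u x - indicator A x *\<^sub>R u x \<partial>\<T>)"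
      by (rule Bochner_Integration.integral_cong) (auto split: split_indicator)
    ultimately show ?case using compl.IH int[OF As] u by (simp add: set_lebesgue_integral_def)
  next
    case (union A)
    then have As: "A i \<in> sets \<T>" for i by (auto simp: sets_torus_boxes)
    have "(LINT x:(\<Union>i. A i)|\<T>. u x) = (\<Sum>i. (LINT x:(A i)|\<T>. u x))"
      by (rule lebesgue_integral_countable_add)
         (use As union(1) int[of "\<Union>i. A i"] in \<open>auto simp: disjoint_family_on_def set_integrable_def\<close>)
    then show ?case using union by simp
  qed
qed

end

section \<open>The weighted Wiener algebra\<close>

context wiener_torus
begin

abbreviation wt :: "(nat \<Rightarrow> int) \<Rightarrow> real" where "wt \<equiv> wiener_weight d \<nu>"

lemma wt_ge_1: "1 \<le> wt k"
  unfolding wiener_weight_def using \<nu>_ge_1 by (rule one_le_power)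

lemma wt_pos: "0 < wt k" and wt_nonneg: "0 \<le> wt k" and wt_nz: "wt k \<noteq> 0"
  using wt_ge_1[of k] by auto

lemma wt_cong:
  assumes "\<And>j. j < d \<Longrightarrow> k j = l j"
  shows "wt k = wt l"
proof -
  have "(\<Sum>j<d. \<bar>k j\<bar>) = (\<Sum>j<d. \<bar>l j\<bar>)" using assms by (intro sum.cong) auto
  then show ?thesis unfolding wiener_weight_def by simp
qed

lemma wt_add: "wt (\<lambda>j. k j + l j) \<le> wt k * wt l"
proof -
  have "(\<Sum>j<d. \<bar>k j + l j\<bar>) \<le> (\<Sum>j<d. \<bar>k j\<bar>) + (\<Sum>j<d. \<bar>l j\<bar>)"
    by (simp add: sum.distrib[symmetric] sum_mono abs_triangle_ineq)
  then have "nat (\<Sum>j<d. \<bar>k j + l j\<bar>) \<le> nat (\<Sum>j<d. \<bar>k j\<bar>) + nat (\<Sum>j<d. \<bar>l j\<bar>)"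
    by (simp add: nat_add_distrib[symmetric] sum_nonneg nat_mono)
  then show ?thesis
    unfolding wiener_weight_def power_add[symmetric] using \<nu>_ge_1 by (rule power_increasing)
qed

definition kadd :: "(nat \<Rightarrow> int) \<Rightarrow> (nat \<Rightarrow> int) \<Rightarrow> nat \<Rightarrow> int" where
  "kadd k l = restrict (\<lambda>j. k j + l j) {..<d}"

definition kneg :: "(nat \<Rightarrow> int) \<Rightarrow> nat \<Rightarrow> int" where
  "kneg k = restrict (\<lambda>j. - k j) {..<d}"

definition kzero :: "nat \<Rightarrow> int" where
  "kzero = restrict (\<lambda>j. 0) {..<d}"

lemma freqs_closed [simp]: "kadd k l \<in> freqs d" "kneg k \<in> freqs d" "kzero \<in> freqs d"
  by (auto simp: kadd_def kneg_def kzero_def freqs_def)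

lemma wchar_kadd: "wchar (kadd k l) x = wchar k x * wchar l x"
  unfolding wchar_add[symmetric] by (rule wchar_cong) (simp add: kadd_def)

lemma wchar_kneg: "wchar (kneg k) x = cnj (wchar k x)"
  unfolding wchar_uminus[symmetric] by (rule wchar_cong) (simp add: kneg_def)

lemma wchar_kzero: "wchar kzero x = 1"
  unfolding wchar_0[of x, symmetric] by (rule wchar_cong) (simp add: kzero_def)

lemma wt_kadd: "wt (kadd k l) \<le> wt k * wt l"
  using wt_add[of k l] wt_cong[of "kadd k l" "\<lambda>j. k j + l j"] by (simp add: kadd_def)

lemma wt_kneg: "wt (kneg k) = wt k"
  using wt_cong[of "kneg k" "\<lambda>j. - k j"] by (simp add: kneg_def wiener_weight_def)

lemma wt_kzero: "wt kzero = 1"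
  using wt_cong[of kzero "\<lambda>j. 0"] by (simp add: kzero_def wiener_weight_def)

text \<open>
  Membership in the Wiener algebra with norm at most \<open>r\<close>, for the continuous representative. Only
  upper bounds are ever needed, and this form lets the algebra of such functions be pointwise
  algebra of complex numbers.
\<close>
definition wbound :: "((nat \<Rightarrow> real) \<Rightarrow> complex) \<Rightarrow> real \<Rightarrow> bool" where
  "wbound u r \<longleftrightarrow> (\<exists>a. (\<lambda>k. norm (a k) * wt k) summable_on freqs d \<and>
      (\<Sum>\<^sub>\<infinity>k\<in>freqs d. norm (a k) * wt k) \<le> r \<and> u = series a)"

lemma weighted_imp_abs_summable:
  assumes "(\<lambda>i. norm (c i) * wt (\<kappa> i)) summable_on I"
  shows "(\<lambda>i. norm (c i :: complex)) summable_on I"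
proof (rule summable_on_comparison_test[OF assms])
  fix i
  have "norm (c i) * 1 \<le> norm (c i) * wt (\<kappa> i)" by (intro mult_left_mono wt_ge_1) auto
  then show "norm (c i) \<le> norm (c i) * wt (\<kappa> i)" by simp
qed auto

text \<open>
  Frequencies may be repeated among the \<open>\<kappa> i\<close>: collecting the terms of equal frequency does not
  increase the weighted sum. This is what makes products and infinite sums easy to bound.
\<close>
lemma wboundI:
  fixes c :: "'i \<Rightarrow> complex"
  assumes \<kappa>: "\<And>i. i \<in> I \<Longrightarrow> \<kappa> i \<in> freqs d"
    and s: "(\<lambda>i. norm (c i) * wt (\<kappa> i)) summable_on I" "(\<Sum>\<^sub>\<infinity>i\<in>I. norm (c i) * wt (\<kappa> i)) \<le> r"
    and u: "\<And>x. ((\<lambda>i. c i * wchar (\<kappa> i) x) has_sum u x) I"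
  shows "wbound u r"
proof -
  define J where "J k = {i \<in> I. \<kappa> i = k}" for k
  define P where "P = Sigma (freqs d) J"
  define s where "s = (\<Sum>\<^sub>\<infinity>i\<in>I. norm (c i) * wt (\<kappa> i))"
  define a where "a k = (\<Sum>\<^sub>\<infinity>i\<in>J k. c i)" for k
  have bij: "bij_betw (\<lambda>i. (\<kappa> i, i)) I P"
    by (rule bij_betwI[where g=snd]) (auto simp: P_def J_def \<kappa>)
  have JI: "J k \<subseteq> I" for k by (auto simp: J_def)
  have Js: "(\<lambda>i. norm (c i)) summable_on J k" for k
    by (rule summable_on_subset[OF weighted_imp_abs_summable[OF s(1)] JI])
  have "((\<lambda>i. norm (c i) * wt (\<kappa> i)) has_sum s) I" using s(1) by (simp add: s_def)
  then have "((\<lambda>(k, i). norm (c i) * wt k) has_sum s) P"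
    using has_sum_reindex_bij_betw[OF bij, of "\<lambda>(k, i). norm (c i) * wt k" s] by simp
  then have "((\<lambda>k. (\<Sum>\<^sub>\<infinity>i\<in>J k. norm (c i)) * wt k) has_sum s) (freqs d)"
    unfolding P_def by (rule has_sum_SigmaD) (auto intro!: has_sum_cmult_left has_sum_infsum Js)
  then have m: "(\<lambda>k. (\<Sum>\<^sub>\<infinity>i\<in>J k. norm (c i)) * wt k) summable_on freqs d"
    "(\<Sum>\<^sub>\<infinity>k\<in>freqs d. (\<Sum>\<^sub>\<infinity>i\<in>J k. norm (c i)) * wt k) = s"
    by (auto simp: has_sum_iff)
  have le: "norm (a k) * wt k \<le> (\<Sum>\<^sub>\<infinity>i\<in>J k. norm (c i)) * wt k" for k
    unfolding a_def by (intro mult_right_mono norm_infsum_bound Js wt_nonneg)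
  have as: "(\<lambda>k. norm (a k) * wt k) summable_on freqs d"
    by (rule summable_on_comparison_test[OF m(1) le]) (simp add: wt_nonneg)
  moreover have "(\<Sum>\<^sub>\<infinity>k\<in>freqs d. norm (a k) * wt k) \<le> r"
    using infsum_mono[OF as m(1) le] s(2) unfolding m(2) s_def by simp
  moreover have "u x = series a x" for x
  proof -
    have "((\<lambda>(k, i). c i * wchar k x) has_sum u x) P"
      using has_sum_reindex_bij_betw[OF bij, of "\<lambda>(k, i). c i * wchar k x" "u x"] u[of x] by simp
    then have "((\<lambda>k. a k * wchar k x) has_sum u x) (freqs d)"
      unfolding P_def a_def
      by (rule has_sum_SigmaD) (auto intro!: has_sum_cmult_left has_sum_infsum abs_summable_summable Js)
    then show ?thesis unfolding series_def by (simp add: has_sum_iff)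
  qed
  ultimately show ?thesis unfolding wbound_def by blast
qed

lemma wboundE:
  assumes "wbound u r"
  obtains a where "(\<lambda>k. norm (a k) * wt k) summable_on freqs d"
    "(\<Sum>\<^sub>\<infinity>k\<in>freqs d. norm (a k) * wt k) \<le> r" "\<And>x. ((\<lambda>k. a k * wchar k x) has_sum u x) (freqs d)"
proof -
  obtain a where a: "(\<lambda>k. norm (a k) * wt k) summable_on freqs d"
    "(\<Sum>\<^sub>\<infinity>k\<in>freqs d. norm (a k) * wt k) \<le> r" "u = series a"
    using assms unfolding wbound_def by blast
  then show ?thesis
    using that series_has_sum[OF weighted_imp_abs_summable[OF a(1)]] by blast
qed

lemma wbound_mono: "wbound u r \<Longrightarrow> r \<le> r' \<Longrightarrow> wbound u r'"
  unfolding wbound_def by force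

lemma wbound_nonneg: "wbound u r \<Longrightarrow> 0 \<le> r"
proof (erule wboundE)
  fix a assume "(\<Sum>\<^sub>\<infinity>k\<in>freqs d. norm (a k :: complex) * wt k) \<le> r"
  moreover have "0 \<le> (\<Sum>\<^sub>\<infinity>k\<in>freqs d. norm (a k) * wt k)"
    by (intro infsum_nonneg mult_nonneg_nonneg norm_ge_zero wt_nonneg)
  ultimately show "0 \<le> r" by linarith
qed

lemma wbound_cnj: "wbound u r \<Longrightarrow> wbound (\<lambda>x. cnj (u x)) r"
proof (erule wboundE)
  fix a assume a: "(\<lambda>k. norm (a k) * wt k) summable_on freqs d"
    "(\<Sum>\<^sub>\<infinity>k\<in>freqs d. norm (a k) * wt k) \<le> r" "\<And>x. ((\<lambda>k. a k * wchar k x) has_sum u x) (freqs d)"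
  show "wbound (\<lambda>x. cnj (u x)) r"
  proof (rule wboundI[where c="\<lambda>k. cnj (a k)" and \<kappa>=kneg])
    fix x show "((\<lambda>k. cnj (a k) * wchar (kneg k) x) has_sum cnj (u x)) (freqs d)"
      unfolding wchar_kneg using has_sum_cnj_iff[THEN iffD2, OF a(3)[of x]] by simp
  qed (use a in \<open>simp_all add: wt_kneg\<close>)
qed

text \<open>
  The weights are submultiplicative, so a shift of the frequencies by \<open>l\<close> costs at most \<open>wt l\<close>.
\<close>
lemma wbound_wchar_mult:
  assumes "wbound u r"
  shows "wbound (\<lambda>x. b * wchar l x * u x) (norm b * wt l * r)"
  using assms
proof (rule wboundE)
  fix a assume a: "(\<lambda>k. norm (a k) * wt k) summable_on freqs d"
    "(\<Sum>\<^sub>\<infinity>k\<in>freqs d. norm (a k) * wt k) \<le> r" "\<And>x. ((\<lambda>k. a k * wchar k x) has_sum u x) (freqs d)"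
  have le: "norm (b * a k) * wt (kadd l k) \<le> norm b * wt l * (norm (a k) * wt k)" for k
    using mult_left_mono[OF wt_kadd[of l k], of "norm (b * a k)"] by (simp add: norm_mult mult_ac)
  have s: "(\<lambda>k. norm b * wt l * (norm (a k) * wt k)) summable_on freqs d"
    by (intro summable_on_cmult_right a)
  have s': "(\<lambda>k. norm (b * a k) * wt (kadd l k)) summable_on freqs d"
    by (rule summable_on_comparison_test[OF s le]) (simp add: wt_nonneg)
  show ?thesis
  proof (rule wboundI[where c="\<lambda>k. b * a k" and \<kappa>="kadd l", OF _ s'])
    have "(\<Sum>\<^sub>\<infinity>k\<in>freqs d. norm (b * a k) * wt (kadd l k)) \<le> (\<Sum>\<^sub>\<infinity>k\<in>freqs d. norm b * wt l * (norm (a k) * wt k))"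
      by (rule infsum_mono[OF s' s le])
    also have "\<dots> = norm b * wt l * (\<Sum>\<^sub>\<infinity>k\<in>freqs d. norm (a k) * wt k)"
      by (rule infsum_cmult_right')
    also have "\<dots> \<le> norm b * wt l * r" using a(2) wt_nonneg by (intro mult_left_mono) auto
    finally show "(\<Sum>\<^sub>\<infinity>k\<in>freqs d. norm (b * a k) * wt (kadd l k)) \<le> norm b * wt l * r" .
    fix x
    show "((\<lambda>k. b * a k * wchar (kadd l k) x) has_sum b * wchar l x * u x) (freqs d)"
      using has_sum_cmult_right[OF a(3)[of x], of "b * wchar l x"] by (simp add: wchar_kadd mult_ac)
  qed simp
qed

lemma wbound_const: "wbound (\<lambda>x. c) (norm c)"
  by (rule wboundI[where I="{()}" and c="\<lambda>_. c" and \<kappa>="\<lambda>_. kzero"])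
     (auto simp: wt_kzero wchar_kzero intro!: has_sum_finiteI)

lemma wbound_sums:
  fixes u :: "'i \<Rightarrow> (nat \<Rightarrow> real) \<Rightarrow> complex"
  assumes u: "\<And>i. i \<in> I \<Longrightarrow> wbound (u i) (r i)"
    and r: "r summable_on I" "(\<Sum>\<^sub>\<infinity>i\<in>I. r i) \<le> s"
    and v: "\<And>x. ((\<lambda>i. u i x) has_sum v x) I"
  shows "wbound v s"
proof -
  have "\<forall>i\<in>I. \<exists>a. (\<lambda>k. norm (a k) * wt k) summable_on freqs d \<and>
      (\<Sum>\<^sub>\<infinity>k\<in>freqs d. norm (a k) * wt k) \<le> r i \<and> (\<forall>x. ((\<lambda>k. a k * wchar k x) has_sum u i x) (freqs d))"
    using wboundE[OF u] by blast
  from bchoice[OF this] obtain a where a: "\<And>i. i \<in> I \<Longrightarrow> (\<lambda>k. norm (a i k) * wt k) summable_on freqs d"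
    "\<And>i. i \<in> I \<Longrightarrow> (\<Sum>\<^sub>\<infinity>k\<in>freqs d. norm (a i k) * wt k) \<le> r i"
    "\<And>i x. i \<in> I \<Longrightarrow> ((\<lambda>k. a i k * wchar k x) has_sum u i x) (freqs d)" by blast
  define m where "m i = (\<Sum>\<^sub>\<infinity>k\<in>freqs d. norm (a i k) * wt k)" for i
  have m0: "0 \<le> m i" for i unfolding m_def by (intro infsum_nonneg mult_nonneg_nonneg wt_nonneg) auto
  have ms: "m summable_on I"
    by (rule summable_on_comparison_test[OF r(1)]) (use a(2) m0 in \<open>auto simp: m_def\<close>)
  have hs: "((\<lambda>k. norm (a i k) * wt k) has_sum m i) (freqs d)" if "i \<in> I" for i
    unfolding m_def using a(1)[OF that] by (rule has_sum_infsum)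
  have S: "(\<lambda>(i, k). norm (a i k) * wt k) summable_on I \<times> freqs d"
    by (rule summable_on_SigmaI[OF _ ms]) (use hs wt_nonneg in auto)
  have "((\<lambda>(i, k). norm (a i k) * wt k) has_sum infsum m I) (I \<times> freqs d)"
    by (rule has_sum_SigmaI[OF _ has_sum_infsum[OF ms] S]) (use hs in auto)
  then have I: "(\<Sum>\<^sub>\<infinity>(i, k)\<in>I \<times> freqs d. norm (a i k) * wt k) = infsum m I" by (simp add: has_sum_iff)
  have "infsum m I \<le> infsum r I" using a(2) by (intro infsum_mono ms r) (simp add: m_def)
  with r(2) I have le: "(\<Sum>\<^sub>\<infinity>(i, k)\<in>I \<times> freqs d. norm (a i k) * wt k) \<le> s" by simp
  show ?thesis
  proof (rule wboundI[where I="I \<times> freqs d" and c="\<lambda>(i, k). a i k" and \<kappa>=snd])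
    show "(\<lambda>i. norm (case i of (i, k) \<Rightarrow> a i k) * wt (snd i)) summable_on I \<times> freqs d"
      using S by (simp add: case_prod_unfold)
    show "(\<Sum>\<^sub>\<infinity>i\<in>I \<times> freqs d. norm (case i of (i, k) \<Rightarrow> a i k) * wt (snd i)) \<le> s"
      using le by (simp add: case_prod_unfold)
    fix x
    have "(\<lambda>(i, k). a i k * wchar k x) summable_on I \<times> freqs d"
    proof (rule abs_summable_summable, rule summable_on_comparison_test[OF S])
      fix y :: "'i \<times> (nat \<Rightarrow> int)"
      have "norm (a (fst y) (snd y)) * 1 \<le> norm (a (fst y) (snd y)) * wt (snd y)"
        by (intro mult_left_mono wt_ge_1) auto
      then show "norm (case y of (i, k) \<Rightarrow> a i k * wchar k x) \<le> (case y of (i, k) \<Rightarrow> norm (a i k) * wt k)"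
        by (simp add: case_prod_unfold norm_mult)
    qed simp
    then have "((\<lambda>(i, k). a i k * wchar k x) has_sum v x) (I \<times> freqs d)"
      by (intro has_sum_SigmaI[OF _ v]) (auto intro: a(3))
    then show "((\<lambda>i. (case i of (i, k) \<Rightarrow> a i k) * wchar (snd i) x) has_sum v x) (I \<times> freqs d)"
      by (simp add: case_prod_unfold)
  qed auto
qed

lemma wbound_add:
  assumes "wbound u r" "wbound v s"
  shows "wbound (\<lambda>x. u x + v x) (r + s)"
  by (rule wbound_sums[where I="UNIV :: bool set" and u="\<lambda>b. if b then u else v" and r="\<lambda>b. if b then r else s"])
     (use assms in \<open>auto simp: UNIV_bool intro!: has_sum_finiteI\<close>)

text \<open>
  The product is the sum over the frequencies of the first factor of shifts of the second one.
\<close>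
lemma wbound_mult:
  assumes "wbound u r" "wbound v s"
  shows "wbound (\<lambda>x. u x * v x) (r * s)"
  using assms(1)
proof (rule wboundE)
  fix a assume a: "(\<lambda>k. norm (a k) * wt k) summable_on freqs d"
    "(\<Sum>\<^sub>\<infinity>k\<in>freqs d. norm (a k) * wt k) \<le> r" "\<And>x. ((\<lambda>k. a k * wchar k x) has_sum u x) (freqs d)"
  show ?thesis
  proof (rule wbound_sums[where I="freqs d" and u="\<lambda>k x. a k * wchar k x * v x" and r="\<lambda>k. norm (a k) * wt k * s"])
    show "(\<lambda>k. norm (a k) * wt k * s) summable_on freqs d" by (rule summable_on_cmult_left[OF a(1)])
    show "(\<Sum>\<^sub>\<infinity>k\<in>freqs d. norm (a k) * wt k * s) \<le> r * s"
      unfolding infsum_cmult_left' by (intro mult_right_mono a(2) wbound_nonneg[OF assms(2)])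
    show "((\<lambda>k. a k * wchar k x * v x) has_sum u x * v x) (freqs d)" for x
      by (rule has_sum_cmult_left[OF a(3)])
  qed (rule wbound_wchar_mult[OF assms(2)])
qed

lemma wbound_cmult: "wbound u r \<Longrightarrow> wbound (\<lambda>x. c * u x) (norm c * r)"
  using wbound_mult[OF wbound_const] .

lemma wbound_uminus: "wbound u r \<Longrightarrow> wbound (\<lambda>x. - u x) r"
  using wbound_cmult[of u r "-1"] by simp

lemma wbound_diff: "wbound u r \<Longrightarrow> wbound v s \<Longrightarrow> wbound (\<lambda>x. u x - v x) (r + s)"
  using wbound_add[OF _ wbound_uminus, of u r v s] by simp

lemma wbound_power: "wbound u r \<Longrightarrow> wbound (\<lambda>x. u x ^ n) (r ^ n)"
proof (induction n)
  case 0
  show ?case using wbound_const[of 1] by simp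
next
  case (Suc n)
  show ?case using wbound_mult[OF Suc.prems Suc.IH[OF Suc.prems]] by simp
qed


text \<open>
  \<open>synth\<close> and \<open>coeffs\<close> pass between families and functions. Entries outside the frequency lattice
  are ignored by the former and set to zero by the latter.
\<close>
definition synth :: "(nat \<Rightarrow> int) ell1 \<Rightarrow> (nat \<Rightarrow> real) \<Rightarrow> complex" where
  "synth A = series (\<lambda>k. coord A k / of_real (wt k))"

definition coeffs :: "((nat \<Rightarrow> real) \<Rightarrow> complex) \<Rightarrow> (nat \<Rightarrow> int) ell1" where
  "coeffs u = Abs_ell1 (\<lambda>k. if k \<in> freqs d then of_real (wt k) * \<F> u k else 0)"

lemma coord_div_summable: "(\<lambda>k. norm (coord A k / of_real (wt k)) * wt k) summable_on freqs d"
  using summable_on_subset[OF coord_summable[of A], of "freqs d"] wt_pos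
  by (simp add: norm_divide abs_of_pos wt_nz)

lemma synth_has_sum: "((\<lambda>k. coord A k / of_real (wt k) * wchar k x) has_sum synth A x) (freqs d)"
  unfolding synth_def by (rule series_has_sum[OF weighted_imp_abs_summable[OF coord_div_summable]])

lemma wbound_synth: "wbound (synth A) (norm A)"
  unfolding wbound_def synth_def
proof (intro exI conjI)
  have "(\<Sum>\<^sub>\<infinity>k\<in>freqs d. norm (coord A k / of_real (wt k)) * wt k) = (\<Sum>\<^sub>\<infinity>k\<in>freqs d. norm (coord A k))"
    using wt_pos by (simp add: norm_divide abs_of_pos wt_nz)
  also have "\<dots> \<le> norm A"
    unfolding norm_ell1_eq
    by (rule infsum_mono_neutral) (use coord_summable[of A] in \<open>auto intro: summable_on_subset\<close>)
  finally show "(\<Sum>\<^sub>\<infinity>k\<in>freqs d. norm (coord A k / of_real (wt k)) * wt k) \<le> norm A" .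
qed (rule coord_div_summable refl)+

lemma synth_diff: "synth (A - B) x = synth A x - synth B x"
proof -
  have "((\<lambda>k. coord A k / of_real (wt k) * wchar k x + - (coord B k / of_real (wt k) * wchar k x))
     has_sum synth A x + - synth B x) (freqs d)"
    by (intro has_sum_add has_sum_uminusI synth_has_sum)
  then have "((\<lambda>k. coord (A - B) k / of_real (wt k) * wchar k x) has_sum synth A x - synth B x) (freqs d)"
    by (simp add: diff_divide_distrib left_diff_distrib)
  then show ?thesis using synth_has_sum has_sum_unique by blast
qed

lemma wbound_synth_diff: "wbound (\<lambda>x. synth A x - synth B x) (norm (A - B))"
  using wbound_synth[of "A - B"] by (simp add: synth_diff[abs_def])

lemma fourier_coeff_synth: "k \<in> freqs d \<Longrightarrow> \<F> (synth A) k = coord A k / of_real (wt k)"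
  unfolding synth_def by (rule fourier_coeff_series[OF weighted_imp_abs_summable[OF coord_div_summable]])

lemma fourier_coeff_diff:
  assumes "integrable \<T> u" "integrable \<T> v"
  shows "\<F> (\<lambda>x. u x - v x) k = \<F> u k - \<F> v k"
  using assms integrable_mult_wchar[of u k] integrable_mult_wchar[of v k]
  by (simp add: fourier_coeff_eq left_diff_distrib diff_divide_distrib)

lemma wiener_algebra_integrable: "u \<in> \<A> \<Longrightarrow> integrable \<T> u"
  by (simp add: wiener_algebra_def)

lemma coord_coeffs:
  assumes "u \<in> \<A>"
  shows "coord (coeffs u) k = (if k \<in> freqs d then of_real (wt k) * \<F> u k else 0)"
proof -
  have "(\<lambda>k. norm (if k \<in> freqs d then of_real (wt k) * \<F> u k else 0)) summable_on UNIV
     \<longleftrightarrow> (\<lambda>k. norm (\<F> u k) * wt k) summable_on freqs d"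
    by (rule summable_on_cong_neutral) (auto simp: norm_mult wt_nonneg)
  then show ?thesis using assms unfolding coeffs_def wiener_algebra_def by (simp add: Abs_ell1_inverse)
qed

lemma norm_coeffs:
  assumes "u \<in> \<A>"
  shows "norm (coeffs u) = wnorm u"
  unfolding norm_ell1_eq wiener_norm_def
  by (rule infsum_cong_neutral) (auto simp: coord_coeffs[OF assms] norm_mult wt_nonneg)

lemma wiener_algebra_diff:
  assumes u: "u \<in> \<A>" and v: "v \<in> \<A>"
  shows "(\<lambda>x. u x - v x) \<in> \<A>" and "coeffs (\<lambda>x. u x - v x) = coeffs u - coeffs v"
proof -
  note i = wiener_algebra_integrable[OF u] wiener_algebra_integrable[OF v]
  have "(\<lambda>k. norm (\<F> u k) * wt k + norm (\<F> v k) * wt k) summable_on freqs d"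
    using u v unfolding wiener_algebra_def by (intro summable_on_add) auto
  then have "(\<lambda>k. norm (\<F> (\<lambda>x. u x - v x) k) * wt k) summable_on freqs d"
  proof (rule summable_on_comparison_test)
    fix k
    show "norm (\<F> (\<lambda>x. u x - v x) k) * wt k
        \<le> norm (\<F> u k) * wt k + norm (\<F> v k) * wt k"
      unfolding fourier_coeff_diff[OF i] distrib_right[symmetric]
      by (intro mult_right_mono norm_triangle_ineq4 wt_nonneg)
  qed (simp add: wt_nonneg)
  then show uv: "(\<lambda>x. u x - v x) \<in> \<A>"
    using i unfolding wiener_algebra_def by simp
  show "coeffs (\<lambda>x. u x - v x) = coeffs u - coeffs v"
    by (rule ell1_eqI) (simp add: coord_coeffs u v uv fourier_coeff_diff[OF i] algebra_simps)
qed

lemma wiener_norm_diff: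
  assumes "u \<in> \<A>" "v \<in> \<A>"
  shows "wnorm (\<lambda>x. u x - v x) = norm (coeffs u - coeffs v)"
  using norm_coeffs[OF wiener_algebra_diff(1)[OF assms]] wiener_algebra_diff(2)[OF assms] by simp

lemma
  assumes "wbound u r"
  shows wbound_wiener_algebra: "u \<in> \<A>"
    and wbound_wiener_norm: "wnorm u \<le> r"
proof -
  obtain a where a: "(\<lambda>k. norm (a k) * wt k) summable_on freqs d"
      "(\<Sum>\<^sub>\<infinity>k\<in>freqs d. norm (a k) * wt k) \<le> r" "u = series a"
    using assms unfolding wbound_def by blast
  note a' = weighted_imp_abs_summable[OF a(1)]
  have f: "k \<in> freqs d \<Longrightarrow> \<F> u k = a k" for k
    unfolding a(3) by (rule fourier_coeff_series[OF a'])
  show u: "u \<in> \<A>"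
    unfolding wiener_algebra_def using a(1) integrable_series[OF a'] summable_on_cong[of "freqs d"] f
    by (simp add: a(3) cong: summable_on_cong)
  show "wnorm u \<le> r"
    unfolding wiener_norm_def using a(2) by (simp add: f cong: infsum_cong)
qed

lemma norm_coeffs_le: "wbound u r \<Longrightarrow> norm (coeffs u) \<le> r"
  by (simp add: norm_coeffs wbound_wiener_algebra wbound_wiener_norm)

lemma norm_coeffs_diff_le:
  assumes "wbound u r" "wbound v s" "wbound (\<lambda>x. u x - v x) e"
  shows "norm (coeffs u - coeffs v) \<le> e"
  using norm_coeffs_le[OF assms(3)] wiener_algebra_diff(2) assms(1,2)[THEN wbound_wiener_algebra] by simp

text \<open>
  Fourier inversion: both sides are integrable and have the same Fourier coefficients.
\<close>
lemma AE_synth_coeffs: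
  assumes "u \<in> \<A>"
  shows "AE x in \<T>. synth (coeffs u) x = u x"
proof -
  have i: "integrable \<T> u" "integrable \<T> (synth (coeffs u))"
    using assms wbound_wiener_algebra[OF wbound_synth] by (auto intro: wiener_algebra_integrable)
  have "AE x in \<T>. synth (coeffs u) x - u x = 0"
    by (rule fourier_coeff_eq_0_imp_AE_eq_0)
       (use i in \<open>auto simp: fourier_coeff_diff fourier_coeff_synth coord_coeffs[OF assms] wt_nz\<close>)
  then show ?thesis by simp
qed

lemma wiener_norm_nonneg: "0 \<le> wnorm u"
  unfolding wiener_norm_def by (intro infsum_nonneg mult_nonneg_nonneg wt_nonneg norm_ge_zero)

end

section \<open>Estimates for the nonlinearity\<close>

text \<open>
  The factor \<open>2\<close> absorbs the exponent \<open>m + n \<le> 2\<^sup>m\<^sup>+\<^sup>n\<close> that differentiation brings down, so that the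
  same number bounds \<open>f\<close> and its Lipschitz constant on the ball of radius \<open>R\<close>.
\<close>
definition power_majorant :: "(nat \<Rightarrow> nat \<Rightarrow> complex) \<Rightarrow> real \<Rightarrow> real" where
  "power_majorant a R = (\<Sum>\<^sub>\<infinity>(m, n). norm (a m n) * (2 * R) ^ (m + n))"

definition remainder_const :: "nat \<Rightarrow> (nat \<Rightarrow> nat \<Rightarrow> complex) \<Rightarrow> real" where
  "remainder_const p a = power_majorant a 2 * real p ^ 2 * 2 ^ p"

text \<open>
  The series converges at the real point \<open>2 R\<close>, and convergence of complex families is absolute.
\<close>
lemma power_majorant_summable:
  assumes "\<And>u. ((\<lambda>(m, n). a m n * u ^ m * cnj u ^ n) has_sum f u) UNIV" "0 \<le> R"
  shows "(\<lambda>(m, n). norm (a m n) * (2 * R) ^ (m + n)) summable_on UNIV"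
proof -
  have "(\<lambda>(m, n). a m n * of_real (2 * R) ^ m * cnj (of_real (2 * R)) ^ n) summable_on UNIV"
    using assms(1)[of "of_real (2 * R)"] by (rule has_sum_imp_summable)
  then have "(\<lambda>z. norm (case z of (m, n) \<Rightarrow> a m n * of_real (2 * R) ^ m * cnj (of_real (2 * R)) ^ n)) summable_on UNIV"
    by (simp only: summable_on_iff_abs_summable_on_complex)
  then show ?thesis
    using assms(2) by (simp add: case_prod_unfold norm_mult norm_power power_add mult.assoc)
qed

lemma power_majorant_nonneg: "0 \<le> R \<Longrightarrow> 0 \<le> power_majorant a R"
  unfolding power_majorant_def by (rule infsum_nonneg) auto

context wiener_torus
begin

lemma wbound_norm_le:
  assumes "wbound u r"
  shows "norm (u x) \<le> r"
  using assms
proof (rule wboundE)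
  fix a assume a: "(\<lambda>k. norm (a k) * wt k) summable_on freqs d"
    "(\<Sum>\<^sub>\<infinity>k\<in>freqs d. norm (a k) * wt k) \<le> r" "\<And>x. ((\<lambda>k. a k * wchar k x) has_sum u x) (freqs d)"
  have "norm (u x) \<le> (\<Sum>\<^sub>\<infinity>k\<in>freqs d. norm (a k) * wt k)"
  proof (rule norm_infsum_le[OF a(3)[of x] has_sum_infsum[OF a(1)]])
    fix k
    have "norm (a k) * 1 \<le> norm (a k) * wt k" by (intro mult_left_mono wt_ge_1) auto
    then show "norm (a k * wchar k x) \<le> norm (a k) * wt k" by (simp add: norm_mult)
  qed
  with a(2) show ?thesis by simp
qed

text \<open>
  Telescoping by \<open>U\<^sup>n\<^sup>+\<^sup>1 - V\<^sup>n\<^sup>+\<^sup>1 = U (U\<^sup>n - V\<^sup>n) + (U - V) V\<^sup>n\<close>. The precise power of \<open>R\<close> matters: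
  it later becomes a power of the decaying \<open>\<zeta>\<close>.
\<close>
lemma wbound_power_diff:
  assumes "wbound u R" "wbound v R" "wbound (\<lambda>x. u x - v x) e"
  shows "wbound (\<lambda>x. u x ^ Suc n - v x ^ Suc n) (real (Suc n) * R ^ n * e)"
proof (induction n)
  case 0
  then show ?case using assms(3) by simp
next
  case (Suc n)
  have "wbound (\<lambda>x. u x * (u x ^ Suc n - v x ^ Suc n) + (u x - v x) * v x ^ Suc n)
     (R * (real (Suc n) * R ^ n * e) + e * R ^ Suc n)"
    by (intro wbound_add wbound_mult assms Suc wbound_power)
  moreover have "R * (real (Suc n) * R ^ n * e) + e * R ^ Suc n = real (Suc (Suc n)) * R ^ Suc n * e"
    by (simp add: algebra_simps)
  moreover have "(\<lambda>x. u x * (u x ^ Suc n - v x ^ Suc n) + (u x - v x) * v x ^ Suc n) =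
     (\<lambda>x. u x ^ Suc (Suc n) - v x ^ Suc (Suc n))"
    by (simp add: algebra_simps)
  ultimately show ?case by simp
qed

lemma wbound_power_diff':
  assumes "wbound u R" "wbound v R" "wbound (\<lambda>x. u x - v x) e" "1 \<le> R"
  shows "wbound (\<lambda>x. u x ^ n - v x ^ n) (real n * R ^ n * e)"
proof (cases n)
  case 0
  then show ?thesis using wbound_const[of 0] by simp
next
  case (Suc m)
  have "R ^ m \<le> R ^ Suc m" using assms(4) by simp
  then have "real n * R ^ m * e \<le> real n * R ^ n * e"
    using wbound_nonneg[OF assms(3)] Suc by (intro mult_right_mono mult_left_mono) auto
  with wbound_mono[OF wbound_power_diff[OF assms(1-3)]] Suc show ?thesis by blast
qed

end

locale wiener_nls = wiener_torus d \<omega> \<nu> for d \<omega> \<nu> +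
  fixes p :: nat and a :: "nat \<Rightarrow> nat \<Rightarrow> complex" and f :: "complex \<Rightarrow> complex"
  assumes p_ge_2: "2 \<le> p"
    and f_has_sum: "\<And>u. ((\<lambda>(m, n). a m n * u ^ m * cnj u ^ n) has_sum f u) UNIV"
begin

abbreviation maj :: "real \<Rightarrow> real" where "maj \<equiv> power_majorant a"

abbreviation C\<^sub>N :: real where "C\<^sub>N \<equiv> remainder_const p a"

lemma maj_nonneg: "0 \<le> R \<Longrightarrow> 0 \<le> maj R" by (rule power_majorant_nonneg)

lemma wbound_f:
  assumes u: "wbound u R" and R: "1 \<le> R"
  shows "wbound (\<lambda>x. f (u x)) (maj R)"
proof (rule wbound_sums[where I=UNIV and u="\<lambda>(m, n) x. a m n * u x ^ m * cnj (u x) ^ n"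
      and r="\<lambda>(m, n). norm (a m n) * (2 * R) ^ (m + n)"])
  show "(\<lambda>(m, n). norm (a m n) * (2 * R) ^ (m + n)) summable_on UNIV"
    using R by (intro power_majorant_summable[OF f_has_sum]) auto
  show "(\<Sum>\<^sub>\<infinity>(m, n). norm (a m n) * (2 * R) ^ (m + n)) \<le> maj R" by (simp add: power_majorant_def)
  show "((\<lambda>i. (case i of (m, n) \<Rightarrow> \<lambda>x. a m n * u x ^ m * cnj (u x) ^ n) x) has_sum f (u x)) UNIV" for x
    using f_has_sum[of "u x"] by (simp add: case_prod_unfold)
  fix z :: "nat \<times> nat"
  obtain m n where z: "z = (m, n)" by (cases z)
  have "wbound (\<lambda>x. a m n * u x ^ m * cnj (u x) ^ n) (norm (a m n) * R ^ m * R ^ n)"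
    by (intro wbound_mult wbound_cmult wbound_power wbound_cnj u)
  moreover have "norm (a m n) * R ^ m * R ^ n \<le> norm (a m n) * (2 * R) ^ (m + n)"
    unfolding power_add[symmetric] mult.assoc using R by (intro mult_left_mono power_mono) auto
  ultimately show "wbound (case z of (m, n) \<Rightarrow> \<lambda>x. a m n * u x ^ m * cnj (u x) ^ n)
     (case z of (m, n) \<Rightarrow> norm (a m n) * (2 * R) ^ (m + n))"
    unfolding z by (auto intro: wbound_mono)
qed

lemma wbound_f_diff:
  assumes u: "wbound u R" and v: "wbound v R" and uv: "wbound (\<lambda>x. u x - v x) e" and R: "1 \<le> R"
  shows "wbound (\<lambda>x. f (u x) - f (v x)) (maj R * e)"
proof (rule wbound_sums[where I=UNIV and u="\<lambda>(m, n) x. a m n * u x ^ m * cnj (u x) ^ n - a m n * v x ^ m * cnj (v x) ^ n"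
      and r="\<lambda>(m, n). norm (a m n) * (2 * R) ^ (m + n) * e"])
  have s: "(\<lambda>(m, n). norm (a m n) * (2 * R) ^ (m + n)) summable_on UNIV"
    using R by (intro power_majorant_summable[OF f_has_sum]) auto
  show "(\<lambda>(m, n). norm (a m n) * (2 * R) ^ (m + n) * e) summable_on UNIV"
    using summable_on_cmult_left[OF s, of e] by (simp add: case_prod_unfold)
  show "(\<Sum>\<^sub>\<infinity>(m, n). norm (a m n) * (2 * R) ^ (m + n) * e) \<le> maj R * e"
    unfolding power_majorant_def infsum_cmult_left'[symmetric] by (simp add: case_prod_unfold)
  show "((\<lambda>i. (case i of (m, n) \<Rightarrow> \<lambda>x. a m n * u x ^ m * cnj (u x) ^ n - a m n * v x ^ m * cnj (v x) ^ n) x)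
      has_sum f (u x) - f (v x)) UNIV" for x
    using has_sum_add[OF f_has_sum[of "u x"] has_sum_uminusI[OF f_has_sum[of "v x"]]]
    by (simp add: case_prod_unfold)
  fix z :: "nat \<times> nat"
  obtain m n where z: "z = (m, n)" by (cases z)
  have uvc: "wbound (\<lambda>x. cnj (u x) - cnj (v x)) e" using wbound_cnj[OF uv] by simp
  have e: "0 \<le> e" by (rule wbound_nonneg[OF uv])
  have "wbound (\<lambda>x. a m n * ((u x ^ m - v x ^ m) * cnj (u x) ^ n + v x ^ m * (cnj (u x) ^ n - cnj (v x) ^ n)))
     (norm (a m n) * (real m * R ^ m * e * R ^ n + R ^ m * (real n * R ^ n * e)))"
    by (intro wbound_add wbound_cmult wbound_mult wbound_power wbound_cnj u v uv uvc wbound_power_diff' R)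
  moreover have "norm (a m n) * (real m * R ^ m * e * R ^ n + R ^ m * (real n * R ^ n * e))
      \<le> norm (a m n) * (2 * R) ^ (m + n) * e"
  proof -
    have "real (m + n) * (R ^ (m + n) * e) \<le> 2 ^ (m + n) * (R ^ (m + n) * e)"
      using R e of_nat_less_two_power[of "m + n", where 'a=real] by (intro mult_right_mono) auto
    moreover have "real m * R ^ m * e * R ^ n + R ^ m * (real n * R ^ n * e) = real (m + n) * (R ^ (m + n) * e)"
      by (simp add: power_add algebra_simps)
    ultimately have "real m * R ^ m * e * R ^ n + R ^ m * (real n * R ^ n * e) \<le> (2 * R) ^ (m + n) * e"
      by (simp add: power_mult_distrib mult.assoc)
    then show ?thesis by (simp add: mult_left_mono mult.assoc)
  qed
  moreover have "(\<lambda>x. a m n * ((u x ^ m - v x ^ m) * cnj (u x) ^ n + v x ^ m * (cnj (u x) ^ n - cnj (v x) ^ n))) =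
      (\<lambda>x. a m n * u x ^ m * cnj (u x) ^ n - a m n * v x ^ m * cnj (v x) ^ n)"
    by (simp add: algebra_simps)
  ultimately show "wbound (case z of (m, n) \<Rightarrow> \<lambda>x. a m n * u x ^ m * cnj (u x) ^ n - a m n * v x ^ m * cnj (v x) ^ n)
     (case z of (m, n) \<Rightarrow> norm (a m n) * (2 * R) ^ (m + n) * e)"
    unfolding z by (auto intro: wbound_mono)
qed

text \<open>
  The estimate in the algebra, applied to constant functions.
\<close>
lemma norm_f_diff_le: "norm z \<le> R \<Longrightarrow> norm z' \<le> R \<Longrightarrow> 1 \<le> R \<Longrightarrow> norm (f z - f z') \<le> maj R * norm (z - z')"
  using wbound_norm_le[OF wbound_f_diff[OF wbound_mono[OF wbound_const] wbound_mono[OF wbound_const] wbound_const]] by blast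

lemma isCont_f: "isCont f z"
  unfolding isCont_def
proof (rule Lim_null[THEN iffD2], rule Lim_null_comparison)
  show "\<forall>\<^sub>F w in at z. norm (f w - f z) \<le> maj (norm z + 1) * norm (w - z)"
    unfolding eventually_at
  proof (intro exI[of _ 1] conjI ballI impI)
    fix w assume "w \<noteq> z \<and> dist w z < 1"
    then have "norm w \<le> norm z + 1" using norm_triangle_sub[of w z] by (simp add: dist_norm)
    then show "norm (f w - f z) \<le> maj (norm z + 1) * norm (w - z)" by (intro norm_f_diff_le) auto
  qed simp
  show "((\<lambda>w. maj (norm z + 1) * norm (w - z)) \<longlongrightarrow> 0) (at z)"
    by (auto intro!: tendsto_eq_intros)
qed

lemma continuous_on_f: "continuous_on UNIV f"
  by (simp add: continuous_at_imp_continuous_on isCont_f)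

definition N :: "complex \<Rightarrow> complex" where "N z = z ^ p * f z"

lemma wbound_N: "wbound u R \<Longrightarrow> 1 \<le> R \<Longrightarrow> wbound (\<lambda>x. N (u x)) (R ^ p * maj R)"
  unfolding N_def by (intro wbound_mult wbound_power wbound_f)

lemma wbound_N_diff:
  assumes u: "wbound u R" and v: "wbound v R" and uv: "wbound (\<lambda>x. u x - v x) e" and R: "1 \<le> R"
  shows "wbound (\<lambda>x. N (u x) - N (v x)) ((real p + 1) * R ^ p * maj R * e)"
proof -
  have "wbound (\<lambda>x. (u x ^ p - v x ^ p) * f (u x) + v x ^ p * (f (u x) - f (v x)))
     (real p * R ^ p * e * maj R + R ^ p * (maj R * e))"
    by (intro wbound_add wbound_mult wbound_power wbound_power_diff' wbound_f wbound_f_diff assms)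
  moreover have "(\<lambda>x. (u x ^ p - v x ^ p) * f (u x) + v x ^ p * (f (u x) - f (v x))) = (\<lambda>x. N (u x) - N (v x))"
    by (simp add: N_def algebra_simps)
  ultimately show ?thesis by (simp add: algebra_simps)
qed

text \<open>
  The second-order remainder of the power at \<open>z\<close>, compared at two points. It is small in \<open>u - v\<close> and
  in the distance \<open>s\<close> to \<open>z\<close>, and it keeps the factor \<open>\<bar>z\<bar>\<^sup>p\<^sup>-\<^sup>2\<close>.
\<close>
lemma wbound_power_taylor:
  assumes u: "wbound (\<lambda>x. u x - z) s" and v: "wbound (\<lambda>x. v x - z) s" and uv: "wbound (\<lambda>x. u x - v x) e"
    and s: "s \<le> norm z"
  shows "wbound (\<lambda>x. u x ^ (j + 2) - v x ^ (j + 2) - of_nat (j + 2) * z ^ (j + 1) * (u x - v x))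
      (real (j + 2) ^ 2 * (2 * norm z) ^ j * s * e)"
proof -
  have u2: "wbound u (2 * norm z)" and v2: "wbound v (2 * norm z)"
    using wbound_add[OF u wbound_const[of z]] wbound_add[OF v wbound_const[of z]] s
    by (auto elim: wbound_mono)
  have z2: "wbound (\<lambda>x. z) (2 * norm z)" using wbound_mono[OF wbound_const[of z]] by simp
  have s0: "0 \<le> s" and e0: "0 \<le> e" using wbound_nonneg u uv by auto
  show ?thesis
  proof (induction j)
    case 0
    have "wbound (\<lambda>x. (u x - v x) * (v x - z) + (u x - z) * (u x - v x)) (e * s + s * e)"
      by (intro wbound_add wbound_mult u v uv)
    moreover have "(\<lambda>x. (u x - v x) * (v x - z) + (u x - z) * (u x - v x)) =
       (\<lambda>x. u x ^ (0 + 2) - v x ^ (0 + 2) - of_nat (0 + 2) * z ^ (0 + 1) * (u x - v x))"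
      by (simp add: algebra_simps power2_eq_square)
    moreover have "e * s + s * e \<le> real (0 + 2) ^ 2 * (2 * norm z) ^ 0 * s * e"
      using mult_nonneg_nonneg[OF s0 e0] by (simp add: mult.commute)
    ultimately show ?case by (auto intro: wbound_mono)
  next
    case (Suc j)
    define r where "r = 2 * norm z"
    let ?n = "j + 2"
    have vz: "wbound (\<lambda>x. v x ^ Suc (j + 1) - z ^ Suc (j + 1)) (real (Suc (j + 1)) * r ^ (j + 1) * s)"
      unfolding r_def by (rule wbound_power_diff[OF v2 z2 v])
    have "wbound (\<lambda>x. u x * (u x ^ ?n - v x ^ ?n - of_nat ?n * z ^ (j + 1) * (u x - v x))
       + (u x - v x) * (v x ^ Suc (j + 1) - z ^ Suc (j + 1)) + of_nat ?n * z ^ (j + 1) * (u x - z) * (u x - v x))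
       (r * (real ?n ^ 2 * r ^ j * s * e) + e * (real (Suc (j + 1)) * r ^ (j + 1) * s)
        + norm (of_nat ?n * z ^ (j + 1) :: complex) * s * e)"
      unfolding r_def
      by (intro wbound_add wbound_mult wbound_cmult Suc u2 u uv vz[unfolded r_def])
    moreover have "(\<lambda>x. u x * (u x ^ ?n - v x ^ ?n - of_nat ?n * z ^ (j + 1) * (u x - v x))
       + (u x - v x) * (v x ^ Suc (j + 1) - z ^ Suc (j + 1)) + of_nat ?n * z ^ (j + 1) * (u x - z) * (u x - v x)) =
       (\<lambda>x. u x ^ (Suc j + 2) - v x ^ (Suc j + 2) - of_nat (Suc j + 2) * z ^ (Suc j + 1) * (u x - v x))"
      by (simp add: algebra_simps)
    moreover have "r * (real ?n ^ 2 * r ^ j * s * e) + e * (real (Suc (j + 1)) * r ^ (j + 1) * s)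
        + norm (of_nat ?n * z ^ (j + 1) :: complex) * s * e
        \<le> real (Suc j + 2) ^ 2 * r ^ Suc j * s * e"
    proof -
      have zr: "norm z ^ (j + 1) \<le> r ^ Suc j" unfolding r_def by (simp only: Suc_eq_plus1) (rule power_mono, auto)
      have X0: "0 \<le> s * e" using s0 e0 by simp
      have "norm (of_nat ?n * z ^ (j + 1) :: complex) * s * e = real ?n * norm z ^ (j + 1) * (s * e)"
        by (simp only: norm_mult norm_of_nat norm_power mult.assoc)
      also have "\<dots> \<le> real ?n * r ^ Suc j * (s * e)" using zr X0 by (intro mult_right_mono mult_left_mono) auto
      finally have "r * (real ?n ^ 2 * r ^ j * s * e) + e * (real (Suc (j + 1)) * r ^ (j + 1) * s)
        + norm (of_nat ?n * z ^ (j + 1) :: complex) * s * e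
         \<le> (real ?n ^ 2 + 2 * real ?n) * (r ^ Suc j * (s * e))"
        by (simp add: algebra_simps)
      also have "\<dots> \<le> real (Suc j + 2) ^ 2 * (r ^ Suc j * (s * e))"
      proof (rule mult_right_mono)
        show "0 \<le> r ^ Suc j * (s * e)" using X0 by (simp add: r_def)
      qed (simp add: power2_eq_square algebra_simps)
      finally show ?thesis by (simp add: mult.assoc)
    qed
    ultimately show ?case unfolding r_def by (auto intro: wbound_mono)
  qed
qed

text \<open>
  The difference is split into three parts: the variation of \<open>f\<close> between \<open>u\<close> and \<open>v\<close>, which carries the
  factor \<open>v\<^sup>p\<close>; the variation of \<open>f\<close> between \<open>z\<close> and \<open>u\<close> in the linear term; and the Taylor remainder of the
  power. Only the last one lacks the full power \<open>\<bar>z\<bar>\<^sup>p\<close>, and it has the factor \<open>s\<close> instead.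
\<close>
lemma wbound_remainder_diff:
  assumes u: "wbound (\<lambda>x. u x - z) s" and v: "wbound (\<lambda>x. v x - z) s" and uv: "wbound (\<lambda>x. u x - v x) e"
    and s: "s \<le> norm z" and z: "norm z \<le> 1"
  shows "wbound (\<lambda>x. N (u x) - N (v x) - of_nat p * z ^ (p - 1) * f z * (u x - v x))
     (C\<^sub>N * (norm z ^ p + norm z ^ (p - 2) * s) * e)"
proof -
  define r where "r = norm z"
  obtain j where p: "p = j + 2" using p_ge_2 by (metis add.commute le_Suc_ex)
  have u2: "wbound u (2 * r)" and v2: "wbound v (2 * r)"
    using wbound_add[OF u wbound_const[of z]] wbound_add[OF v wbound_const[of z]] s
    unfolding r_def by (auto elim: wbound_mono)
  have le2: "wbound u 2" "wbound v 2" "wbound (\<lambda>_. z) 2"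
    using wbound_mono[OF u2, of 2] wbound_mono[OF v2, of 2] wbound_mono[OF wbound_const[of z], of 2] z
    by (auto simp: r_def)
  define M where "M = maj 2"
  have s0: "0 \<le> s" and e0: "0 \<le> e" using wbound_nonneg u uv by auto
  have M0: "0 \<le> M" unfolding M_def by (intro maj_nonneg) auto
  have r0: "0 \<le> r" by (simp add: r_def)
  have "wbound (\<lambda>x. v x ^ p * (f (u x) - f (v x)) + of_nat p * z ^ (p - 1) * (u x - v x) * (f (u x) - f z)
      + (u x ^ (j + 2) - v x ^ (j + 2) - of_nat (j + 2) * z ^ (j + 1) * (u x - v x)) * f (u x))
      ((2 * r) ^ p * (M * e) + norm (of_nat p * z ^ (p - 1) :: complex) * e * (M * s)
       + (real (j + 2) ^ 2 * (2 * r) ^ j * s * e) * M)"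
    unfolding M_def r_def
    by (intro wbound_add wbound_mult wbound_cmult wbound_power v2[unfolded r_def] wbound_f_diff wbound_f le2 uv u v
         wbound_power_taylor s) auto
  moreover have "(\<lambda>x. v x ^ p * (f (u x) - f (v x)) + of_nat p * z ^ (p - 1) * (u x - v x) * (f (u x) - f z)
      + (u x ^ (j + 2) - v x ^ (j + 2) - of_nat (j + 2) * z ^ (j + 1) * (u x - v x)) * f (u x)) =
     (\<lambda>x. N (u x) - N (v x) - of_nat p * z ^ (p - 1) * f z * (u x - v x))"
    unfolding N_def by (simp add: p algebra_simps)
  moreover have "(2 * r) ^ p * (M * e) + norm (of_nat p * z ^ (p - 1) :: complex) * e * (M * s)
       + (real (j + 2) ^ 2 * (2 * r) ^ j * s * e) * M \<le> C\<^sub>N * (r ^ p + r ^ (p - 2) * s) * e"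
  proof -
    define X where "X = M * e"
    have X0: "0 \<le> X" using M0 e0 by (simp add: X_def)
    have p2: "real p ^ 2 \<ge> 4" using power_mono[of 2 "real p" 2] p_ge_2 by simp
    have pp: "real p \<le> 2 ^ p" using of_nat_less_two_power[of p, where 'a=real] by simp
    have "norm (of_nat p * z ^ (p - 1) :: complex) * s \<le> real p * (r ^ (p - 1) * r)"
      using s s0 unfolding r_def[symmetric] by (simp add: norm_mult norm_power r_def mult.assoc mult_left_mono)
    also have "r ^ (p - 1) * r = r ^ p" using p by simp
    finally have 1: "norm (of_nat p * z ^ (p - 1) :: complex) * s * X \<le> real p * r ^ p * X"
      using X0 by (intro mult_right_mono)
    have "(2 * r) ^ p * X + real p * r ^ p * X = (2 ^ p + real p) * (r ^ p * X)"
      by (simp add: power_mult_distrib algebra_simps)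
    also have "\<dots> \<le> (real p ^ 2 * 2 ^ p) * (r ^ p * X)"
    proof (rule mult_right_mono)
      have "(2::real) ^ p + real p \<le> 2 * 2 ^ p" using pp by simp
      also have "\<dots> \<le> real p ^ 2 * 2 ^ p" using p2 by (intro mult_right_mono) auto
      finally show "(2::real) ^ p + real p \<le> real p ^ 2 * 2 ^ p" .
    qed (use X0 r0 in auto)
    finally have 2: "(2 * r) ^ p * X + real p * r ^ p * X \<le> (real p ^ 2 * 2 ^ p) * (r ^ p * X)" .
    have "real p ^ 2 * (2 * r) ^ j * s * X = (real p ^ 2 * 2 ^ j) * (r ^ j * s * X)"
      by (simp add: power_mult_distrib algebra_simps)
    also have "\<dots> \<le> (real p ^ 2 * 2 ^ p) * (r ^ j * s * X)"
      using X0 s0 r0 p by (intro mult_right_mono mult_left_mono power_increasing) auto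
    finally have 3: "real p ^ 2 * (2 * r) ^ j * s * X \<le> (real p ^ 2 * 2 ^ p) * (r ^ j * s * X)" .
    have "(2 * r) ^ p * (M * e) + norm (of_nat p * z ^ (p - 1) :: complex) * e * (M * s)
       + (real (j + 2) ^ 2 * (2 * r) ^ j * s * e) * M =
       (2 * r) ^ p * X + norm (of_nat p * z ^ (p - 1) :: complex) * s * X + real p ^ 2 * (2 * r) ^ j * s * X"
      unfolding X_def p by (simp add: mult_ac)
    also have "\<dots> \<le> (real p ^ 2 * 2 ^ p) * (r ^ p * X) + (real p ^ 2 * 2 ^ p) * (r ^ j * s * X)"
      using 1 2 3 by linarith
    also have "\<dots> = C\<^sub>N * (r ^ p + r ^ (p - 2) * s) * e"
      unfolding X_def remainder_const_def M_def[symmetric] using p by (simp add: algebra_simps)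
    finally show ?thesis .
  qed
  ultimately show ?thesis unfolding r_def by (auto intro: wbound_mono)
qed

text \<open>
  The nonlinearity in the equation for \<open>y\<close> after the substitution \<open>u = z + z\<^sup>p y\<close>, where \<open>z\<close> is the
  value of the constant solution.
\<close>
definition scaled_remainder :: "complex \<Rightarrow> ((nat \<Rightarrow> real) \<Rightarrow> complex) \<Rightarrow> (nat \<Rightarrow> real) \<Rightarrow> complex" where
  "scaled_remainder z u x = (1 / z ^ p) * (N (z + z ^ p * u x) - N z - of_nat p * z ^ (p - 1) * f z * (z ^ p * u x))"

lemma scaled_remainder_0: "scaled_remainder z (\<lambda>x. 0) = (\<lambda>x. 0)"
  by (simp add: scaled_remainder_def[abs_def])

text \<open>
  The hypothesis \<open>\<bar>z\<bar>\<^sup>p \<rho> \<le> \<bar>z\<bar>\<close> says that the perturbation \<open>z\<^sup>p u\<close> is at most as large as \<open>z\<close>.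
\<close>
lemma wbound_scaled_remainder_diff:
  assumes u: "wbound u \<rho>" and v: "wbound v \<rho>" and uv: "wbound (\<lambda>x. u x - v x) e"
    and \<rho>: "norm z ^ p * \<rho> \<le> norm z" and z: "norm z \<le> 1" "z \<noteq> 0"
  shows "wbound (\<lambda>x. scaled_remainder z u x - scaled_remainder z v x) (C\<^sub>N * (norm z ^ p + norm z ^ (2 * p - 2) * \<rho>) * e)"
proof -
  let ?U = "\<lambda>x. z + z ^ p * u x" and ?V = "\<lambda>x. z + z ^ p * v x"
  have "wbound (\<lambda>x. N (?U x) - N (?V x) - of_nat p * z ^ (p - 1) * f z * (?U x - ?V x))
     (C\<^sub>N * (norm z ^ p + norm z ^ (p - 2) * (norm z ^ p * \<rho>)) * (norm z ^ p * e))"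
  proof (rule wbound_remainder_diff[OF _ _ _ \<rho> z(1)])
    show "wbound (\<lambda>x. ?U x - z) (norm z ^ p * \<rho>)" "wbound (\<lambda>x. ?V x - z) (norm z ^ p * \<rho>)"
      using wbound_cmult[OF u, of "z ^ p"] wbound_cmult[OF v, of "z ^ p"] by (simp_all add: norm_power)
    show "wbound (\<lambda>x. ?U x - ?V x) (norm z ^ p * e)"
      using wbound_cmult[OF uv, of "z ^ p"] by (simp add: norm_power algebra_simps)
  qed
  from wbound_cmult[OF this, of "1 / z ^ p"]
  have "wbound (\<lambda>x. 1 / z ^ p * (N (?U x) - N (?V x) - of_nat p * z ^ (p - 1) * f z * (?U x - ?V x)))
     (C\<^sub>N * (norm z ^ p + norm z ^ (p - 2) * (norm z ^ p * \<rho>)) * e)"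
    using z(2) by (simp add: norm_divide norm_power mult.assoc)
  moreover have "(\<lambda>x. 1 / z ^ p * (N (?U x) - N (?V x) - of_nat p * z ^ (p - 1) * f z * (?U x - ?V x))) =
     (\<lambda>x. scaled_remainder z u x - scaled_remainder z v x)"
    unfolding scaled_remainder_def right_diff_distrib[symmetric] by (simp add: algebra_simps)
  moreover have "norm z ^ (p - 2) * norm z ^ p = norm z ^ (2 * p - 2)"
    using p_ge_2 by (simp add: power_add[symmetric] mult_2)
  ultimately show ?thesis by (simp add: mult.assoc[symmetric])
qed

end

section \<open>Continuous curves in the Wiener algebra\<close>

context wiener_torus
begin

text \<open>
  Continuity of a curve with respect to the Wiener norm, in a form that is inherited by products and
  by compositions with \<open>f\<close>.
\<close>
definition wcont :: "real set \<Rightarrow> (real \<Rightarrow> (nat \<Rightarrow> real) \<Rightarrow> complex) \<Rightarrow> bool" where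
  "wcont T u \<longleftrightarrow> (\<forall>s\<in>T. (\<exists>r. wbound (u s) r) \<and>
     (\<forall>\<epsilon>>0. \<forall>\<^sub>F t in at s within T. wbound (\<lambda>x. u t x - u s x) \<epsilon>))"

lemma wcontI:
  assumes "\<And>s \<epsilon>. s \<in> T \<Longrightarrow> 0 < (\<epsilon>::real) \<Longrightarrow> \<exists>r. wbound (u s) r"
    and "\<And>s \<epsilon>. s \<in> T \<Longrightarrow> 0 < \<epsilon> \<Longrightarrow> \<forall>\<^sub>F t in at s within T. wbound (\<lambda>x. u t x - u s x) \<epsilon>"
  shows "wcont T u"
  using assms zero_less_one unfolding wcont_def by blast

lemma wcontD:
  assumes "wcont T u" "s \<in> T"
  shows "\<exists>r. wbound (u s) r" and "\<epsilon> > 0 \<Longrightarrow> \<forall>\<^sub>F t in at s within T. wbound (\<lambda>x. u t x - u s x) \<epsilon>"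
  using assms unfolding wcont_def by auto

lemma wcont_const:
  assumes "continuous_on T \<zeta>"
  shows "wcont T (\<lambda>t x. \<zeta> t)"
proof (rule wcontI)
  fix s \<epsilon> assume s: "s \<in> T" and \<epsilon>: "(0::real) < \<epsilon>"
  show "\<exists>r. wbound (\<lambda>x. \<zeta> s) r" using wbound_const by blast
  have "\<forall>\<^sub>F t in at s within T. dist (\<zeta> t) (\<zeta> s) < \<epsilon>"
    using assms s \<epsilon> unfolding continuous_on_def tendsto_iff by blast
  then show "\<forall>\<^sub>F t in at s within T. wbound (\<lambda>x. \<zeta> t - \<zeta> s) \<epsilon>"
    by eventually_elim (rule wbound_mono[OF wbound_const], simp add: dist_norm)
qed

lemma wcont_add:
  assumes u: "wcont T u" and v: "wcont T v"
  shows "wcont T (\<lambda>t x. u t x + v t x)"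
proof (rule wcontI)
  fix s \<epsilon> assume s: "s \<in> T" and \<epsilon>: "(0::real) < \<epsilon>"
  show "\<exists>r. wbound (\<lambda>x. u s x + v s x) r" using wcontD(1)[OF u s] wcontD(1)[OF v s] wbound_add by blast
  show "\<forall>\<^sub>F t in at s within T. wbound (\<lambda>x. u t x + v t x - (u s x + v s x)) \<epsilon>"
    using wcontD(2)[OF u s half_gt_zero[OF \<epsilon>]] wcontD(2)[OF v s half_gt_zero[OF \<epsilon>]]
  proof eventually_elim
    case (elim t)
    from wbound_add[OF this] show ?case by (simp add: algebra_simps)
  qed
qed

lemma wcont_mult:
  assumes u: "wcont T u" and v: "wcont T v"
  shows "wcont T (\<lambda>t x. u t x * v t x)"
proof (rule wcontI)
  fix s \<epsilon> assume s: "s \<in> T" and \<epsilon>: "(0::real) < \<epsilon>"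
  obtain r q where r: "wbound (u s) r" and q: "wbound (v s) q" using wcontD(1)[OF u s] wcontD(1)[OF v s] by blast
  then show "\<exists>r. wbound (\<lambda>x. u s x * v s x) r" using wbound_mult by blast
  have rq: "0 \<le> r" "0 \<le> q" using r q wbound_nonneg by auto
  define \<eta> where "\<eta> = min 1 (\<epsilon> / (1 + q + r))"
  have \<eta>: "0 < \<eta>" "\<eta> \<le> 1" "\<eta> \<le> \<epsilon> / (1 + q + r)"
    using rq \<epsilon> by (auto simp: \<eta>_def)
  then have \<eta>_le: "\<eta> * (1 + q + r) \<le> \<epsilon>"
    using rq by (simp add: pos_le_divide_eq)
  show "\<forall>\<^sub>F t in at s within T. wbound (\<lambda>x. u t x * v t x - u s x * v s x) \<epsilon>"
    using wcontD(2)[OF u s \<eta>(1)] wcontD(2)[OF v s \<eta>(1)]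
  proof eventually_elim
    case (elim t)
    have "wbound (\<lambda>x. (u t x - u s x) * (v t x - v s x) + (u t x - u s x) * v s x + u s x * (v t x - v s x))
        (\<eta> * \<eta> + \<eta> * q + r * \<eta>)"
      by (intro wbound_add wbound_mult elim r q)
    moreover have "(\<lambda>x. (u t x - u s x) * (v t x - v s x) + (u t x - u s x) * v s x + u s x * (v t x - v s x)) =
       (\<lambda>x. u t x * v t x - u s x * v s x)" by (simp add: algebra_simps)
    moreover have "\<eta> * \<eta> + \<eta> * q + r * \<eta> \<le> \<epsilon>"
    proof -
      have "\<eta> * \<eta> \<le> \<eta>" using \<eta> by (simp add: mult_left_le)
      then show ?thesis using \<eta>_le by (simp add: algebra_simps)
    qed
    ultimately show ?case by (auto intro: wbound_mono)
  qed
qed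

lemma wcont_diff:
  assumes u: "wcont T u" and v: "wcont T v"
  shows "wcont T (\<lambda>t x. u t x - v t x)"
  using wcont_add[OF u wcont_mult[OF wcont_const[of T "\<lambda>_. -1", OF continuous_on_const] v]] by simp

lemma wcont_power:
  assumes u: "wcont T u"
  shows "wcont T (\<lambda>t x. u t x ^ n)"
proof (induction n)
  case 0
  show ?case using wcont_const[OF continuous_on_const, of T 1] by simp
next
  case (Suc n)
  show ?case using wcont_mult[OF u Suc] by simp
qed

lemma wcont_synth:
  assumes "continuous_on T A"
  shows "wcont T (\<lambda>t. synth (A t))"
proof (rule wcontI)
  fix s \<epsilon> assume s: "s \<in> T" and \<epsilon>: "(0::real) < \<epsilon>"
  show "\<exists>r. wbound (synth (A s)) r" using wbound_synth by blast
  have "\<forall>\<^sub>F t in at s within T. dist (A t) (A s) < \<epsilon>"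
    using assms s \<epsilon> unfolding continuous_on_def tendsto_iff by blast
  then show "\<forall>\<^sub>F t in at s within T. wbound (\<lambda>x. synth (A t) x - synth (A s) x) \<epsilon>"
    by eventually_elim (rule wbound_mono[OF wbound_synth_diff], simp add: dist_norm)
qed

lemma continuous_on_coeffs:
  assumes u: "wcont T u"
  shows "continuous_on T (\<lambda>t. coeffs (u t))"
  unfolding continuous_on_def tendsto_iff
proof (intro ballI allI impI)
  fix s \<epsilon> assume s: "s \<in> T" and \<epsilon>: "(0::real) < \<epsilon>"
  obtain r where r: "wbound (u s) r" using wcontD(1)[OF u s] by blast
  show "\<forall>\<^sub>F t in at s within T. dist (coeffs (u t)) (coeffs (u s)) < \<epsilon>"
    using wcontD(2)[OF u s half_gt_zero[OF \<epsilon>]]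
  proof eventually_elim
    case (elim t)
    have "wbound (u t) (r + \<epsilon> / 2)" using wbound_add[OF r elim] by simp
    from norm_coeffs_diff_le[OF this r elim] show ?case using \<epsilon> by (simp add: dist_norm)
  qed
qed

end

context wiener_nls
begin

lemma wcont_f:
  assumes u: "wcont T u"
  shows "wcont T (\<lambda>t x. f (u t x))"
proof (rule wcontI)
  fix s \<epsilon> assume s: "s \<in> T" and \<epsilon>: "(0::real) < \<epsilon>"
  obtain r where r: "wbound (u s) r" using wcontD(1)[OF u s] by blast
  define R where "R = r + 1"
  have R1: "1 \<le> R" using wbound_nonneg[OF r] by (simp add: R_def)
  have rR: "wbound (u s) R" by (rule wbound_mono[OF r]) (simp add: R_def)
  then show "\<exists>r. wbound (\<lambda>x. f (u s x)) r" using wbound_f[OF _ R1] by blast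
  define \<eta> where "\<eta> = min 1 (\<epsilon> / (maj R + 1))"
  have m: "0 \<le> maj R" using R1 by (intro maj_nonneg) auto
  have \<eta>: "0 < \<eta>" "\<eta> \<le> 1" "\<eta> \<le> \<epsilon> / (maj R + 1)"
    using m \<epsilon> by (auto simp: \<eta>_def)
  then have \<eta>_le: "\<eta> * (maj R + 1) \<le> \<epsilon>"
    using m by (simp add: pos_le_divide_eq)
  show "\<forall>\<^sub>F t in at s within T. wbound (\<lambda>x. f (u t x) - f (u s x)) \<epsilon>"
    using wcontD(2)[OF u s \<eta>(1)]
  proof eventually_elim
    case (elim t)
    have "wbound (u t) R" using wbound_mono[OF wbound_add[OF r elim], of R] \<eta>(2) by (simp add: R_def)
    from wbound_f_diff[OF this rR elim R1] show ?case
      by (rule wbound_mono) (use \<eta>(1) \<eta>_le in \<open>simp add: algebra_simps\<close>)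
  qed
qed

lemma wcont_N: "wcont T u \<Longrightarrow> wcont T (\<lambda>t x. N (u t x))"
  unfolding N_def by (intro wcont_mult wcont_power wcont_f)

lemma wcont_scaled_remainder:
  assumes u: "wcont T u" and \<zeta>: "continuous_on T \<zeta>" and nz: "\<And>t. t \<in> T \<Longrightarrow> \<zeta> t \<noteq> 0"
  shows "wcont T (\<lambda>t. scaled_remainder (\<zeta> t) (u t))"
  unfolding scaled_remainder_def[abs_def]
  by (intro wcont_mult wcont_diff wcont_add wcont_N u wcont_const continuous_intros \<zeta>
      continuous_on_compose2[OF continuous_on_f] subset_UNIV)
     (use nz in auto)

end

section \<open>Integral equations on the half-line\<close>

lemma integral_has_vector_derivative_half_line:
  fixes g :: "real \<Rightarrow> 'e::banach"
  assumes "continuous_on {0..} g" "0 \<le> t"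
  shows "((\<lambda>u. integral {0..u} g) has_vector_derivative g t) (at t within {0..})"
proof -
  have "((\<lambda>u. integral {0..u} g) has_vector_derivative g t) (at t within {0..t + 1})"
    using assms by (intro integral_has_vector_derivative continuous_on_subset[OF assms(1)]) auto
  moreover have "at t within {0..t + 1} = at t within {0..}"
    by (rule at_within_nhd[of _ "{..<t + 1}"]) auto
  ultimately show ?thesis by simp
qed

lemma continuous_on_integral_half_line:
  fixes g :: "real \<Rightarrow> 'e::banach"
  assumes "continuous_on {0..} g"
  shows "continuous_on {0..} (\<lambda>u. integral {0..u} g)"
  by (rule continuous_on_vector_derivative) (rule integral_has_vector_derivative_half_line[OF assms], simp)

text \<open>
  The contraction principle on bounded continuous curves on the half-line. The weight \<open>\<kappa>\<close> serves the
  scalar equation, where the unknown is the quotient of a growing function by its expected growth;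
  for the partial differential equation it is \<open>1\<close>. Curves are extended to negative times by their
  value at \<open>0\<close>.
\<close>
lemma weighted_integral_fixed_point:
  fixes G :: "real \<Rightarrow> 'e::banach \<Rightarrow> 'e" and y0 :: 'e and \<rho> :: real
  assumes \<rho>: "0 \<le> \<rho>"
    and \<kappa>: "continuous_on {0..} \<kappa>" "\<And>t. 0 \<le> t \<Longrightarrow> (0::real) \<le> \<kappa> t"
    and cont: "\<And>y. continuous_on {0..} y \<Longrightarrow> (\<And>t. 0 \<le> t \<Longrightarrow> norm (y t) \<le> \<rho>) \<Longrightarrow> continuous_on {0..} (\<lambda>t. G t (y t))"
    and lip: "\<And>t A B. 0 \<le> t \<Longrightarrow> norm A \<le> \<rho> \<Longrightarrow> norm B \<le> \<rho> \<Longrightarrow> norm (G t A - G t B) \<le> \<l> t * norm (A - B)"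
    and \<l>: "continuous_on {0..} \<l>" "\<And>t. 0 \<le> t \<Longrightarrow> \<kappa> t * integral {0..t} \<l> \<le> 1 / 2" "\<And>t. 0 \<le> t \<Longrightarrow> 0 \<le> \<l> t"
    and bound: "\<And>y t. continuous_on {0..} y \<Longrightarrow> (\<And>t. 0 \<le> t \<Longrightarrow> norm (y t) \<le> \<rho>) \<Longrightarrow> 0 \<le> t \<Longrightarrow>
      norm (y0 + \<kappa> t *\<^sub>R integral {0..t} (\<lambda>\<tau>. G \<tau> (y \<tau>))) \<le> \<rho>"
  shows "\<exists>y. continuous_on {0..} y \<and> (\<forall>t\<ge>0. norm (y t) \<le> \<rho>) \<and>
     (\<forall>t\<ge>0. y t = y0 + \<kappa> t *\<^sub>R integral {0..t} (\<lambda>\<tau>. G \<tau> (y \<tau>)))"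
proof -
  define S where "S = cball (0 :: real \<Rightarrow>\<^sub>C 'e) \<rho>"
  define E where "E y t = y0 + \<kappa> t *\<^sub>R integral {0..t} (\<lambda>\<tau>. G \<tau> (y \<tau>))" for y t
  define \<Phi> where "\<Phi> y = Bcontfun (\<lambda>t. E (apply_bcontfun y) (max 0 t))" for y
  have S: "norm (apply_bcontfun y t) \<le> \<rho>" "continuous_on {0..} (apply_bcontfun y)" if "y \<in> S" for y t
    using that norm_bounded[of y t] by (auto simp: S_def intro: continuous_on_subset[OF continuous_on_apply_bcontfun])
  have E: "continuous_on UNIV (\<lambda>t. E y (max 0 t))" "norm (E y (max 0 t)) \<le> \<rho>"
    if y: "continuous_on {0..} y" "\<And>t. 0 \<le> t \<Longrightarrow> norm (y t) \<le> \<rho>" for y t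
  proof -
    have "continuous_on {0..} (E y)" unfolding E_def
      by (intro continuous_intros \<kappa> continuous_on_integral_half_line cont y)
    then show "continuous_on UNIV (\<lambda>t. E y (max 0 t))"
      by (rule continuous_on_compose2) (auto intro!: continuous_intros)
    show "norm (E y (max 0 t)) \<le> \<rho>" unfolding E_def by (rule bound) (use y in auto)
  qed
  have \<Phi>: "apply_bcontfun (\<Phi> y) t = E (apply_bcontfun y) (max 0 t)" if "y \<in> S" for y t
    unfolding \<Phi>_def using E[OF S(2,1)] that
    by (subst Bcontfun_inverse) (auto intro!: bcontfun_normI)
  have "\<exists>!y\<in>S. \<Phi> y = y"
  proof (rule Banach_fix[where c="1/2"])
    show "complete S" unfolding S_def by (simp add: complete_eq_closed)
    show "S \<noteq> {}" using \<rho> by (auto simp: S_def)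
    show "\<Phi> ` S \<subseteq> S"
    proof (rule image_subsetI)
      fix y assume "y \<in> S"
      have "norm (\<Phi> y) \<le> \<rho>"
        by (rule norm_bound) (use E(2)[OF S(2,1)] \<open>y \<in> S\<close> in \<open>simp add: \<Phi>\<close>)
      then show "\<Phi> y \<in> S" by (simp add: S_def)
    qed
    fix y z assume yz: "y \<in> S" "z \<in> S"
    show "dist (\<Phi> y) (\<Phi> z) \<le> 1 / 2 * dist y z"
    proof (rule dist_bound)
      fix t' :: real
      define t where "t = max 0 t'"
      have t: "0 \<le> t" by (simp add: t_def)
      have sub: "continuous_on {0..t} h" if "continuous_on {0..} h" for h :: "real \<Rightarrow> 'f::topological_space"
        using that by (rule continuous_on_subset) auto
      have int: "(\<lambda>\<tau>. G \<tau> (apply_bcontfun w \<tau>)) integrable_on {0..t}" if "w \<in> S" for w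
        by (intro integrable_continuous_real sub cont S that)
      have "E (apply_bcontfun y) t - E (apply_bcontfun z) t =
          \<kappa> t *\<^sub>R integral {0..t} (\<lambda>\<tau>. G \<tau> (apply_bcontfun y \<tau>) - G \<tau> (apply_bcontfun z \<tau>))"
        unfolding E_def by (simp add: Henstock_Kurzweil_Integration.integral_diff int yz scaleR_diff_right)
      also have "norm \<dots> \<le> \<kappa> t * integral {0..t} (\<lambda>\<tau>. \<l> \<tau> * dist y z)"
        unfolding norm_scaleR abs_of_nonneg[OF \<kappa>(2)[OF t]]
      proof (intro mult_left_mono \<kappa>(2) t Henstock_Kurzweil_Integration.integral_norm_bound_integral)
        show "(\<lambda>\<tau>. \<l> \<tau> * dist y z) integrable_on {0..t}"
          by (intro integrable_continuous_real continuous_intros sub \<l>)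
        fix \<tau> assume \<tau>: "\<tau> \<in> {0..t}"
        then have "norm (G \<tau> (apply_bcontfun y \<tau>) - G \<tau> (apply_bcontfun z \<tau>)) \<le> \<l> \<tau> * dist (apply_bcontfun y \<tau>) (apply_bcontfun z \<tau>)"
          unfolding dist_norm by (intro lip S yz) auto
        also have "\<dots> \<le> \<l> \<tau> * dist y z" using \<tau> by (intro mult_left_mono dist_bounded \<l>) auto
        finally show "norm (G \<tau> (apply_bcontfun y \<tau>) - G \<tau> (apply_bcontfun z \<tau>)) \<le> \<l> \<tau> * dist y z" .
      qed (intro Henstock_Kurzweil_Integration.integrable_diff int yz)
      also have "\<dots> = (\<kappa> t * integral {0..t} \<l>) * dist y z" by simp
      also have "\<dots> \<le> 1 / 2 * dist y z" by (intro mult_right_mono \<l> t) simp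
      finally show "dist (apply_bcontfun (\<Phi> y) t') (apply_bcontfun (\<Phi> z) t') \<le> 1 / 2 * dist y z"
        by (simp add: \<Phi> yz t_def[symmetric] dist_norm)
    qed
  qed auto
  then obtain y where y: "y \<in> S" "\<Phi> y = y" by blast
  have "apply_bcontfun y t = E (apply_bcontfun y) t" if "0 \<le> t" for t
    using \<Phi>[OF y(1), of t] y(2) that by simp
  then show ?thesis unfolding E_def using S[OF y(1)] by blast
qed

text \<open>
  Here \<open>m t\<close> stands for the norm of the family \<open>D k t\<close>, so that only finite partial sums have to be integrated.
  Comparison with \<open>exp(2 L t)\<close>: at a maximum point of \<open>exp(- 2 L t) m t\<close> the integrated inequality gains
  a factor \<open>1 / 2\<close>.
\<close>
lemma coefficientwise_gronwall:
  fixes D G :: "'k \<Rightarrow> real \<Rightarrow> complex" and m :: "real \<Rightarrow> real"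
  assumes m: "continuous_on {0..T} m" and t: "t \<in> {0..T}" and L: "0 < L"
    and D: "\<And>k t. k \<in> K \<Longrightarrow> t \<in> {0..T} \<Longrightarrow> (D k has_vector_derivative G k t) (at t within {0..T})"
    and D0: "\<And>k. k \<in> K \<Longrightarrow> D k 0 = 0"
    and G: "\<And>t F. t \<in> {0..T} \<Longrightarrow> finite F \<Longrightarrow> F \<subseteq> K \<Longrightarrow> (\<Sum>k\<in>F. norm (G k t)) \<le> L * m t"
    and sup: "\<And>t B. t \<in> {0..T} \<Longrightarrow> (\<And>F. finite F \<Longrightarrow> F \<subseteq> K \<Longrightarrow> (\<Sum>k\<in>F. norm (D k t)) \<le> B) \<Longrightarrow> m t \<le> B"
  shows "m t \<le> 0"
proof -
  have "continuous_on {0..T} (\<lambda>t. exp (- 2 * L * t) * m t)" by (intro continuous_intros m)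
  then obtain s where s: "s \<in> {0..T}" "\<And>t. t \<in> {0..T} \<Longrightarrow> exp (- 2 * L * t) * m t \<le> exp (- 2 * L * s) * m s"
    using continuous_attains_sup[of "{0..T}"] t by (metis (no_types, lifting) compact_Icc empty_iff)
  define M where "M = exp (- 2 * L * s) * m s"
  have mM: "m t \<le> M * exp (2 * L * t)" if "t \<in> {0..T}" for t
    using s(2)[OF that] unfolding M_def[symmetric] by (simp add: exp_minus field_simps)
  have ms: "m s = M * exp (2 * L * s)" by (simp add: M_def exp_minus field_simps)
  have "M \<le> 0"
  proof (rule ccontr)
    assume "\<not> M \<le> 0"
    then have M: "M > 0" by simp
    have "m s \<le> M / 2 * exp (2 * L * s)"
    proof (rule sup[OF s(1)])
      fix F assume F: "finite F" "F \<subseteq> K"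
      show "(\<Sum>k\<in>F. norm (D k s)) \<le> M / 2 * exp (2 * L * s)"
      proof (cases "s = 0")
        case True
        then have "(\<Sum>k\<in>F. norm (D k s)) = 0" using D0 F by (intro sum.neutral) auto
        then show ?thesis using M by simp
      next
        case False
        \<comment> \<open>Unimodular factors turn the sum of moduli into a linear combination, which can be differentiated.\<close>
        define \<theta> where "\<theta> k = cnj (sgn (D k s))" for k
        define E where "E t = (\<Sum>k\<in>F. \<theta> k * D k t)" for t
        have \<theta>: "norm (\<theta> k) \<le> 1" for k by (simp add: \<theta>_def norm_sgn)
        have "norm (E s - E 0) \<le> M / 2 * exp (2 * L * s) - M / 2 * exp (2 * L * 0)"
        proof (rule differentiable_bound_general[where f'="\<lambda>t. \<Sum>k\<in>F. \<theta> k * G k t" and \<phi>'="\<lambda>t. L * M * exp (2 * L * t)"])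
          show "0 < s" using False s(1) by simp
          have dE: "(E has_vector_derivative (\<Sum>k\<in>F. \<theta> k * G k t)) (at t within {0..T})" if "t \<in> {0..T}" for t
            unfolding E_def using F D that
            by (intro has_vector_derivative_sum bounded_linear.has_vector_derivative[OF bounded_linear_mult_right]) auto
          have "continuous_on {0..T} E" by (rule continuous_on_vector_derivative[OF dE])
          then show "continuous_on {0..s} E" by (rule continuous_on_subset) (use s in auto)
          show "continuous_on {0..s} (\<lambda>t. M / 2 * exp (2 * L * t))" by (intro continuous_intros)
          fix t assume t: "0 < t" "t < s"
          then have tT: "t \<in> {0..T}" "at t within {0..T} = at t" using s(1) by (auto intro: at_within_Icc_at)
          then show "(E has_vector_derivative (\<Sum>k\<in>F. \<theta> k * G k t)) (at t)" using dE by metis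
          show "((\<lambda>t. M / 2 * exp (2 * L * t)) has_vector_derivative L * M * exp (2 * L * t)) (at t)"
            unfolding has_real_derivative_iff_has_vector_derivative[symmetric]
            by (auto intro!: derivative_eq_intros)
          have "norm (\<Sum>k\<in>F. \<theta> k * G k t) \<le> (\<Sum>k\<in>F. norm (G k t))"
            by (rule sum_norm_le) (use \<theta> in \<open>auto simp: norm_mult intro: mult_left_le_one_le\<close>)
          also have "\<dots> \<le> L * m t" by (rule G[OF tT(1) F])
          also have "\<dots> \<le> L * M * exp (2 * L * t)" using mM[OF tT(1)] L by simp
          finally show "norm (\<Sum>k\<in>F. \<theta> k * G k t) \<le> L * M * exp (2 * L * t)" .
        qed
        moreover have "E s = of_real (\<Sum>k\<in>F. norm (D k s))"
          unfolding E_def of_real_sum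
        proof (rule sum.cong[OF refl])
          fix k
          have "cnj (D k s) * D k s = of_real (norm (D k s)) * of_real (norm (D k s))"
            by (simp add: mult.commute[of "cnj _"] complex_norm_square[symmetric] power2_eq_square[symmetric])
          then show "\<theta> k * D k s = of_real (norm (D k s))"
            by (cases "D k s = 0") (auto simp: \<theta>_def sgn_div_norm scaleR_conv_of_real field_simps)
        qed
        moreover have "E 0 = 0" unfolding E_def using D0 F by (intro sum.neutral) auto
        ultimately have "\<bar>\<Sum>k\<in>F. norm (D k s)\<bar> \<le> M / 2 * exp (2 * L * s) - M / 2"
          by (simp add: norm_of_real del: of_real_sum)
        then show ?thesis using M by linarith
      qed
    qed
    then show False using M unfolding ms by simp
  qed
  have "m t \<le> M * exp (2 * L * t)" by (rule mM[OF t])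
  also have "\<dots> \<le> 0" using \<open>M \<le> 0\<close> by (simp add: mult_le_0_iff)
  finally show ?thesis .
qed

section \<open>The scalar equation\<close>

lemma principal_power_lipschitz:
  fixes w w' :: complex
  assumes a: "0 \<le> a" "a \<le> (1::real)" and w: "norm w \<le> 1 / 2" "norm w' \<le> 1 / 2"
  shows "norm (exp (- of_real a * Ln (1 + w)) - exp (- of_real a * Ln (1 + w'))) \<le> 4 * norm (w - w')"
proof (rule field_differentiable_bound[where S="cball 0 (1/2)" and f'="\<lambda>w. exp (- of_real a * Ln (1 + w)) * (- of_real a * (1 / (1 + w)))"])
  fix z :: complex assume z: "z \<in> cball 0 (1/2)"
  then have z': "norm z \<le> 1/2" by simp
  then have "Re (1 + z) > 0" using abs_Re_le_cmod[of z] by simp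
  then have nn: "1 + z \<notin> \<real>\<^sub>\<le>\<^sub>0" by (auto simp: complex_nonpos_Reals_iff)
  then show "((\<lambda>w. exp (- of_real a * Ln (1 + w))) has_field_derivative
      exp (- of_real a * Ln (1 + z)) * (- of_real a * (1 / (1 + z)))) (at z within cball 0 (1/2))"
    by (auto intro!: derivative_eq_intros simp: field_simps)
  have ge: "1/2 \<le> norm (1 + z)" using norm_triangle_ineq2[of 1 "- z"] z' by simp
  have "norm (exp (- of_real a * Ln (1 + z))) = norm (1 + z) powr (- a)"
    using nn by (auto simp: powr_def)
  also have "\<dots> \<le> (1/2) powr (- a)" using ge a by (intro powr_mono2') auto
  also have "\<dots> \<le> (1/2) powr (- 1)" using a by (intro powr_mono') auto
  finally have 1: "norm (exp (- of_real a * Ln (1 + z))) \<le> 2" by (simp add: powr_minus)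
  have "norm (- of_real a * (1 / (1 + z))) = a / norm (1 + z)" using a by (simp add: norm_mult norm_divide)
  also have "\<dots> \<le> 1 / (1/2)" using ge a by (intro frac_le) auto
  finally have 2: "norm (- of_real a * (1 / (1 + z))) \<le> 2" by simp
  show "norm (exp (- of_real a * Ln (1 + z)) * (- of_real a * (1 / (1 + z)))) \<le> 4"
    unfolding norm_mult[of "exp _"] using mult_mono[OF 1 2] by simp
qed (use w in auto)

text \<open>
  The modulus of \<open>1 + c t\<close> is at least its real part, and it is at least \<open>\<bar>c\<bar> t\<close> because the cross term
  in its square is nonnegative.
\<close>
lemma half_plane_growth:
  assumes "0 \<le> Re c" "0 \<le> t"
  shows "1 \<le> Re (1 + c * of_real t)" "1 + norm c * t \<le> 2 * norm (1 + c * of_real t)" "1 \<le> norm (1 + c * of_real t)"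
proof -
  show 1: "1 \<le> Re (1 + c * of_real t)" using assms by simp
  then show 2: "1 \<le> norm (1 + c * of_real t)" using complex_Re_le_cmod[of "1 + c * of_real t"] by linarith
  have "(norm c * t) ^ 2 \<le> norm (1 + c * of_real t) ^ 2"
    using assms by (simp add: cmod_power2 power_mult_distrib) (simp add: power2_eq_square algebra_simps)
  then have "norm c * t \<le> norm (1 + c * of_real t)" by (rule power2_le_imp_le) simp
  with 2 show "1 + norm c * t \<le> 2 * norm (1 + c * of_real t)" by simp
qed

text \<open>
  The factors \<open>\<iota> = \<i>\<close> and \<open>\<iota> = -\<i>\<close> correspond to the two directions of time. For
  \<open>r = q - (1 + c t)\<close> with \<open>q = (z0 / \<zeta>)\<^sup>p\<^sup>-\<^sup>1\<close> the equation reads \<open>r' = c (f(\<zeta>) / f(0) - 1)\<close>. The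
  function \<open>r\<close> is in general unbounded, but \<open>y = r / (1 + \<bar>c\<bar> t)\<close> stays in the disc of radius \<open>1 / 4\<close>, on
  which \<open>\<zeta>\<close> is an explicit function of \<open>t\<close> and \<open>y\<close>. This yields the decay of \<open>\<zeta>\<close> together with its
  existence, without a continuation argument.
\<close>
lemma decaying_scalar_solution:
  fixes f :: "complex \<Rightarrow> complex" and z0 \<iota> :: complex and p :: nat and L :: real
  assumes p: "2 \<le> p" and f0: "f 0 \<noteq> 0" and z0: "z0 \<noteq> 0" "4 * norm z0 \<le> 1"
    and fc: "continuous_on UNIV f" and L: "0 \<le> L"
    and fL: "\<And>z z'. norm z \<le> 1 \<Longrightarrow> norm z' \<le> 1 \<Longrightarrow> norm (f z - f z') \<le> L * norm (z - z')"
    and small: "16 * L * norm z0 \<le> norm (f 0)"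
    and c_def: "c = - \<iota> * of_nat (p - 1) * f 0 * z0 ^ (p - 1)" and c: "0 \<le> Re c"
  shows "\<exists>\<zeta>. \<zeta> 0 = z0 \<and> (\<forall>t\<ge>0. \<zeta> t \<noteq> 0 \<and>
       (\<zeta> has_vector_derivative \<iota> * \<zeta> t ^ p * f (\<zeta> t)) (at t within {0..}) \<and>
       norm (\<zeta> t) \<le> 4 * norm z0 * (1 + norm c * t) powr (- 1 / (real p - 1)))"
proof -
  define b where "b = norm c"
  define a where "a = 1 / (real p - 1)"
  have a: "0 < a" "a \<le> 1" "of_nat (p - 1) * a = 1" using p by (auto simp: a_def of_nat_diff)
  have b0: "0 \<le> b" by (simp add: b_def)
  have bt: "1 \<le> 1 + b * t" if "0 \<le> t" for t using b0 that by simp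
  define A where "A t = 1 + c * of_real t" for t
  note hp = half_plane_growth[OF c, folded A_def b_def]
  have Anz: "A t \<noteq> 0" if "0 \<le> t" for t using hp(1)[OF that] by auto
  define e where "e t = of_real (1 + b * t) / A t" for t
  have e: "norm (e t * y) \<le> 1/2" if "0 \<le> t" "norm y \<le> 1/4" for t y
  proof -
    have "norm (e t) \<le> 2"
      using hp(2)[OF that(1)] bt[OF that(1)] Anz[OF that(1)]
      by (simp add: e_def norm_divide norm_of_real del: of_real_add of_real_mult) (simp add: divide_le_eq)
    then have "norm (e t) * norm y \<le> 2 * (1/4)" using that(2) by (intro mult_mono) auto
    then show ?thesis by (simp add: norm_mult)
  qed
  \<comment> \<open>The solution expressed by \<open>y\<close>, from \<open>q = (1 + c t) (1 + e(t) y)\<close>. The root is taken of each factor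
    separately, because both lie in the right half-plane while their product need not.\<close>
  define Z where "Z t y = z0 * (exp (- of_real a * Ln (A t)) * exp (- of_real a * Ln (1 + e t * y)))" for t y
  have nexp: "norm (exp (- of_real a * Ln w)) = norm w powr (- a)" if "w \<noteq> 0" for w
    using that by (simp add: powr_def)
  have one_e: "1/2 \<le> norm (1 + e t * y)" "0 < Re (1 + e t * y)" if "0 \<le> t" "norm y \<le> 1/4" for t y
    using norm_triangle_ineq2[of 1 "- (e t * y)"] e[OF that] abs_Re_le_cmod[of "e t * y"] by auto
  have Znz: "Z t y \<noteq> 0" for t y using z0 by (simp add: Z_def)
  have Zle: "norm (Z t y) \<le> 4 * norm z0 * (1 + b * t) powr (- a)" if t: "0 \<le> t" and y: "norm y \<le> 1/4" for t y
  proof -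
    have nz: "1 + e t * y \<noteq> 0" using one_e[OF t y] by auto
    have "norm (Z t y) = norm z0 * (norm (A t) powr (- a) * norm (1 + e t * y) powr (- a))"
      by (simp only: Z_def norm_mult nexp[OF Anz[OF t]] nexp[OF nz])
    also have "\<dots> \<le> norm z0 * (((1 + b * t) / 2) powr (- a) * (1/2) powr (- a))"
      using hp(2)[OF t] one_e[OF t y] a bt[OF t] by (intro mult_left_mono mult_mono powr_mono2') auto
    also have "((1 + b * t) / 2) powr (- a) * (1/2) powr (- a) = (1 + b * t) powr (- a) * (1/4) powr (- a)"
      using bt[OF t] by (simp add: powr_mult[symmetric])
    also have "norm z0 * \<dots> \<le> norm z0 * ((1 + b * t) powr (- a) * (1/4) powr (- 1))"
      using a by (intro mult_left_mono powr_mono') auto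
    finally show ?thesis by (simp add: powr_minus mult_ac)
  qed
  have pow1: "(1 + b * t) powr (- a) \<le> 1" if "0 \<le> t" for t
  proof -
    have "(1 + b * t) powr (- a) \<le> 1 powr (- a)" using bt[OF that] a by (intro powr_mono2') auto
    then show ?thesis by simp
  qed
  have Zle': "norm (Z t y) \<le> 4 * norm z0" if "0 \<le> t" "norm y \<le> 1/4" for t y
    using order_trans[OF Zle[OF that] mult_left_mono[OF pow1[OF that(1)]], of] by simp
  have Zlip: "norm (Z t y - Z t y') \<le> 8 * norm z0 * norm (y - y')"
    if t: "0 \<le> t" and y: "norm y \<le> 1/4" "norm y' \<le> 1/4" for t y y'
  proof -
    have "norm (e t) \<le> 2"
      using hp(2)[OF t] bt[OF t] Anz[OF t]
      by (simp add: e_def norm_divide norm_of_real del: of_real_add of_real_mult) (simp add: divide_le_eq)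
    have "norm (Z t y - Z t y') = norm z0 * norm (A t) powr (- a) *
        norm (exp (- of_real a * Ln (1 + e t * y)) - exp (- of_real a * Ln (1 + e t * y')))"
      by (simp only: Z_def nexp[OF Anz[OF t], symmetric] right_diff_distrib[symmetric] norm_mult mult.assoc)
    also have "\<dots> \<le> norm z0 * 1 * (4 * norm (e t * y - e t * y'))"
    proof (intro mult_mono principal_power_lipschitz e t y)
      have "norm (A t) powr (- a) \<le> 1 powr (- a)" using hp(3)[OF t] a by (intro powr_mono2') auto
      then show "norm (A t) powr (- a) \<le> 1" by simp
    qed (use a in auto)
    also have "\<dots> = norm z0 * 4 * (norm (e t) * norm (y - y'))"
      by (simp add: right_diff_distrib[symmetric] norm_mult)
    also have "\<dots> \<le> norm z0 * 4 * (2 * norm (y - y'))"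
      using \<open>norm (e t) \<le> 2\<close> by (intro mult_left_mono mult_right_mono) auto
    finally show ?thesis by simp
  qed
  define G where "G t y = c * (f (Z t y) / f 0 - 1)" for t y
  define \<kappa> where "\<kappa> t = 1 / (1 + b * t)" for t
  define \<l> where "\<l> = b * (L * (8 * norm z0)) / norm (f 0)"
  have eps: "L * (8 * norm z0) / norm (f 0) \<le> 1/2" using small f0 by (simp add: field_simps)
  have \<kappa>0: "0 \<le> \<kappa> t" if "0 \<le> t" for t using bt[OF that] by (simp add: \<kappa>_def)
  have \<kappa>bt: "\<kappa> t * (b * t) \<le> 1" if "0 \<le> t" for t using bt[OF that] by (simp add: \<kappa>_def)
  have Acont: "continuous_on {0..} A" unfolding A_def by (intro continuous_intros)
  have econt: "continuous_on {0..} e" unfolding e_def by (intro continuous_intros Acont) (use Anz in auto)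
  have nA: "A t \<notin> \<real>\<^sub>\<le>\<^sub>0" if "0 \<le> t" for t using hp(1)[OF that] by (auto simp: complex_nonpos_Reals_iff)
  have ne: "1 + e t * y \<notin> \<real>\<^sub>\<le>\<^sub>0" if "0 \<le> t" "norm y \<le> 1/4" for t y
    using one_e(2)[OF that] by (auto simp: complex_nonpos_Reals_iff)
  have Gcont: "continuous_on {0..} (\<lambda>t. G t (y t))"
    if y: "continuous_on {0..} y" "\<And>t. 0 \<le> t \<Longrightarrow> norm (y t) \<le> 1/4" for y
  proof -
    have "continuous_on {0..} (\<lambda>t. Z t (y t))"
      unfolding Z_def by (intro continuous_intros Acont econt y) (use nA ne y in auto)
    then show ?thesis unfolding G_def using f0
      by (intro continuous_intros continuous_on_compose2[OF fc]) auto
  qed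
  have Gle: "norm (G t y) \<le> b * (1/4)" if "0 \<le> t" "norm y \<le> 1/4" for t y
  proof -
    have "norm (f (Z t y) - f 0) \<le> L * norm (Z t y - 0)"
      using Zle'[OF that] z0(2) by (intro fL) auto
    also have "\<dots> \<le> L * (4 * norm z0)" using Zle'[OF that] L by (intro mult_left_mono) auto
    also have "\<dots> \<le> norm (f 0) * (1/4)" using small by simp
    finally have le: "norm (f (Z t y) - f 0) \<le> norm (f 0) * (1/4)" .
    have "f (Z t y) / f 0 - 1 = (f (Z t y) - f 0) / f 0" using f0 by (simp add: diff_divide_distrib)
    then have "norm (f (Z t y) / f 0 - 1) \<le> 1/4" using f0 le
      by (simp add: norm_divide divide_le_eq mult.commute)
    then show ?thesis unfolding G_def b_def norm_mult by (intro mult_left_mono) auto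
  qed
  have "\<exists>y. continuous_on {0..} y \<and> (\<forall>t\<ge>0. norm (y t) \<le> 1/4) \<and>
     (\<forall>t\<ge>0. y t = 0 + \<kappa> t *\<^sub>R integral {0..t} (\<lambda>\<tau>. G \<tau> (y \<tau>)))"
  proof (rule weighted_integral_fixed_point[where \<l>="\<lambda>_. \<l>"])
    show "continuous_on {0..} \<kappa>" unfolding \<kappa>_def
    proof (intro continuous_intros ballI)
      fix t :: real assume "t \<in> {0..}"
      then show "1 + b * t \<noteq> 0" using bt[of t] by auto
    qed
    show "norm (G t y - G t y') \<le> \<l> * norm (y - y')"
      if t: "0 \<le> t" and y: "norm y \<le> 1/4" "norm y' \<le> 1/4" for t y y'
    proof -
      have "G t y - G t y' = c * ((f (Z t y) - f (Z t y')) / f 0)" by (simp add: G_def algebra_simps diff_divide_distrib)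
      then have "norm (G t y - G t y') = b * (norm (f (Z t y) - f (Z t y')) / norm (f 0))"
        by (simp add: norm_mult norm_divide b_def)
      also have "\<dots> \<le> b * (L * norm (Z t y - Z t y') / norm (f 0))"
        using Zle'[OF t y(1)] Zle'[OF t y(2)] z0(2) b0 by (intro mult_left_mono divide_right_mono fL) auto
      also have "\<dots> \<le> b * (L * (8 * norm z0 * norm (y - y')) / norm (f 0))"
        using b0 L by (intro mult_left_mono divide_right_mono Zlip t y) auto
      finally show ?thesis by (simp add: \<l>_def mult_ac)
    qed
    show "\<kappa> t * integral {0..t} (\<lambda>_. \<l>) \<le> 1/2" if "0 \<le> t" for t
    proof -
      have "\<kappa> t * integral {0..t} (\<lambda>_. \<l>) = (\<kappa> t * (b * t)) * (L * (8 * norm z0) / norm (f 0))"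
        using that by (simp add: \<l>_def)
      also have "\<dots> \<le> 1 * (L * (8 * norm z0) / norm (f 0))"
        using \<kappa>bt[OF that] L by (intro mult_right_mono) auto
      finally show ?thesis using eps by simp
    qed
    show "norm (0 + \<kappa> t *\<^sub>R integral {0..t} (\<lambda>\<tau>. G \<tau> (y \<tau>))) \<le> 1/4"
      if y: "continuous_on {0..} y" "\<And>t. 0 \<le> t \<Longrightarrow> norm (y t) \<le> 1/4" and t: "0 \<le> t" for y t
    proof -
      have "norm (integral {0..t} (\<lambda>\<tau>. G \<tau> (y \<tau>))) \<le> integral {0..t} (\<lambda>\<tau>. b * (1/4))"
      proof (rule Henstock_Kurzweil_Integration.integral_norm_bound_integral)
        show "(\<lambda>\<tau>. G \<tau> (y \<tau>)) integrable_on {0..t}"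
          by (rule integrable_continuous_real, rule continuous_on_subset[OF Gcont[OF y]]) auto
        show "norm (G \<tau> (y \<tau>)) \<le> b * (1/4)" if "\<tau> \<in> {0..t}" for \<tau>
          by (rule Gle) (use that y(2) in auto)
      qed (rule integrable_const_ivl)
      then have le: "norm (integral {0..t} (\<lambda>\<tau>. G \<tau> (y \<tau>))) \<le> t * (b * (1/4))"
        using t by simp
      have "norm (\<kappa> t *\<^sub>R integral {0..t} (\<lambda>\<tau>. G \<tau> (y \<tau>))) \<le> \<kappa> t * (t * (b * (1/4)))"
        unfolding norm_scaleR abs_of_nonneg[OF \<kappa>0[OF t]] by (rule mult_left_mono[OF le \<kappa>0[OF t]])
      also have "\<dots> = (\<kappa> t * (b * t)) * (1/4)" by simp
      also have "\<dots> \<le> 1 * (1/4)" using \<kappa>bt[OF t] by (intro mult_right_mono) auto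
      finally show ?thesis by simp
    qed
    show "0 \<le> \<l>" unfolding \<l>_def using b0 L by simp
  qed (use Gcont \<kappa>0 in \<open>auto intro!: continuous_intros\<close>)
  then obtain y where yc: "continuous_on {0..} y" and y4: "\<And>t. 0 \<le> t \<Longrightarrow> norm (y t) \<le> 1/4"
    and yfix: "\<And>t. 0 \<le> t \<Longrightarrow> y t = \<kappa> t *\<^sub>R integral {0..t} (\<lambda>\<tau>. G \<tau> (y \<tau>))" by auto
  define r where "r t = integral {0..t} (\<lambda>\<tau>. G \<tau> (y \<tau>))" for t
  define \<zeta> where "\<zeta> t = Z t (y t)" for t
  have ey: "e t * y t = r t * inverse (A t)" if t: "0 \<le> t" for t
  proof -
    have "1 + b * t \<noteq> 0" using bt[OF t] by simp
    then have "of_real (1 + b * t) * y t = r t"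
      unfolding yfix[OF t] r_def[symmetric] \<kappa>_def scaleR_conv_of_real
      by (metis (no_types, lifting) mult.assoc mult_1 nonzero_eq_divide_eq of_real_1 of_real_mult mult.commute)
    then show ?thesis by (simp add: e_def divide_inverse mult_ac)
  qed
  have \<zeta>_eq: "\<zeta> t = z0 * exp (- of_real a * (Ln (A t) + Ln (1 + r t * inverse (A t))))" if "0 \<le> t" for t
    unfolding \<zeta>_def Z_def ey[OF that] by (simp add: exp_add[symmetric] algebra_simps)
  have deriv: "(\<zeta> has_vector_derivative \<iota> * \<zeta> t ^ p * f (\<zeta> t)) (at t within {0..})" if t: "0 \<le> t" for t
  proof -
    define g where "g = G t (y t)"
    define B where "B t = 1 + r t * inverse (A t)" for t
    have A': "(A has_vector_derivative c) (at t within {0..})"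
      unfolding A_def by (auto intro!: derivative_eq_intros)
    have r': "(r has_vector_derivative g) (at t within {0..})"
      unfolding r_def g_def by (rule integral_has_vector_derivative_half_line[OF Gcont[OF yc y4] t])
    have iA: "((\<lambda>t. inverse (A t)) has_vector_derivative c * - (inverse (A t) ^ 2)) (at t within {0..})"
    proof -
      have "(inverse has_field_derivative - (inverse (A t) ^ 2)) (at (A t) within A ` {0..})"
        using DERIV_inverse[OF Anz[OF t]] by (simp add: numeral_2_eq_2)
      from field_vector_diff_chain_within[OF A' this] show ?thesis by (simp only: o_def)
    qed
    have B': "(B has_vector_derivative (r t * (c * - (inverse (A t) ^ 2)) + g * inverse (A t))) (at t within {0..})"
      unfolding B_def using has_vector_derivative_add[OF has_vector_derivative_const has_vector_derivative_mult[OF r' iA]] by simp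
    have nB: "B t \<notin> \<real>\<^sub>\<le>\<^sub>0" unfolding B_def ey[OF t, symmetric] by (rule ne[OF t y4[OF t]])
    then have Bnz: "B t \<noteq> 0" by auto
    have lA: "((\<lambda>t. Ln (A t)) has_vector_derivative c * inverse (A t)) (at t within {0..})"
      using field_vector_diff_chain_within[OF A' has_field_derivative_at_within[OF has_field_derivative_Ln[OF nA[OF t]]]]
      by (simp add: o_def)
    have lB: "((\<lambda>t. Ln (B t)) has_vector_derivative (r t * (c * - (inverse (A t) ^ 2)) + g * inverse (A t)) * inverse (B t)) (at t within {0..})"
      using field_vector_diff_chain_within[OF B' has_field_derivative_at_within[OF has_field_derivative_Ln[OF nB]]]
      by (simp add: o_def)
    define \<theta>' where "\<theta>' = c * inverse (A t) + (r t * (c * - (inverse (A t) ^ 2)) + g * inverse (A t)) * inverse (B t)"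
    have \<theta>: "((\<lambda>t. Ln (A t) + Ln (B t)) has_vector_derivative \<theta>') (at t within {0..})"
      unfolding \<theta>'_def by (rule has_vector_derivative_add[OF lA lB])
    have "((\<lambda>w. z0 * exp (- of_real a * w)) has_field_derivative
        (z0 * exp (- of_real a * (Ln (A t) + Ln (B t))) * - of_real a)) (at (Ln (A t) + Ln (B t)))"
      by (auto intro!: derivative_eq_intros)
    from field_vector_diff_chain_within[OF \<theta> has_field_derivative_at_within[OF this]]
    have "((\<lambda>t. z0 * exp (- of_real a * (Ln (A t) + Ln (B t)))) has_vector_derivative
        \<theta>' * (\<zeta> t * - of_real a)) (at t within {0..})"
      unfolding \<zeta>_eq[OF t] B_def by (simp add: o_def)
    then have d: "(\<zeta> has_vector_derivative \<theta>' * (\<zeta> t * - of_real a)) (at t within {0..})"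
      by (rule has_vector_derivative_transform[rotated 2]) (use t \<zeta>_eq in \<open>auto simp: B_def\<close>)
    have AB: "A t * B t = A t + r t" using Anz[OF t] by (simp add: B_def field_simps)
    \<comment> \<open>\<open>A B = q\<close>, and so this is \<open>q' = c + r'\<close>.\<close>
    have \<theta>'_eq: "\<theta>' * (A t * B t) = c + g"
    proof -
      have "\<theta>' * (A t * B t) = c * B t + (r t * (c * - inverse (A t)) + g)"
        using Anz[OF t] Bnz by (simp add: \<theta>'_def field_simps power2_eq_square)
      also have "\<dots> = c + g" by (simp add: B_def algebra_simps)
      finally show ?thesis .
    qed
    have cg: "c + g = c * f (\<zeta> t) / f 0" by (simp add: g_def G_def \<zeta>_def algebra_simps)
    have pa: "of_nat (p - 1) * (- complex_of_real a * w) = - w" for w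
    proof -
      have "complex_of_nat (p - 1) * complex_of_real a = 1"
        using arg_cong[OF a(3), of complex_of_real] by simp
      then show ?thesis by (simp add: mult.assoc[symmetric] del: of_nat_diff)
    qed
    have "\<zeta> t ^ (p - 1) = z0 ^ (p - 1) * exp (- (Ln (A t) + Ln (B t)))"
      unfolding \<zeta>_eq[OF t] power_mult_distrib exp_of_nat_mult[symmetric] pa B_def ..
    also have "exp (- (Ln (A t) + Ln (B t))) = inverse (A t * B t)"
      unfolding exp_minus exp_add using Anz[OF t] Bnz by simp
    finally have zp': "\<zeta> t ^ (p - 1) = z0 ^ (p - 1) * inverse (A t * B t)" .
    have ABnz: "A t * B t \<noteq> 0" using Anz[OF t] Bnz by simp
    have zp: "\<zeta> t ^ (p - 1) * (A t * B t) = z0 ^ (p - 1)"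
      unfolding zp' by (simp only: mult.assoc left_inverse[OF ABnz] mult_1_right)
    have "\<theta>' * (\<zeta> t * - of_real a) = \<iota> * \<zeta> t ^ p * f (\<zeta> t)"
    proof -
      have "(\<theta>' * (\<zeta> t * - of_real a)) * (A t * B t) = (\<theta>' * (A t * B t)) * (\<zeta> t * - of_real a)"
        by (simp only: mult_ac)
      also have "\<dots> = - (c * f (\<zeta> t) / f 0) * \<zeta> t * of_real a"
        unfolding \<theta>'_eq cg by simp
      also have "\<dots> = (of_nat (p - 1) * of_real a) * \<iota> * z0 ^ (p - 1) * \<zeta> t * f (\<zeta> t)"
        using f0 by (simp add: c_def mult_ac)
      also have "\<dots> = \<iota> * z0 ^ (p - 1) * \<zeta> t * f (\<zeta> t)"
        using pa[of 1] by simp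
      also have "\<dots> = (\<iota> * \<zeta> t ^ p * f (\<zeta> t)) * (A t * B t)"
      proof -
        have "\<zeta> t ^ p = \<zeta> t ^ (p - 1) * \<zeta> t" using p by (simp add: power_eq_if mult.commute)
        then show ?thesis unfolding zp[symmetric] by (simp add: mult_ac)
      qed
      finally show ?thesis using mult_right_cancel[OF ABnz] by blast
    qed
    with d show ?thesis by simp
  qed
  have "\<zeta> 0 = z0" by (simp add: \<zeta>_eq A_def r_def)
  moreover have "\<zeta> t \<noteq> 0" for t by (simp add: \<zeta>_def Znz)
  moreover have "norm (\<zeta> t) \<le> 4 * norm z0 * (1 + norm c * t) powr (- 1 / (real p - 1))" if "0 \<le> t" for t
    using Zle[OF that y4[OF that]] by (simp add: \<zeta>_def a_def b_def)
  ultimately show ?thesis using deriv by blast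
qed

section \<open>Solutions of the partial differential equation\<close>

context wiener_torus
begin

text \<open>
  The symbol of \<open>- \<triangle>\<close>.
\<close>
definition lap :: "(nat \<Rightarrow> int) \<Rightarrow> real" where "lap k = (\<Sum>j<d. (of_int (k j) * \<omega> j)\<^sup>2)"

definition free_flow :: "real \<Rightarrow> (nat \<Rightarrow> int) ell1 \<Rightarrow> (nat \<Rightarrow> int) ell1" where
  "free_flow s = multiplier (\<lambda>k. cis (- (s * lap k)))"

lemma norm_free_flow_le: "norm (free_flow s A) \<le> norm A"
  using norm_multiplier_le[of "\<lambda>k. cis (- (s * lap k))" 1 A] by (simp add: free_flow_def)

lemma coord_free_flow: "coord (free_flow s A) k = cis (- (s * lap k)) * coord A k"
  unfolding free_flow_def by (rule coord_multiplier[where B=1]) simp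

lemma free_flow_diff: "free_flow s (A - B) = free_flow s A - free_flow s B"
  unfolding free_flow_def by (rule multiplier_diff[where B=1]) simp

lemma free_flow_0: "free_flow 0 A = A"
  by (rule ell1_eqI) (simp add: coord_free_flow)

lemma continuous_on_free_flow:
  fixes T :: "real set"
  assumes "continuous_on T A" "continuous_on T \<sigma>"
  shows "continuous_on T (\<lambda>t. free_flow (\<sigma> t) (A t))"
  unfolding free_flow_def
  by (rule continuous_on_multiplier[OF assms(1), where B=1]) (auto simp: cis_conv_exp intro!: continuous_intros assms)

lemma fourier_coeff_cmult: "\<F> (\<lambda>x. c * u x) k = c * \<F> u k"
  by (simp add: fourier_coeff_eq mult.assoc)

lemma fourier_coeff_add:
  assumes "u \<in> \<A>" "v \<in> \<A>"
  shows "\<F> (\<lambda>x. u x + v x) k = \<F> u k + \<F> v k"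
  using integrable_mult_wchar[of u k] integrable_mult_wchar[of v k] assms[THEN wiener_algebra_integrable]
  by (simp add: fourier_coeff_eq distrib_right add_divide_distrib)

lemma lap_mult_fourier_coeff_const:
  assumes "k \<in> freqs d"
  shows "complex_of_real (lap k) * \<F> (\<lambda>x. c) k = 0"
proof (cases "k = kzero")
  case True
  then show ?thesis by (simp add: lap_def kzero_def)
next
  case False
  then have "(\<integral>x. wchar kzero x * cnj (wchar k x) \<partial>\<T>) = 0"
    using integral_wchar_wchar[of kzero k] assms by auto
  then have "\<F> (\<lambda>x. 1) k = 0" by (simp add: fourier_coeff_eq wchar_kzero)
  then have "\<F> (\<lambda>x. c * 1) k = 0" unfolding fourier_coeff_cmult by simp
  then show ?thesis by simp
qed

lemma fourier_coeff_cong_AE: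
  assumes "AE x in \<T>. u x = v x" "u \<in> borel_measurable \<T>" "v \<in> borel_measurable \<T>"
  shows "\<F> u k = \<F> v k"
proof -
  have m: "(\<lambda>x. w x * cnj (wchar k x)) \<in> borel_measurable \<T>"
    if "w \<in> borel_measurable \<T>" for w
    unfolding wchar_uminus[symmetric] using that by auto
  have "(\<integral>x. u x * cnj (wchar k x) \<partial>\<T>) = (\<integral>x. v x * cnj (wchar k x) \<partial>\<T>)"
    by (rule integral_cong_AE) (use assms m in auto)
  then show ?thesis by (simp add: fourier_coeff_eq)
qed

lemma AE_eq_if_coeffs_eq:
  assumes "u \<in> \<A>" "v \<in> \<A>" "coeffs u = coeffs v"
  shows "AE x in \<T>. u x = v x"
  using AE_synth_coeffs[OF assms(1)] AE_synth_coeffs[OF assms(2)] by eventually_elim (use assms(3) in simp)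

text \<open>
  Continuity as it is required of a solution is continuity of the curve of weighted coefficients.
\<close>
lemma continuous_on_coeffs_iff:
  assumes "\<And>t. t \<in> J \<Longrightarrow> u t \<in> \<A>"
  shows "(\<forall>t\<in>J. ((\<lambda>s. wnorm (\<lambda>x. u s x - u t x)) \<longlongrightarrow> 0) (at t within J)) \<longleftrightarrow>
    continuous_on J (\<lambda>t. coeffs (u t))"
proof -
  have "((\<lambda>s. wnorm (\<lambda>x. u s x - u t x)) \<longlongrightarrow> 0) (at t within J) \<longleftrightarrow>
      ((\<lambda>s. coeffs (u s)) \<longlongrightarrow> coeffs (u t)) (at t within J)" if t: "t \<in> J" for t
  proof -
    have "((\<lambda>s. wnorm (\<lambda>x. u s x - u t x)) \<longlongrightarrow> 0) (at t within J) \<longleftrightarrow>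
        ((\<lambda>s. norm (coeffs (u s) - coeffs (u t))) \<longlongrightarrow> 0) (at t within J)"
      by (rule Lim_cong_within) (use t assms in \<open>auto simp: wiener_norm_diff\<close>)
    then show ?thesis by (simp add: Lim_null[of _ "coeffs (u t)"] tendsto_norm_zero_iff)
  qed
  then show ?thesis by (simp add: continuous_on_def)
qed

end

context wiener_nls
begin

text \<open>
  A solution is given up to null sets only, whereas \<open>wbound\<close> speaks of the continuous representative.
\<close>
lemma fourier_coeff_N_coeffs:
  assumes "u \<in> \<A>"
  shows "\<F> (\<lambda>x. u x ^ p * f (u x)) k = \<F> (\<lambda>x. N (synth (coeffs u) x)) k"
proof (rule fourier_coeff_cong_AE)
  have [measurable]: "f \<in> borel_measurable borel"
    by (rule borel_measurable_continuous_onI[OF continuous_on_f])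
  have [measurable]: "u \<in> borel_measurable \<T>" "synth (coeffs u) \<in> borel_measurable \<T>"
    using wiener_algebra_integrable[OF assms] wiener_algebra_integrable[OF wbound_wiener_algebra[OF wbound_synth]]
    by auto
  show "(\<lambda>x. u x ^ p * f (u x)) \<in> borel_measurable \<T>" by measurable
  show "(\<lambda>x. N (synth (coeffs u) x)) \<in> borel_measurable \<T>" unfolding N_def by measurable
  show "AE x in \<T>. u x ^ p * f (u x) = N (synth (coeffs u) x)"
    using AE_synth_coeffs[OF assms] by eventually_elim (simp add: N_def)
qed

text \<open>
  After the factor \<open>exp(\<i> \<lambda>\<^sub>k t)\<close> has removed the Laplacian, the differences of the coefficients solve
  equations whose right-hand sides are bounded in the summed norm by the Lipschitz estimate for the
  nonlinearity. The sign \<open>\<sigma>\<close> treats times on both sides of \<open>0\<close> at once.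
\<close>
lemma nls_solution_unique:
  assumes J': "is_interval J'" "0 \<in> J'" "J' \<subseteq> J"
    and v: "nls_solution d \<omega> \<nu> p f J' w v" and u: "nls_solution d \<omega> \<nu> p f J w u"
    and t: "t \<in> J'"
  shows "AE x in \<T>. v t x = u t x"
proof -
  define \<sigma> where "\<sigma> = (if 0 \<le> t then 1 else - 1 :: real)"
  define T where "T = \<bar>t\<bar>"
  have \<sigma>: "\<sigma> * \<sigma> = 1" "\<bar>\<sigma>\<bar> = 1" "\<sigma> * T = t" by (auto simp: \<sigma>_def T_def)
  have J: "\<sigma> * \<tau> \<in> J'" if "\<tau> \<in> {0..T}" for \<tau>
    using that J'(2) t mem_is_interval_1_I[OF J'(1), of 0 t "\<sigma> * \<tau>"] mem_is_interval_1_I[OF J'(1), of t 0 "\<sigma> * \<tau>"]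
    by (auto simp: \<sigma>_def T_def split: if_splits)
  have W: "v s \<in> \<A>" "u s \<in> \<A>" if "s \<in> J'" for s
    using that v u J'(3) unfolding nls_solution_def by auto
  have cv: "continuous_on J' (\<lambda>s. coeffs (v s))" and cu: "continuous_on J (\<lambda>s. coeffs (u s))"
    using v u continuous_on_coeffs_iff[of J' v] continuous_on_coeffs_iff[of J u] unfolding nls_solution_def by auto
  have cV: "continuous_on {0..T} (\<lambda>\<tau>. coeffs (v (\<sigma> * \<tau>)))" and cU: "continuous_on {0..T} (\<lambda>\<tau>. coeffs (u (\<sigma> * \<tau>)))"
  proof -
    have im: "(\<lambda>\<tau>. \<sigma> * \<tau>) ` {0..T} \<subseteq> J'" "(\<lambda>\<tau>. \<sigma> * \<tau>) ` {0..T} \<subseteq> J" using J J'(3) by auto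
    have c: "continuous_on {0..T} (\<lambda>\<tau>. \<sigma> * \<tau>)" by (intro continuous_intros)
    show "continuous_on {0..T} (\<lambda>\<tau>. coeffs (v (\<sigma> * \<tau>)))"
      by (rule continuous_on_compose2[OF cv c im(1)])
    show "continuous_on {0..T} (\<lambda>\<tau>. coeffs (u (\<sigma> * \<tau>)))"
      by (rule continuous_on_compose2[OF cu c im(2)])
  qed
  define m where "m \<tau> = norm (coeffs (v (\<sigma> * \<tau>)) - coeffs (u (\<sigma> * \<tau>)))" for \<tau>
  have cm: "continuous_on {0..T} m" unfolding m_def by (intro continuous_intros cV cU)
  have "bounded ((\<lambda>\<tau>. coeffs (v (\<sigma> * \<tau>))) ` {0..T} \<union> (\<lambda>\<tau>. coeffs (u (\<sigma> * \<tau>))) ` {0..T})"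
    by (intro bounded_Un[THEN iffD2] conjI compact_imp_bounded compact_continuous_image cV cU compact_Icc)
  then obtain R0 where R0: "\<And>A. A \<in> (\<lambda>\<tau>. coeffs (v (\<sigma> * \<tau>))) ` {0..T} \<union> (\<lambda>\<tau>. coeffs (u (\<sigma> * \<tau>))) ` {0..T} \<Longrightarrow> norm A \<le> R0"
    unfolding bounded_iff by blast
  define R where "R = max 1 R0"
  have R: "1 \<le> R" "\<tau> \<in> {0..T} \<Longrightarrow> norm (coeffs (v (\<sigma> * \<tau>))) \<le> R" "\<tau> \<in> {0..T} \<Longrightarrow> norm (coeffs (u (\<sigma> * \<tau>))) \<le> R" for \<tau>
    unfolding R_def using R0 by (auto simp: le_max_iff_disj)
  define L where "L = (real p + 1) * R ^ p * maj R + 1"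
  have L: "0 < L" using maj_nonneg[of R] R(1) unfolding L_def by (intro add_nonneg_pos mult_nonneg_nonneg) auto
  define q where "q k s = \<F> (v s) k - \<F> (u s) k" for k s
  define n where "n k s = \<F> (\<lambda>x. v s x ^ p * f (v s x)) k - \<F> (\<lambda>x. u s x ^ p * f (u s x)) k" for k s
  have coeffs_q: "of_real (wt k) * q k s = coord (coeffs (v s) - coeffs (u s)) k" if "k \<in> freqs d" "s \<in> J'" for k s
    using that by (simp add: q_def coord_coeffs W right_diff_distrib)
  define D where "D k \<tau> = exp (\<i> * of_real (\<sigma> * lap k) * of_real \<tau>) * (of_real (wt k) * q k (\<sigma> * \<tau>))" for k \<tau>
  define G where "G k \<tau> = exp (\<i> * of_real (\<sigma> * lap k) * of_real \<tau>) * (of_real (wt k) * (of_real \<sigma> * \<i> * n k (\<sigma> * \<tau>)))" for k \<tau>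
  have nexp: "norm (exp (\<i> * of_real (\<sigma> * lap k) * of_real \<tau>)) = 1" for k \<tau> by simp
  have m0: "m T \<le> 0"
  proof (rule coefficientwise_gronwall[where K="freqs d" and D=D and G=G and T=T, OF cm _ L])
    show "T \<in> {0..T}" by (simp add: T_def)
    fix k assume k: "k \<in> freqs d"
    show "D k 0 = 0"
    proof -
      have "AE x in \<T>. v 0 x = u 0 x"
        using v u unfolding nls_solution_def by (auto elim: eventually_elim2)
      then have "\<F> (v 0) k = \<F> (u 0) k"
        using W[OF J'(2), THEN wiener_algebra_integrable] by (intro fourier_coeff_cong_AE) auto
      then show ?thesis by (simp add: D_def q_def)
    qed
    fix \<tau> assume \<tau>: "\<tau> \<in> {0..T}"
    define s where "s = \<sigma> * \<tau>"
    have s: "s \<in> J'" "s \<in> J" using J[OF \<tau>] J'(3) by (auto simp: s_def)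
    have "((\<lambda>s. q k s) has_vector_derivative \<i> * (- of_real (lap k) * q k s + n k s)) (at s within J')"
    proof -
      have "((\<lambda>s. \<F> (v s) k) has_vector_derivative
          \<i> * (- of_real (lap k) * \<F> (v s) k + \<F> (\<lambda>x. v s x ^ p * f (v s x)) k)) (at s within J')"
        using v s k unfolding nls_solution_def lap_def by blast
      moreover have "((\<lambda>s. \<F> (u s) k) has_vector_derivative
          \<i> * (- of_real (lap k) * \<F> (u s) k + \<F> (\<lambda>x. u s x ^ p * f (u s x)) k)) (at s within J')"
        by (rule has_vector_derivative_within_subset[OF _ J'(3)]) (use u s k in \<open>unfold nls_solution_def lap_def, blast\<close>)
      ultimately show ?thesis unfolding q_def n_def
        by (rule has_vector_derivative_eq_rhs[OF has_vector_derivative_diff]) (simp add: algebra_simps)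
    qed
    then have q': "((\<lambda>s. q k s) has_vector_derivative \<i> * (- of_real (lap k) * q k s + n k s)) (at (\<sigma> * \<tau>) within (\<lambda>\<tau>. \<sigma> * \<tau>) ` {0..T})"
      unfolding s_def by (rule has_vector_derivative_within_subset) (use J in auto)
    have "((\<lambda>\<tau>. \<sigma> * \<tau>) has_vector_derivative \<sigma>) (at \<tau> within {0..T})"
      by (auto intro!: derivative_eq_intros simp: has_real_derivative_iff_has_vector_derivative[symmetric])
    from vector_diff_chain_within[OF this q']
    have 1: "((\<lambda>\<tau>. q k (\<sigma> * \<tau>)) has_vector_derivative \<sigma> *\<^sub>R (\<i> * (- of_real (lap k) * q k s + n k s))) (at \<tau> within {0..T})"
      by (simp add: o_def)
    have "((\<lambda>z. exp (\<i> * of_real (\<sigma> * lap k) * z)) has_field_derivative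
        exp (\<i> * of_real (\<sigma> * lap k) * of_real \<tau>) * (\<i> * of_real (\<sigma> * lap k))) (at (of_real \<tau>))"
      by (auto intro!: derivative_eq_intros)
    from has_vector_derivative_real_field[OF this]
    have 2: "((\<lambda>\<tau>. exp (\<i> * of_real (\<sigma> * lap k) * of_real \<tau>)) has_vector_derivative
        exp (\<i> * of_real (\<sigma> * lap k) * of_real \<tau>) * (\<i> * of_real (\<sigma> * lap k))) (at \<tau> within {0..T})"
      by (simp add: o_def)
    have 3: "((\<lambda>\<tau>. of_real (wt k) * q k (\<sigma> * \<tau>)) has_vector_derivative
        of_real (wt k) * (\<sigma> *\<^sub>R (\<i> * (- of_real (lap k) * q k s + n k s)))) (at \<tau> within {0..T})"
      by (rule bounded_linear.has_vector_derivative[OF bounded_linear_mult_right 1])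
    show "(D k has_vector_derivative G k \<tau>) (at \<tau> within {0..T})"
      unfolding D_def G_def
      by (rule has_vector_derivative_eq_rhs[OF has_vector_derivative_mult[OF 2 3]])
         (simp add: s_def scaleR_conv_of_real algebra_simps)
  next
    fix \<tau> F assume \<tau>: "\<tau> \<in> {0..T}" and F: "finite F" "F \<subseteq> freqs d"
    define s where "s = \<sigma> * \<tau>"
    have s: "s \<in> J'" using J[OF \<tau>] by (auto simp: s_def)
    define V where "V = coeffs (v s)"
    define U where "U = coeffs (u s)"
    have VR: "wbound (synth V) R" and UR: "wbound (synth U) R"
      using wbound_mono[OF wbound_synth] R \<tau> by (auto simp: V_def U_def s_def)
    have NV: "wbound (\<lambda>x. N (synth V x)) (R ^ p * maj R)" and NU: "wbound (\<lambda>x. N (synth U x)) (R ^ p * maj R)"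
      using wbound_N VR UR R(1) by auto
    have le: "norm (coeffs (\<lambda>x. N (synth V x)) - coeffs (\<lambda>x. N (synth U x))) \<le> (real p + 1) * R ^ p * maj R * norm (V - U)"
      by (rule norm_coeffs_diff_le[OF NV NU wbound_N_diff[OF VR UR wbound_synth_diff R(1)]])
    have "(\<Sum>k\<in>F. norm (G k \<tau>)) = (\<Sum>k\<in>F. norm (coord (coeffs (\<lambda>x. N (synth V x)) - coeffs (\<lambda>x. N (synth U x))) k))"
    proof (rule sum.cong[OF refl])
      fix k assume "k \<in> F"
      then have k: "k \<in> freqs d" using F by auto
      have "of_real (wt k) * n k s = coord (coeffs (\<lambda>x. N (synth V x)) - coeffs (\<lambda>x. N (synth U x))) k"
        unfolding n_def fourier_coeff_N_coeffs[OF W(1)[OF s]] fourier_coeff_N_coeffs[OF W(2)[OF s]]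
          V_def[symmetric] U_def[symmetric]
        using k by (simp add: coord_coeffs NV[THEN wbound_wiener_algebra] NU[THEN wbound_wiener_algebra] right_diff_distrib)
      moreover have "norm (G k \<tau>) = norm (of_real (wt k) * n k s)"
        unfolding G_def norm_mult nexp using \<sigma>(2) by (simp add: s_def norm_mult)
      ultimately show "norm (G k \<tau>) = norm (coord (coeffs (\<lambda>x. N (synth V x)) - coeffs (\<lambda>x. N (synth U x))) k)" by simp
    qed
    also have "\<dots> \<le> norm (coeffs (\<lambda>x. N (synth V x)) - coeffs (\<lambda>x. N (synth U x)))"
      by (rule sum_coord_le_norm[OF F(1)])
    also have "\<dots> \<le> L * norm (V - U)"
      by (rule order_trans[OF le mult_right_mono]) (simp_all add: L_def)
    finally show "(\<Sum>k\<in>F. norm (G k \<tau>)) \<le> L * m \<tau>" by (simp add: m_def V_def U_def s_def)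
  next
    fix \<tau> B assume \<tau>: "\<tau> \<in> {0..T}" and B: "\<And>F. finite F \<Longrightarrow> F \<subseteq> freqs d \<Longrightarrow> (\<Sum>k\<in>F. norm (D k \<tau>)) \<le> B"
    have s: "\<sigma> * \<tau> \<in> J'" using J[OF \<tau>] .
    show "m \<tau> \<le> B" unfolding m_def
    proof (rule norm_ell1_leI)
      fix F :: "(nat \<Rightarrow> int) set" assume F: "finite F"
      have "(\<Sum>k\<in>F. norm (coord (coeffs (v (\<sigma> * \<tau>)) - coeffs (u (\<sigma> * \<tau>))) k)) =
          (\<Sum>k\<in>F \<inter> freqs d. norm (coord (coeffs (v (\<sigma> * \<tau>)) - coeffs (u (\<sigma> * \<tau>))) k))"
        using F by (intro sum.mono_neutral_right) (auto simp: coord_coeffs W s)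
      also have "\<dots> = (\<Sum>k\<in>F \<inter> freqs d. norm (D k \<tau>))"
        by (rule sum.cong[OF refl]) (simp add: D_def norm_mult coeffs_q[OF _ s, symmetric] del: coord_simps)
      also have "\<dots> \<le> B" using F by (intro B) auto
      finally show "(\<Sum>k\<in>F. norm (coord (coeffs (v (\<sigma> * \<tau>)) - coeffs (u (\<sigma> * \<tau>))) k)) \<le> B" .
    qed
  qed
  then have "coeffs (v t) = coeffs (u t)" by (simp add: m_def \<sigma>)
  with W[OF t] show ?thesis by (intro AE_eq_if_coeffs_eq)
qed

text \<open>
  The Laplacian annihilates constants. Hence uniqueness for the scalar equation is a special case.
\<close>
lemma scalar_solution_is_nls_solution:
  assumes v: "scalar_solution p f J z v"
  shows "nls_solution d \<omega> \<nu> p f J (\<lambda>x. z) (\<lambda>t x. v t)"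
  unfolding nls_solution_def
proof (intro conjI ballI)
  have dv: "(v has_vector_derivative \<i> * v t ^ p * f (v t)) (at t within J)" if "t \<in> J" for t
    using v that by (simp add: scalar_solution_def)
  show A: "(\<lambda>x. v t) \<in> \<A>" for t by (rule wbound_wiener_algebra[OF wbound_const])
  have "continuous_on J (\<lambda>t. coeffs (\<lambda>x. v t))"
    by (rule continuous_on_coeffs[OF wcont_const], rule continuous_on_vector_derivative, erule dv)
  then have "\<forall>t\<in>J. ((\<lambda>s. wnorm (\<lambda>x. v s - v t)) \<longlongrightarrow> 0) (at t within J)"
    using continuous_on_coeffs_iff[of J "\<lambda>t x. v t"] A by simp
  then show "((\<lambda>s. wnorm (\<lambda>x. v s - v t)) \<longlongrightarrow> 0) (at t within J)" if "t \<in> J" for t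
    using that by (rule bspec)
  show "AE x in \<T>. v 0 = z" using v by (simp add: scalar_solution_def)
  fix k t assume k: "k \<in> freqs d" and t: "t \<in> J"
  have const: "\<F> (\<lambda>x. c) k = c * \<F> (\<lambda>x. 1) k" for c
    using fourier_coeff_cmult[of c "\<lambda>x. 1" k] by simp
  have "((\<lambda>s. v s * \<F> (\<lambda>x. 1) k) has_vector_derivative
      \<i> * v t ^ p * f (v t) * \<F> (\<lambda>x. 1) k) (at t within J)"
    by (rule bounded_linear.has_vector_derivative[OF bounded_linear_mult_left dv[OF t]])
  then have "((\<lambda>s. \<F> (\<lambda>x. v s) k) has_vector_derivative
      \<i> * \<F> (\<lambda>x. v t ^ p * f (v t)) k) (at t within J)"
    by (simp only: const[of "v _"] const[of "v t ^ p * f (v t)"] mult.assoc)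
  moreover have "- complex_of_real (lap k) * \<F> (\<lambda>x. v t) k = 0"
    unfolding mult_minus_left lap_mult_fourier_coeff_const[OF k] by simp
  ultimately show "((\<lambda>s. \<F> (\<lambda>x. v s) k) has_vector_derivative
      \<i> * (- complex_of_real (\<Sum>j<d. (of_int (k j) * \<omega> j)\<^sup>2) * \<F> (\<lambda>x. v t) k
        + \<F> (\<lambda>x. v t ^ p * f (v t)) k)) (at t within J)"
    unfolding lap_def[symmetric] by (simp only: add_0)
qed

lemma scalar_solution_unique:
  assumes J': "is_interval J'" "0 \<in> J'" "J' \<subseteq> J"
    and v: "scalar_solution p f J' z v" and u: "scalar_solution p f J z u"
    and t: "t \<in> J'"
  shows "v t = u t"
proof (rule ccontr)
  assume ne: "v t \<noteq> u t"
  have "AE x in \<T>. v t = u t"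
    by (rule nls_solution_unique[OF J' scalar_solution_is_nls_solution[OF v] scalar_solution_is_nls_solution[OF u] t])
  then have "emeasure \<T> (space \<T>) = 0"
    using ne by (simp add: AE_iff_measurable[OF sets.top])
  then show False using vol_pos by (simp add: emeasure_torus)
qed

end

section \<open>The perturbation equation\<close>

lemma integral_powr_decay_le:
  fixes M a b t :: real
  assumes "0 < a" "0 < b" "0 \<le> M" "0 \<le> t"
  shows "integral {0..t} (\<lambda>\<tau>. M * (1 + b * \<tau>) powr (- 1 - a)) \<le> M / (a * b)"
proof -
  define F where "F \<tau> = - (M / (a * b)) * (1 + b * \<tau>) powr (- a)" for \<tau>
  have "((\<lambda>\<tau>. M * (1 + b * \<tau>) powr (- 1 - a)) has_integral (F t - F 0)) {0..t}"
  proof (rule fundamental_theorem_of_calculus[OF assms(4)])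
    fix \<tau> assume "\<tau> \<in> {0..t}"
    then have pos: "0 < 1 + b * \<tau>" using assms(2) by (simp add: add_pos_nonneg)
    have "(F has_real_derivative - (M / (a * b)) * ((1 + b * \<tau>) powr (- a - 1) * b * (- a))) (at \<tau>)"
      unfolding F_def using pos by (auto intro!: derivative_eq_intros simp: algebra_simps)
    also have "- (M / (a * b)) * ((1 + b * \<tau>) powr (- a - 1) * b * (- a)) = M * (1 + b * \<tau>) powr (- a - 1)"
      using assms by (simp add: field_simps)
    also have "- a - 1 = - 1 - a" by simp
    finally show "(F has_vector_derivative M * (1 + b * \<tau>) powr (- 1 - a)) (at \<tau> within {0..t})"
      unfolding has_real_derivative_iff_has_vector_derivative by (rule has_vector_derivative_at_within)
  qed
  then have "integral {0..t} (\<lambda>\<tau>. M * (1 + b * \<tau>) powr (- 1 - a)) = F t - F 0" by (rule integral_unique)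
  also have "\<dots> = M / (a * b) - M / (a * b) * (1 + b * t) powr (- a)" by (simp add: F_def)
  also have "\<dots> \<le> M / (a * b)" using assms by simp
  finally show ?thesis .
qed

context wiener_nls
begin

text \<open>
  The equation for \<open>y\<close>, where \<open>u = \<zeta> + \<zeta>\<^sup>p exp(\<i> \<sigma> t \<triangle>) y\<close> and time runs in the direction \<open>\<sigma>\<close>.
\<close>
definition profile_rhs :: "real \<Rightarrow> (real \<Rightarrow> complex) \<Rightarrow> real \<Rightarrow> (nat \<Rightarrow> int) ell1 \<Rightarrow> (nat \<Rightarrow> int) ell1" where
  "profile_rhs \<sigma> \<zeta> t A = multiplier (\<lambda>_. of_real \<sigma> * \<i>) (free_flow (- \<sigma> * t) (coeffs (scaled_remainder (\<zeta> t) (synth (free_flow (\<sigma> * t) A)))))"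

lemma synth_0: "synth 0 = (\<lambda>x. 0)"
  by (rule ext) (simp add: synth_def series_def)

lemma coeffs_0: "coeffs (\<lambda>x. 0) = 0"
  using norm_coeffs_le[OF wbound_const[of 0]] by simp

text \<open>
  The hypotheses on \<open>r\<close> and \<open>\<rho>\<close> ensure that the perturbation is dominated by \<open>\<zeta>\<close> and that the Lipschitz
  constant of the right-hand side has integral at most \<open>1 / 2\<close> over the half-line. Since the
  right-hand side vanishes at \<open>0\<close>, the curve remains in the ball of radius \<open>\<rho>\<close>.
\<close>
lemma profile_exists:
  fixes \<zeta> :: "real \<Rightarrow> complex" and r b \<rho> \<sigma> :: real
  assumes \<sigma>: "\<bar>\<sigma>\<bar> = 1" and \<zeta>c: "continuous_on {0..} \<zeta>" and nz: "\<And>t. 0 \<le> t \<Longrightarrow> \<zeta> t \<noteq> 0"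
    and \<zeta>: "\<And>t. 0 \<le> t \<Longrightarrow> norm (\<zeta> t) \<le> r * (1 + b * t) powr (- 1 / (real p - 1))"
    and r: "0 \<le> r" "r \<le> 1" and b: "0 < b" and \<rho>: "0 \<le> \<rho>" "r ^ (p - 1) * \<rho> \<le> 1"
    and small: "2 * (C\<^sub>N * (r ^ p + r ^ (2 * p - 2) * \<rho>)) \<le> b / (real p - 1)"
    and y0: "norm y0 \<le> \<rho> / 2"
  shows "\<exists>y. continuous_on {0..} y \<and> (\<forall>t\<ge>0. norm (y t) \<le> \<rho>) \<and> y 0 = y0 \<and>
     (\<forall>t\<ge>0. (y has_vector_derivative profile_rhs \<sigma> \<zeta> t (y t)) (at t within {0..}))"
proof -
  define a where "a = 1 / (real p - 1)"
  have a: "0 < a" "a \<le> 1" "a * real p = 1 + a" "a * real (2 * p - 2) = 2" "a * real (p - 1) = 1"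
    using p_ge_2 by (auto simp: a_def of_nat_diff field_simps)
  define M where "M = C\<^sub>N * (r ^ p + r ^ (2 * p - 2) * \<rho>)"
  have CN: "0 \<le> C\<^sub>N" unfolding remainder_const_def using maj_nonneg[of 2] by simp
  have M: "0 \<le> M" unfolding M_def using CN r \<rho> by (intro mult_nonneg_nonneg add_nonneg_nonneg) auto
  \<comment> \<open>Both \<open>\<bar>\<zeta>\<bar>\<^sup>p\<close> and \<open>\<bar>\<zeta>\<bar>\<^sup>2\<^sup>p\<^sup>-\<^sup>2\<close> decay at least with the exponent \<open>1 + a\<close>, because \<open>a p = 1 + a\<close>,
    \<open>a (2 p - 2) = 2\<close> and \<open>a \<le> 1\<close>.\<close>
  define \<l> where "\<l> \<tau> = M * (1 + b * \<tau>) powr (- 1 - a)" for \<tau>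
  have bt: "1 \<le> 1 + b * t" if "0 \<le> t" for t using b that by simp
  have pw: "norm (\<zeta> t) ^ n \<le> r ^ n * (1 + b * t) powr (- (a * real n))" if t: "0 \<le> t" for t n
  proof -
    have "norm (\<zeta> t) ^ n \<le> (r * (1 + b * t) powr (- a)) ^ n"
      using \<zeta>[OF t] by (intro power_mono) (simp_all add: a_def)
    also have "\<dots> = r ^ n * (1 + b * t) powr (- (a * real n))"
      using bt[OF t] by (simp add: power_mult_distrib powr_realpow[symmetric] powr_powr del: powr_realpow)
    finally show ?thesis .
  qed
  have powr_le1: "(1 + b * t) powr (- c) \<le> 1" if "0 \<le> t" "0 \<le> c" for t c
    using powr_mono2'[of "- c" 1 "1 + b * t"] bt[OF that(1)] that(2) by simp
  have \<zeta>1: "norm (\<zeta> t) \<le> 1" if t: "0 \<le> t" for t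
  proof -
    have "norm (\<zeta> t) \<le> r * (1 + b * t) powr (- a)" using \<zeta>[OF t] by (simp add: a_def)
    also have "\<dots> \<le> 1 * 1" using powr_le1[OF t, of a] a r by (intro mult_mono) auto
    finally show ?thesis by simp
  qed
  have \<zeta>\<rho>: "norm (\<zeta> t) ^ p * \<rho> \<le> norm (\<zeta> t)" if t: "0 \<le> t" for t
  proof -
    have "norm (\<zeta> t) ^ (p - 1) \<le> r ^ (p - 1) * (1 + b * t) powr (- 1)" using pw[OF t, of "p - 1"] unfolding a(5) .
    also have "\<dots> \<le> r ^ (p - 1) * 1" using powr_le1[OF t, of 1] r by (intro mult_left_mono) auto
    finally have "norm (\<zeta> t) ^ (p - 1) * \<rho> \<le> r ^ (p - 1) * \<rho>" using \<rho> by (intro mult_right_mono) auto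
    then have "norm (\<zeta> t) * (norm (\<zeta> t) ^ (p - 1) * \<rho>) \<le> norm (\<zeta> t) * 1"
      using \<rho>(2) by (intro mult_left_mono) auto
    then show ?thesis using p_ge_2 by (simp add: power_eq_if mult.assoc)
  qed
  have \<l>_ge: "C\<^sub>N * (norm (\<zeta> t) ^ p + norm (\<zeta> t) ^ (2 * p - 2) * \<rho>) \<le> \<l> t" if t: "0 \<le> t" for t
  proof -
    have "norm (\<zeta> t) ^ p \<le> r ^ p * (1 + b * t) powr (- 1 - a)" using pw[OF t, of p] a(3) by simp
    moreover have "norm (\<zeta> t) ^ (2 * p - 2) * \<rho> \<le> (r ^ (2 * p - 2) * (1 + b * t) powr (- 1 - a)) * \<rho>"
    proof (rule mult_right_mono[OF _ \<rho>(1)])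
      have "norm (\<zeta> t) ^ (2 * p - 2) \<le> r ^ (2 * p - 2) * (1 + b * t) powr (- 2)"
        using pw[OF t, of "2 * p - 2"] unfolding a(4) .
      also have "\<dots> \<le> r ^ (2 * p - 2) * (1 + b * t) powr (- 1 - a)"
        using bt[OF t] a r by (intro mult_left_mono powr_mono) auto
      finally show "norm (\<zeta> t) ^ (2 * p - 2) \<le> r ^ (2 * p - 2) * (1 + b * t) powr (- 1 - a)" .
    qed
    ultimately have "C\<^sub>N * (norm (\<zeta> t) ^ p + norm (\<zeta> t) ^ (2 * p - 2) * \<rho>) \<le>
       C\<^sub>N * (r ^ p * (1 + b * t) powr (- 1 - a) + (r ^ (2 * p - 2) * (1 + b * t) powr (- 1 - a)) * \<rho>)"
      using CN by (intro mult_left_mono add_mono)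
    then show ?thesis unfolding \<l>_def M_def by (simp add: algebra_simps)
  qed
  define G where "G = profile_rhs \<sigma> \<zeta>"
  have n1: "norm (multiplier (\<lambda>_. of_real \<sigma> * \<i>) A) \<le> norm A" for A :: "(nat \<Rightarrow> int) ell1"
    using norm_multiplier_le[of "\<lambda>_. of_real \<sigma> * \<i>" 1 A] \<sigma> by (simp add: norm_mult)
  have md: "multiplier (\<lambda>_. of_real \<sigma> * \<i>) (A - B) = multiplier (\<lambda>_. of_real \<sigma> * \<i>) A - multiplier (\<lambda>_. of_real \<sigma> * \<i>) B"
    for A B :: "(nat \<Rightarrow> int) ell1"
    using multiplier_diff[of "\<lambda>_. of_real \<sigma> * \<i>" 1 A B] \<sigma> by (simp add: norm_mult)
  have wfn: "wbound (synth (free_flow (\<sigma> * t) A)) \<rho>" if "norm A \<le> \<rho>" for t A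
    by (rule wbound_mono[OF wbound_synth]) (use norm_free_flow_le[of "\<sigma> * t" A] that in simp)
  have w0: "wbound (\<lambda>x. 0) \<rho>" using wbound_mono[OF wbound_const[of 0]] \<rho> by simp
  have RmW: "\<exists>r. wbound (scaled_remainder (\<zeta> t) (synth (free_flow (\<sigma> * t) A))) r" if "norm A \<le> \<rho>" "0 \<le> t" for t A
  proof -
    have "wbound (\<lambda>x. synth (free_flow (\<sigma> * t) A) x - 0) \<rho>" using wfn[OF that(1)] by simp
    from wbound_scaled_remainder_diff[OF wfn[OF that(1)] w0 this \<zeta>\<rho>[OF that(2)] \<zeta>1[OF that(2)] nz[OF that(2)]]
    show ?thesis by (auto simp: scaled_remainder_0)
  qed
  have lip: "norm (G t A - G t B) \<le> \<l> t * norm (A - B)"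
    if t: "0 \<le> t" and A: "norm A \<le> \<rho>" and B: "norm B \<le> \<rho>" for t A B
  proof -
    let ?RA = "scaled_remainder (\<zeta> t) (synth (free_flow (\<sigma> * t) A))" and ?RB = "scaled_remainder (\<zeta> t) (synth (free_flow (\<sigma> * t) B))"
    define S where "S = free_flow (\<sigma> * t) A - free_flow (\<sigma> * t) B"
    have S: "norm S \<le> norm (A - B)" unfolding S_def free_flow_diff[symmetric] by (rule norm_free_flow_le)
    have "norm (coeffs ?RA - coeffs ?RB) \<le> C\<^sub>N * (norm (\<zeta> t) ^ p + norm (\<zeta> t) ^ (2 * p - 2) * \<rho>) * norm S"
      using RmW[OF A t] RmW[OF B t] norm_coeffs_diff_le
        wbound_scaled_remainder_diff[OF wfn[OF A] wfn[OF B] wbound_synth_diff \<zeta>\<rho>[OF t] \<zeta>1[OF t] nz[OF t]] unfolding S_def by blast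
    also have "\<dots> \<le> \<l> t * norm S" by (rule mult_right_mono[OF \<l>_ge[OF t]]) simp
    also have "\<dots> \<le> \<l> t * norm (A - B)" using S M by (intro mult_left_mono) (simp_all add: \<l>_def)
    finally have "norm (coeffs ?RA - coeffs ?RB) \<le> \<l> t * norm (A - B)" .
    moreover have "norm (G t A - G t B) \<le> norm (coeffs ?RA - coeffs ?RB)"
      unfolding G_def profile_rhs_def md[symmetric] free_flow_diff[symmetric]
      by (rule order_trans[OF n1 norm_free_flow_le])
    ultimately show ?thesis by simp
  qed
  have schr00: "free_flow s 0 = 0" for s by (rule ell1_eqI) (simp add: coord_free_flow)
  have G0: "G t 0 = 0" for t
    using n1[of 0] by (simp add: G_def profile_rhs_def schr00 synth_0 scaled_remainder_0 coeffs_0)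
  have Gc: "continuous_on {0..} (\<lambda>t. G t (y t))" if y: "continuous_on {0..} y" for y
    unfolding G_def profile_rhs_def
    by (intro continuous_on_multiplier[where B=1] continuous_on_free_flow continuous_on_coeffs wcont_scaled_remainder wcont_synth y \<zeta>c continuous_intros)
       (use nz \<sigma> in \<open>auto simp: norm_mult\<close>)
  have \<l>c: "continuous_on {0..} \<l>" unfolding \<l>_def
    by (intro continuous_intros) (use bt in \<open>fastforce simp: not_less\<close>)
  have \<l>int: "integral {0..t} \<l> \<le> 1 / 2" if t: "0 \<le> t" for t
  proof -
    have "integral {0..t} \<l> \<le> M / (a * b)"
      unfolding \<l>_def by (rule integral_powr_decay_le[OF a(1) b M t])
    also have "\<dots> \<le> 1 / 2" using small a b unfolding M_def[symmetric] by (simp add: a_def field_simps)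
    finally show ?thesis .
  qed
  have "\<exists>y. continuous_on {0..} y \<and> (\<forall>t\<ge>0. norm (y t) \<le> \<rho>) \<and>
     (\<forall>t\<ge>0. y t = y0 + 1 *\<^sub>R integral {0..t} (\<lambda>\<tau>. G \<tau> (y \<tau>)))"
  proof (rule weighted_integral_fixed_point[where \<l>=\<l> and \<kappa>="\<lambda>_. 1", OF \<rho>(1) _ _ _ lip \<l>c])
    fix y :: "real \<Rightarrow> (nat \<Rightarrow> int) ell1" and t :: real
    assume y: "continuous_on {0..} y" "\<And>t. 0 \<le> t \<Longrightarrow> norm (y t) \<le> \<rho>" and t: "0 \<le> t"
    have "norm (integral {0..t} (\<lambda>\<tau>. G \<tau> (y \<tau>))) \<le> integral {0..t} (\<lambda>\<tau>. \<l> \<tau> * \<rho>)"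
    proof (rule Henstock_Kurzweil_Integration.integral_norm_bound_integral)
      show "(\<lambda>\<tau>. G \<tau> (y \<tau>)) integrable_on {0..t}"
        by (rule integrable_continuous_real, rule continuous_on_subset[OF Gc[OF y(1)]]) auto
      show "(\<lambda>\<tau>. \<l> \<tau> * \<rho>) integrable_on {0..t}"
        by (rule integrable_continuous_real, intro continuous_intros continuous_on_subset[OF \<l>c]) auto
      fix \<tau> assume \<tau>: "\<tau> \<in> {0..t}"
      have "norm (G \<tau> (y \<tau>) - G \<tau> 0) \<le> \<l> \<tau> * norm (y \<tau> - 0)"
        by (rule lip) (use \<tau> y \<rho> in auto)
      also have "\<dots> \<le> \<l> \<tau> * \<rho>" using \<tau> y(2)[of \<tau>] M by (intro mult_left_mono) (simp_all add: \<l>_def)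
      finally show "norm (G \<tau> (y \<tau>)) \<le> \<l> \<tau> * \<rho>" by (simp add: G0)
    qed
    also have "\<dots> = integral {0..t} \<l> * \<rho>" by simp
    also have "\<dots> \<le> 1 / 2 * \<rho>" by (rule mult_right_mono[OF \<l>int[OF t] \<rho>(1)])
    finally have "norm (integral {0..t} (\<lambda>\<tau>. G \<tau> (y \<tau>))) \<le> \<rho> / 2" by simp
    then show "norm (y0 + 1 *\<^sub>R integral {0..t} (\<lambda>\<tau>. G \<tau> (y \<tau>))) \<le> \<rho>"
      using norm_triangle_ineq[of y0 "integral {0..t} (\<lambda>\<tau>. G \<tau> (y \<tau>))"] y0 by simp
  qed (use Gc \<l>int M in \<open>auto simp: \<l>_def\<close>)
  then obtain y where y: "continuous_on {0..} y" "\<And>t. 0 \<le> t \<Longrightarrow> norm (y t) \<le> \<rho>"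
    "\<And>t. 0 \<le> t \<Longrightarrow> y t = y0 + integral {0..t} (\<lambda>\<tau>. G \<tau> (y \<tau>))" by auto
  have "(y has_vector_derivative G t (y t)) (at t within {0..})" if t: "0 \<le> t" for t
  proof -
    have d: "((\<lambda>t. y0 + integral {0..t} (\<lambda>\<tau>. G \<tau> (y \<tau>))) has_vector_derivative 0 + G t (y t)) (at t within {0..})"
      by (intro has_vector_derivative_add has_vector_derivative_const integral_has_vector_derivative_half_line[OF Gc[OF y(1)] t])
    show ?thesis
    proof (rule has_vector_derivative_transform)
      show "((\<lambda>t. y0 + integral {0..t} (\<lambda>\<tau>. G \<tau> (y \<tau>))) has_vector_derivative G t (y t)) (at t within {0..})"
        using d by simp
    qed (use t y(3) in simp_all)
  qed
  moreover have "y 0 = y0" using y(3)[of 0] by simp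
  ultimately show ?thesis using y(1,2) unfolding G_def by blast
qed

text \<open>
  The terms \<open>N(\<zeta>)\<close> and \<open>p \<zeta>\<^sup>p\<^sup>-\<^sup>1 f(\<zeta>) \<zeta>\<^sup>p y\<close> that are subtracted in the remainder are those produced by
  differentiating \<open>\<zeta>\<close> and \<open>\<zeta>\<^sup>p\<close>.
\<close>
lemma perturbed_solution_coefficients:
  fixes \<zeta> :: "real \<Rightarrow> complex" and y :: "real \<Rightarrow> (nat \<Rightarrow> int) ell1" and \<sigma> :: real
  assumes \<sigma>: "\<bar>\<sigma>\<bar> = 1" and t: "0 \<le> t" and k: "k \<in> freqs d" and nz: "\<zeta> t \<noteq> 0"
    and \<zeta>: "(\<zeta> has_vector_derivative of_real \<sigma> * \<i> * \<zeta> t ^ p * f (\<zeta> t)) (at t within {0..})"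
    and y: "(y has_vector_derivative profile_rhs \<sigma> \<zeta> t (y t)) (at t within {0..})"
  defines "u \<equiv> \<lambda>t x. \<zeta> t + \<zeta> t ^ p * synth (free_flow (\<sigma> * t) (y t)) x"
  shows "((\<lambda>t. \<F> (u t) k) has_vector_derivative
     of_real \<sigma> * (\<i> * (- of_real (lap k) * \<F> (u t) k + \<F> (\<lambda>x. N (u t x)) k))) (at t within {0..})"
proof -
  define w where "w = complex_of_real (wt k)"
  have w: "w \<noteq> 0" by (simp add: w_def wt_nz)
  define \<delta> where "\<delta> = \<F> (\<lambda>x. 1) k"
  have const: "\<F> (\<lambda>x. c) k = c * \<delta>" for c
    using fourier_coeff_cmult[of c "\<lambda>x. 1" k] by (simp add: \<delta>_def)
  have lap\<delta>: "complex_of_real (lap k) * \<delta> = 0" unfolding \<delta>_def by (rule lap_mult_fourier_coeff_const[OF k])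
  define E where "E t = exp (of_real (- (\<sigma> * lap k)) * \<i> * of_real t)" for t
  have Ecis: "E t = cis (- (\<sigma> * t * lap k))" for t unfolding E_def cis_conv_exp by (simp add: mult_ac)
  define c where "c t = E t * coord (y t) k / w" for t
  have fcfn: "\<F> (synth (free_flow (\<sigma> * t) (y t))) k = c t" for t
    by (simp add: fourier_coeff_synth[OF k] coord_free_flow c_def Ecis w_def)
  note WA = wbound_wiener_algebra
  have Wf: "wbound (synth A) (norm A)" for A by (rule wbound_synth)
  have fcu: "\<F> (u t) k = \<zeta> t * \<delta> + \<zeta> t ^ p * c t" for t
    unfolding u_def
    by (subst fourier_coeff_add[OF WA[OF wbound_const] WA[OF wbound_cmult[OF Wf]]])
       (simp add: fourier_coeff_cmult const fcfn)
  define n where "n = \<F> (\<lambda>x. N (u t x)) k"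
  define z where "z = \<zeta> t"
  have Wu: "\<exists>r. 1 \<le> r \<and> wbound (u t) r"
  proof -
    have "\<exists>r. wbound (u t) r" unfolding u_def using wbound_add[OF wbound_const wbound_cmult[OF Wf]] by blast
    then obtain r where "wbound (u t) r" by blast
    then show ?thesis using wbound_mono[of "u t" r "max 1 r"] by (intro exI[of _ "max 1 r"]) auto
  qed
  then obtain r where r: "1 \<le> r" "wbound (u t) r" by blast
  note WN = wbound_N[OF r(2,1)]
  have RmE: "scaled_remainder z (synth (free_flow (\<sigma> * t) (y t))) = (\<lambda>x. (1 / z ^ p) * ((N (u t x) - N z) - of_nat p * z ^ (p - 1) * f z * z ^ p * synth (free_flow (\<sigma> * t) (y t)) x))"
    by (rule ext) (simp add: scaled_remainder_def u_def z_def mult.assoc)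
  have fcRm: "\<F> (scaled_remainder z (synth (free_flow (\<sigma> * t) (y t)))) k =
      (1 / z ^ p) * ((n - N z * \<delta>) - of_nat p * z ^ (p - 1) * f z * z ^ p * c t)"
    unfolding RmE fourier_coeff_cmult
    by (subst fourier_coeff_diff[OF wiener_algebra_integrable[OF WA[OF wbound_diff[OF WN wbound_const]]]
          wiener_algebra_integrable[OF WA[OF wbound_cmult[OF Wf]]]],
        subst fourier_coeff_diff[OF wiener_algebra_integrable[OF WA[OF WN]] wiener_algebra_integrable[OF WA[OF wbound_const]]])
       (simp add: fourier_coeff_cmult const fcfn n_def)
  have WRm: "scaled_remainder z (synth (free_flow (\<sigma> * t) (y t))) \<in> \<A>"
    unfolding RmE by (rule WA[OF wbound_cmult[OF wbound_diff[OF wbound_diff[OF WN wbound_const] wbound_cmult[OF Wf]]]])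
  have EE: "E t * cis (\<sigma> * t * lap k) = 1" by (simp add: Ecis cis_mult)
  have G: "coord (profile_rhs \<sigma> \<zeta> t (y t)) k = of_real \<sigma> * \<i> * (cis (\<sigma> * t * lap k) * (w * \<F> (scaled_remainder z (synth (free_flow (\<sigma> * t) (y t)))) k))"
    unfolding profile_rhs_def using \<sigma> k
    by (subst coord_multiplier[where B=1]) (simp_all add: norm_mult coord_free_flow coord_coeffs[OF WRm[unfolded z_def]] w_def z_def)
  have dy: "((\<lambda>t. coord (y t) k) has_vector_derivative coord (profile_rhs \<sigma> \<zeta> t (y t)) k) (at t within {0..})"
    by (rule bounded_linear.has_vector_derivative[OF bounded_linear_coord y])
  have "((\<lambda>z. exp (of_real (- (\<sigma> * lap k)) * \<i> * z)) has_field_derivative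
      E t * (of_real (- (\<sigma> * lap k)) * \<i>)) (at (of_real t))"
    unfolding E_def by (auto intro!: derivative_eq_intros)
  from has_vector_derivative_real_field[OF this, of "{0..}"]
  have dE: "(E has_vector_derivative E t * (of_real (- (\<sigma> * lap k)) * \<i>)) (at t within {0..})"
    by (simp add: o_def E_def[abs_def])
  define c' where "c' = of_real (- (\<sigma> * lap k)) * \<i> * c t + of_real \<sigma> * \<i> * \<F> (scaled_remainder z (synth (free_flow (\<sigma> * t) (y t)))) k"
  have dc: "(c has_vector_derivative c') (at t within {0..})"
  proof -
    have d: "((\<lambda>t. (E t * coord (y t) k) * inverse w) has_vector_derivative
       (E t * coord (profile_rhs \<sigma> \<zeta> t (y t)) k + E t * (of_real (- (\<sigma> * lap k)) * \<i>) * coord (y t) k) * inverse w) (at t within {0..})"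
      by (intro bounded_linear.has_vector_derivative[OF bounded_linear_mult_left] has_vector_derivative_mult dE dy)
    have 1: "E t * coord (profile_rhs \<sigma> \<zeta> t (y t)) k * inverse w =
       of_real \<sigma> * \<i> * \<F> (scaled_remainder z (synth (free_flow (\<sigma> * t) (y t)))) k * (E t * cis (\<sigma> * t * lap k))"
      unfolding G using w by (simp add: field_simps)
    have 2: "E t * (of_real (- (\<sigma> * lap k)) * \<i>) * coord (y t) k * inverse w = of_real (- (\<sigma> * lap k)) * \<i> * c t"
      unfolding c_def divide_inverse by (simp only: mult_ac)
    show ?thesis
      using d unfolding distrib_right 1 2 EE mult_1_right c'_def add.commute[of "of_real (- (\<sigma> * lap k)) * \<i> * c t"]
      by (simp only: c_def[abs_def] divide_inverse)
  qed
  have dp: "((\<lambda>t. \<zeta> t ^ p) has_vector_derivative (of_real \<sigma> * \<i> * N z) * (of_nat p * z ^ (p - 1))) (at t within {0..})"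
  proof -
    have "((\<lambda>w. w ^ p) has_field_derivative of_nat p * z ^ (p - 1)) (at (\<zeta> t) within \<zeta> ` {0..})"
      unfolding z_def by (auto intro!: derivative_eq_intros)
    from field_vector_diff_chain_within[OF \<zeta> this] show ?thesis by (simp add: o_def N_def z_def mult.assoc)
  qed
  have "((\<lambda>t. \<zeta> t * \<delta> + \<zeta> t ^ p * c t) has_vector_derivative
     of_real \<sigma> * \<i> * N z * \<delta> + (z ^ p * c' + (of_real \<sigma> * \<i> * N z) * (of_nat p * z ^ (p - 1)) * c t)) (at t within {0..})"
  proof (rule has_vector_derivative_add)
    show "((\<lambda>t. \<zeta> t * \<delta>) has_vector_derivative of_real \<sigma> * \<i> * N z * \<delta>) (at t within {0..})"
      using bounded_linear.has_vector_derivative[OF bounded_linear_mult_left \<zeta>, of \<delta>] by (simp add: N_def z_def mult.assoc)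
    show "((\<lambda>t. \<zeta> t ^ p * c t) has_vector_derivative z ^ p * c' + (of_real \<sigma> * \<i> * N z) * (of_nat p * z ^ (p - 1)) * c t) (at t within {0..})"
      using has_vector_derivative_mult[OF dp dc] by (simp add: z_def)
  qed
  moreover have "of_real \<sigma> * \<i> * N z * \<delta> + (z ^ p * c' + (of_real \<sigma> * \<i> * N z) * (of_nat p * z ^ (p - 1)) * c t)
     = of_real \<sigma> * (\<i> * (- of_real (lap k) * (z * \<delta> + z ^ p * c t) + n))"
  proof -
    define X where "X = z ^ p * \<F> (scaled_remainder z (synth (free_flow (\<sigma> * t) (y t)))) k"
    have X: "X = (n - N z * \<delta>) - of_nat p * z ^ (p - 1) * N z * c t"
      unfolding X_def fcRm using nz by (simp add: z_def N_def)
    have zc: "z ^ p * c' = - of_real \<sigma> * \<i> * of_real (lap k) * (z ^ p * c t)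
       + of_real \<sigma> * \<i> * ((n - N z * \<delta>) - of_nat p * z ^ (p - 1) * N z * c t)"
      unfolding X[symmetric] X_def c'_def by (simp add: algebra_simps)
    have "of_real (lap k) * (z * \<delta> + z ^ p * c t) = of_real (lap k) * \<delta> * z + of_real (lap k) * (z ^ p * c t)"
      by (simp only: distrib_left mult_ac)
    then have lz: "- of_real (lap k) * (z * \<delta> + z ^ p * c t) = - (of_real (lap k) * (z ^ p * c t))"
      unfolding lap\<delta> by simp
    show ?thesis unfolding zc lz by (simp add: algebra_simps)
  qed
  ultimately show ?thesis unfolding fcu n_def z_def by simp
qed

end

section \<open>Decay in the direction selected by the initial value\<close>

context wiener_nls
begin

text \<open>
  The hypothesis \<open>dir\<close> is the condition on \<open>z0\<close> that selects the direction of time \<open>\<sigma>\<close>.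
\<close>
lemma global_decay_direction:
  fixes \<sigma> \<delta> :: real and J :: "real set" and F :: "real filter"
  assumes \<sigma>: "\<sigma> = 1 \<or> \<sigma> = - 1" and J: "J = {t. 0 \<le> \<sigma> * t}" and F: "filterlim (\<lambda>t. \<sigma> * t) at_top F"
    and f0: "f 0 \<noteq> 0"
    and \<delta>: "0 < \<delta>" "4 ^ p * \<delta> \<le> 1" "6 * C\<^sub>N * 16 ^ p * \<delta> \<le> norm (f 0)" "16 * maj 1 * \<delta> \<le> norm (f 0)"
    and z0: "z0 \<noteq> 0" "norm z0 < \<delta>"
    and dir: "0 \<le> Re (- (of_real \<sigma> * \<i>) * of_nat (p - 1) * f 0 * z0 ^ (p - 1))"
    and u0: "u0 \<in> \<A>" "wnorm u0 < \<delta> * norm z0 ^ (p - 1)"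
  shows "global_decay d \<omega> \<nu> p f J F z0 u0"
proof -
  have \<sigma>1: "\<bar>\<sigma>\<bar> = 1" "\<sigma> * \<sigma> = 1" using \<sigma> by auto
  define c where "c = - (of_real \<sigma> * \<i>) * of_nat (p - 1) * f 0 * z0 ^ (p - 1)"
  define b where "b = norm c"
  define s where "s = norm z0"
  define r where "r = 4 * s"
  have s: "0 < s" "s < \<delta>" using z0 by (auto simp: s_def)
  have p4: "4 \<le> (4::real) ^ p" using power_increasing[of 1 p "4::real"] p_ge_2 by simp
  have "4 * \<delta> \<le> 4 ^ p * \<delta>" using \<delta>(1) p4 by (intro mult_right_mono) auto
  then have \<delta>4: "4 * \<delta> \<le> 1" using \<delta>(2) by simp
  have r: "0 \<le> r" "r \<le> 1" using s \<delta>4 by (auto simp: r_def)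
  have b_eq: "b = (real p - 1) * norm (f 0) * s ^ (p - 1)"
  proof -
    have "b = real (p - 1) * norm (f 0) * s ^ (p - 1)"
      unfolding b_def c_def s_def norm_mult norm_power norm_of_nat using \<sigma>1(1) by (simp add: norm_mult)
    then show ?thesis using p_ge_2 by (simp add: of_nat_diff)
  qed
  have b: "0 < b" unfolding b_eq using p_ge_2 f0 s by simp
  define L where "L = maj 1"
  have L: "0 \<le> L" unfolding L_def by (intro maj_nonneg) simp
  have "16 * L * s \<le> 16 * L * \<delta>" using s L by (intro mult_left_mono) auto
  with \<delta>(4) have Ls: "16 * L * norm z0 \<le> norm (f 0)" by (simp add: L_def s_def)
  have fL: "norm z \<le> 1 \<Longrightarrow> norm z' \<le> 1 \<Longrightarrow> norm (f z - f z') \<le> L * norm (z - z')" for z z'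
    unfolding L_def by (rule norm_f_diff_le) auto
  obtain \<zeta> where \<zeta>0: "\<zeta> 0 = z0" and \<zeta>nz: "\<And>t. 0 \<le> t \<Longrightarrow> \<zeta> t \<noteq> 0"
    and \<zeta>d: "\<And>t. 0 \<le> t \<Longrightarrow> (\<zeta> has_vector_derivative of_real \<sigma> * \<i> * \<zeta> t ^ p * f (\<zeta> t)) (at t within {0..})"
    and \<zeta>le: "\<And>t. 0 \<le> t \<Longrightarrow> norm (\<zeta> t) \<le> r * (1 + b * t) powr (- 1 / (real p - 1))"
    using decaying_scalar_solution[OF p_ge_2 f0 z0(1) _ continuous_on_f L fL Ls refl dir] r(2)
    unfolding r_def s_def b_def c_def by auto
  have \<zeta>c: "continuous_on {0..} \<zeta>"
    by (rule continuous_on_vector_derivative) (use \<zeta>d in auto)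
  \<comment> \<open>Twice the bound for the initial value \<open>u0 / z0\<^sup>p\<close> of \<open>y\<close>.\<close>
  define \<rho> where "\<rho> = 2 * \<delta> / s"
  have \<rho>0: "0 \<le> \<rho>" using \<delta>(1) s by (simp add: \<rho>_def)
  obtain q where q: "p = Suc (Suc q)" using p_ge_2 by (metis Suc_le_D numeral_2_eq_2 Suc_le_mono)
  have s1: "s ^ n \<le> 1" for n using s \<delta>4 by (intro power_le_one) auto
  have \<rho>1: "r ^ (p - 1) * \<rho> \<le> 1"
  proof -
    have "r ^ (p - 1) * \<rho> = 2 * 4 ^ Suc q * \<delta> * s ^ q" using s by (simp add: q r_def \<rho>_def power_mult_distrib)
    also have "\<dots> \<le> 2 * 4 ^ Suc q * \<delta> * 1" using \<delta>(1) s1 by (intro mult_left_mono) auto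
    also have "\<dots> \<le> 4 ^ p * \<delta>" using \<delta>(1) by (simp add: q)
    finally show ?thesis using \<delta>(2) by simp
  qed
  have CN: "0 \<le> C\<^sub>N" unfolding remainder_const_def using maj_nonneg[of 2] by simp
  have small: "2 * (C\<^sub>N * (r ^ p + r ^ (2 * p - 2) * \<rho>)) \<le> b / (real p - 1)"
  proof -
    have "r ^ p = 4 ^ p * (s * s ^ (p - 1))" by (simp add: q r_def power_mult_distrib)
    also have "\<dots> \<le> 16 ^ p * (\<delta> * s ^ (p - 1))"
      using s \<delta> by (intro mult_mono power_mono) auto
    finally have 1: "r ^ p \<le> 16 ^ p * \<delta> * s ^ (p - 1)" by simp
    have "r ^ (2 * p - 2) * \<rho> = (4 ^ (2 * p - 2) * (2 * \<delta>)) * (s ^ (2 * p - 2) / s)"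
      by (simp add: r_def \<rho>_def power_mult_distrib)
    also have "s ^ (2 * p - 2) / s = s ^ (p - 1) * s ^ q"
      using s by (simp add: q power_add[symmetric] mult_2)
    also have "(4 ^ (2 * p - 2) * (2 * \<delta>)) * (s ^ (p - 1) * s ^ q) \<le> (4 ^ (2 * p) * (2 * \<delta>)) * (s ^ (p - 1) * 1)"
      using \<delta>(1) s s1 by (intro mult_mono mult_nonneg_nonneg power_increasing mult_left_mono) auto
    also have "(4::real) ^ (2 * p) = 16 ^ p" by (simp add: power_mult)
    finally have 2: "r ^ (2 * p - 2) * \<rho> \<le> 2 * (16 ^ p * \<delta> * s ^ (p - 1))" by simp
    have "2 * (C\<^sub>N * (r ^ p + r ^ (2 * p - 2) * \<rho>)) \<le> 2 * (C\<^sub>N * (16 ^ p * \<delta> * s ^ (p - 1) + 2 * (16 ^ p * \<delta> * s ^ (p - 1))))"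
      using CN 1 2 by (intro mult_left_mono add_mono) auto
    also have "\<dots> = (6 * C\<^sub>N * 16 ^ p * \<delta>) * s ^ (p - 1)" by simp
    also have "\<dots> \<le> norm (f 0) * s ^ (p - 1)" using \<delta>(3) s by (intro mult_right_mono) auto
    also have "\<dots> = b / (real p - 1)" unfolding b_eq using p_ge_2 by simp
    finally show ?thesis .
  qed
  define y0 where "y0 = multiplier (\<lambda>_. 1 / z0 ^ p) (coeffs u0)"
  have nz0: "norm (1 / z0 ^ p) \<le> 1 / s ^ p" by (simp add: norm_divide norm_power s_def)
  have y0c: "coord y0 k = 1 / z0 ^ p * coord (coeffs u0) k" for k
    unfolding y0_def by (rule coord_multiplier[OF nz0])
  have y0: "norm y0 \<le> \<rho> / 2"
  proof -
    have "norm y0 \<le> 1 / s ^ p * norm (coeffs u0)" unfolding y0_def by (rule norm_multiplier_le[OF nz0])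
    also have "\<dots> \<le> 1 / s ^ p * (\<delta> * s ^ (p - 1))"
      using u0 s by (intro mult_left_mono) (auto simp: norm_coeffs s_def)
    also have "\<dots> = \<rho> / 2" using s by (simp add: q \<rho>_def)
    finally show ?thesis .
  qed
  obtain y where yc: "continuous_on {0..} y" and yle: "\<And>t. 0 \<le> t \<Longrightarrow> norm (y t) \<le> \<rho>" and yy0: "y 0 = y0"
    and yd: "\<And>t. 0 \<le> t \<Longrightarrow> (y has_vector_derivative profile_rhs \<sigma> \<zeta> t (y t)) (at t within {0..})"
    using profile_exists[OF \<sigma>1(1) \<zeta>c \<zeta>nz \<zeta>le r b \<rho>0 \<rho>1 small y0] by blast
  \<comment> \<open>In the time variable \<open>\<sigma> t\<close>; the solution itself is \<open>u\<close> below.\<close>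
  define U where "U t x = \<zeta> t + \<zeta> t ^ p * synth (free_flow (\<sigma> * t) (y t)) x" for t x
  define u where "u t = U (\<sigma> * t)" for t
  define \<xi> where "\<xi> t = \<zeta> (\<sigma> * t)" for t
  have pert: "wbound (\<lambda>x. \<zeta> t ^ p * synth (free_flow (\<sigma> * t) (y t)) x) (norm (\<zeta> t) ^ p * \<rho>)" if "0 \<le> t" for t
  proof -
    have "wbound (synth (free_flow (\<sigma> * t) (y t))) \<rho>"
      by (rule wbound_mono[OF wbound_synth order_trans[OF norm_free_flow_le yle[OF that]]])
    from wbound_cmult[OF this, of "\<zeta> t ^ p"] show ?thesis by (simp add: norm_power)
  qed
  have WU: "wbound (U t) (norm (\<zeta> t) + norm (\<zeta> t) ^ p * \<rho>)" if "0 \<le> t" for t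
    unfolding U_def by (rule wbound_add[OF wbound_const pert[OF that]])
  have UA: "U t \<in> \<A>" if "0 \<le> t" for t by (rule wbound_wiener_algebra[OF WU[OF that]])
  have Uc: "continuous_on {0..} (\<lambda>t. coeffs (U t))"
    unfolding U_def
    by (intro continuous_on_coeffs wcont_add wcont_mult wcont_const wcont_synth continuous_on_free_flow continuous_intros \<zeta>c yc)
  have J0: "0 \<le> \<sigma> * t" if "t \<in> J" for t using that J by simp
  have JI: "(\<lambda>t. \<sigma> * t) ` J \<subseteq> {0..}" using J0 by auto
  have ds: "((\<lambda>t. \<sigma> * t) has_vector_derivative \<sigma>) (at t within J)" for t
    by (auto intro!: derivative_eq_intros simp: has_real_derivative_iff_has_vector_derivative[symmetric])
  have uA: "u t \<in> \<A>" if "t \<in> J" for t unfolding u_def by (rule UA[OF J0[OF that]])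
  have sol: "nls_solution d \<omega> \<nu> p f J (\<lambda>x. z0 + u0 x) u"
    unfolding nls_solution_def
  proof (intro conjI ballI uA)
    have "continuous_on J (\<lambda>t. coeffs (u t))"
      unfolding u_def by (rule continuous_on_compose2[OF Uc _ JI]) (intro continuous_intros)
    then have "\<forall>t\<in>J. ((\<lambda>s. wnorm (\<lambda>x. u s x - u t x)) \<longlongrightarrow> 0) (at t within J)"
      using continuous_on_coeffs_iff[of J u] uA by simp
    then show "((\<lambda>s. wnorm (\<lambda>x. u s x - u t x)) \<longlongrightarrow> 0) (at t within J)" if "t \<in> J" for t
      using that by (rule bspec)
    show "AE x in \<T>. u 0 x = z0 + u0 x"
      using AE_synth_coeffs[OF u0(1)]
    proof eventually_elim
      case (elim x)
      have "((\<lambda>k. 1 / z0 ^ p * (coord (coeffs u0) k / of_real (wt k) * wchar k x)) has_sum 1 / z0 ^ p * synth (coeffs u0) x) (freqs d)"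
        by (rule has_sum_cmult_right[OF synth_has_sum])
      then have "((\<lambda>k. coord y0 k / of_real (wt k) * wchar k x) has_sum 1 / z0 ^ p * synth (coeffs u0) x) (freqs d)"
        by (simp add: y0c)
      then have "synth y0 x = 1 / z0 ^ p * synth (coeffs u0) x" by (rule has_sum_unique[OF synth_has_sum])
      then show ?case using elim z0(1) by (simp add: u_def U_def \<zeta>0 yy0 free_flow_0)
    qed
    fix k t assume k: "k \<in> freqs d" and t: "t \<in> J"
    define \<tau> where "\<tau> = \<sigma> * t"
    have \<tau>: "0 \<le> \<tau>" using J0[OF t] by (simp add: \<tau>_def)
    have "((\<lambda>t. \<F> (U t) k) has_vector_derivative
       of_real \<sigma> * (\<i> * (- of_real (lap k) * \<F> (U \<tau>) k + \<F> (\<lambda>x. N (U \<tau> x)) k))) (at \<tau> within {0..})"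
      unfolding U_def by (rule perturbed_solution_coefficients[OF \<sigma>1(1) \<tau> k \<zeta>nz[OF \<tau>] \<zeta>d[OF \<tau>] yd[OF \<tau>]])
    from has_vector_derivative_within_subset[OF this JI]
    have "((\<lambda>t. \<F> (U t) k) has_vector_derivative
       of_real \<sigma> * (\<i> * (- of_real (lap k) * \<F> (U \<tau>) k + \<F> (\<lambda>x. N (U \<tau> x)) k))) (at (\<sigma> * t) within (\<lambda>t. \<sigma> * t) ` J)"
      by (simp add: \<tau>_def)
    from vector_diff_chain_within[OF ds this]
    have "((\<lambda>t. \<F> (u t) k) has_vector_derivative
       \<sigma> *\<^sub>R (of_real \<sigma> * (\<i> * (- of_real (lap k) * \<F> (u t) k + \<F> (\<lambda>x. N (u t x)) k)))) (at t within J)"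
      by (simp add: o_def u_def \<tau>_def)
    moreover have "\<sigma> *\<^sub>R (of_real \<sigma> * X) = X" for X :: complex
      using \<sigma>1(2) by (metis mult.assoc mult_1 of_real_1 of_real_mult scaleR_conv_of_real)
    ultimately show "((\<lambda>s. \<F> (u s) k) has_vector_derivative
          \<i> * (- complex_of_real (\<Sum>j<d. (of_int (k j) * \<omega> j)\<^sup>2) * \<F> (u t) k
               + \<F> (\<lambda>x. u t x ^ p * f (u t x)) k)) (at t within J)"
      by (simp add: lap_def N_def)
  qed
  have ssol: "scalar_solution p f J z0 \<xi>"
    unfolding scalar_solution_def
  proof (intro conjI ballI)
    fix t assume t: "t \<in> J"
    from vector_diff_chain_within[OF ds has_vector_derivative_within_subset[OF \<zeta>d[OF J0[OF t]] JI]]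
    have "(\<xi> has_vector_derivative \<sigma> *\<^sub>R (of_real \<sigma> * \<i> * \<xi> t ^ p * f (\<xi> t))) (at t within J)"
      by (simp add: o_def \<xi>_def[abs_def])
    moreover have "\<sigma> *\<^sub>R (of_real \<sigma> * \<i> * \<xi> t ^ p * f (\<xi> t)) = \<i> * \<xi> t ^ p * f (\<xi> t)"
      using \<sigma> by (auto simp: scaleR_conv_of_real)
    ultimately show "(\<xi> has_vector_derivative \<i> * \<xi> t ^ p * f (\<xi> t)) (at t within J)" by simp
  qed (simp add: \<xi>_def \<zeta>0)
  define a where "a = 1 / (real p - 1)"
  have a: "0 < a" "a * real p = real p / (real p - 1)" using p_ge_2 by (auto simp: a_def)
  have rate: "norm (\<xi> t) \<le> r * b powr (- a) * \<bar>t\<bar> powr (- a)" if t: "0 < \<sigma> * t" for t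
  proof -
    have tt: "\<bar>t\<bar> = \<sigma> * t" using t \<sigma> by auto
    have "norm (\<xi> t) \<le> r * (1 + b * (\<sigma> * t)) powr (- a)" using \<zeta>le[of "\<sigma> * t"] t by (simp add: \<xi>_def a_def)
    also have "\<dots> \<le> r * (b * \<bar>t\<bar>) powr (- a)"
      unfolding tt using t b a r by (intro mult_left_mono powr_mono2') auto
    finally show ?thesis using b by (simp add: powr_mult)
  qed
  have pr: "wnorm (\<lambda>x. u t x - \<xi> t) \<le> norm (\<xi> t) ^ p * \<rho>" if t: "0 \<le> \<sigma> * t" for t
    using wbound_wiener_norm[OF pert[OF t]] by (simp add: u_def U_def \<xi>_def)
  define K1 where "K1 = r * b powr (- a)"
  define K where "K = K1 + K1 ^ p * \<rho> + 1"
  have K1: "0 \<le> K1" unfolding K1_def using r by simp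
  have K: "0 < K" "K1 \<le> K" "K1 ^ p * \<rho> \<le> K" unfolding K_def using K1 \<rho>0 by (auto intro: add_nonneg_pos)
  have ev: "\<forall>\<^sub>F t in F. 0 < \<sigma> * t" using F by (simp add: filterlim_at_top_dense)
  have \<xi>0: "((\<lambda>t. norm (\<xi> t)) \<longlongrightarrow> 0) F"
  proof (rule tendsto_sandwich[OF _ _ tendsto_const])
    have "filterlim (\<lambda>t. 1 + b * (\<sigma> * t)) at_top F"
      by (rule filterlim_tendsto_add_at_top[OF tendsto_const])
         (rule filterlim_tendsto_pos_mult_at_top[OF tendsto_const b F])
    then have "((\<lambda>t. (1 + b * (\<sigma> * t)) powr (- a)) \<longlongrightarrow> 0) F"
      using a by (intro tendsto_neg_powr) auto
    from tendsto_mult[OF tendsto_const this, of r]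
    show "((\<lambda>t. r * (1 + b * (\<sigma> * t)) powr (- a)) \<longlongrightarrow> 0) F" by simp
    show "\<forall>\<^sub>F t in F. norm (\<xi> t) \<le> r * (1 + b * (\<sigma> * t)) powr (- a)"
      using ev by eventually_elim (use \<zeta>le in \<open>simp add: \<xi>_def a_def\<close>)
  qed simp
  have lim: "((\<lambda>t. wnorm (u t)) \<longlongrightarrow> 0) F"
  proof (rule tendsto_sandwich[OF _ _ tendsto_const])
    show "((\<lambda>t. norm (\<xi> t) + norm (\<xi> t) ^ p * \<rho>) \<longlongrightarrow> 0) F"
    proof -
      have "((\<lambda>t. norm (\<xi> t) + norm (\<xi> t) ^ p * \<rho>) \<longlongrightarrow> 0 + 0 ^ p * \<rho>) F"
        by (rule tendsto_add[OF \<xi>0 tendsto_mult[OF tendsto_power[OF \<xi>0] tendsto_const]])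
      then show ?thesis using p_ge_2 by (simp add: power_0_left)
    qed
    show "\<forall>\<^sub>F t in F. wnorm (u t) \<le> norm (\<xi> t) + norm (\<xi> t) ^ p * \<rho>"
      using ev by eventually_elim (use wbound_wiener_norm[OF WU] in \<open>simp add: u_def \<xi>_def\<close>)
    show "\<forall>\<^sub>F t in F. 0 \<le> wnorm (u t)"
      by (intro always_eventually allI wiener_norm_nonneg)
  qed
  show ?thesis
    unfolding global_decay_def the_nls_solution_def the_scalar_solution_def
  proof (intro exI[of _ u] exI[of _ \<xi>] conjI allI impI ballI sol lim ssol exI[of _ K] K(1))
    show "AE x in \<T>. v t x = u t x"
      if "is_interval J' \<and> 0 \<in> J' \<and> J' \<subseteq> J \<and> nls_solution d \<omega> \<nu> p f J' (\<lambda>x. z0 + u0 x) v" "t \<in> J'" for J' v t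
      using that by (intro nls_solution_unique[OF _ _ _ _ sol]) auto
    show "v t = \<xi> t"
      if "is_interval J' \<and> 0 \<in> J' \<and> J' \<subseteq> J \<and> scalar_solution p f J' z0 v" "t \<in> J'" for J' v t
      using that by (intro scalar_solution_unique[OF _ _ _ _ ssol]) auto
    show "\<forall>\<^sub>F t in F. norm (\<xi> t) \<le> K * \<bar>t\<bar> powr (- 1 / (real p - 1)) \<and>
       wnorm (\<lambda>x. u t x - \<xi> t) \<le> K * \<bar>t\<bar> powr (- real p / (real p - 1))"
      using ev
    proof eventually_elim
      case (elim t)
      have rt: "norm (\<xi> t) \<le> K1 * \<bar>t\<bar> powr (- a)" unfolding K1_def by (rule rate[OF elim])
      also have "\<dots> \<le> K * \<bar>t\<bar> powr (- a)" using K(2) by (intro mult_right_mono) auto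
      finally have 1: "norm (\<xi> t) \<le> K * \<bar>t\<bar> powr (- 1 / (real p - 1))" by (simp add: a_def)
      have tp: "0 < \<bar>t\<bar>" using elim by auto
      have "wnorm (\<lambda>x. u t x - \<xi> t) \<le> norm (\<xi> t) ^ p * \<rho>" using pr elim by simp
      also have "\<dots> \<le> (K1 * \<bar>t\<bar> powr (- a)) ^ p * \<rho>"
        using rt \<rho>0 by (intro mult_right_mono power_mono) auto
      also have "\<dots> = (K1 ^ p * \<rho>) * \<bar>t\<bar> powr (- (a * real p))"
        using tp by (simp add: power_mult_distrib powr_realpow[symmetric] powr_powr del: powr_realpow)
      also have "\<dots> \<le> K * \<bar>t\<bar> powr (- (a * real p))" using K(3) by (intro mult_right_mono) auto
      finally show ?case using 1 unfolding a(2) by simp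
    qed
  qed
qed

end


theorem theorem1p4:
  fixes p :: nat and f :: "complex \<Rightarrow> complex"
  assumes "p \<ge> 2" and "real_analytic f" and "f 0 \<noteq> 0"
  shows "\<exists>\<delta>>0. \<forall>(d::nat) (\<nu>::real) (\<omega>::nat \<Rightarrow> real).
           d \<ge> 1 \<and> \<nu> \<ge> 1 \<and> (\<forall>j<d. \<omega> j \<noteq> 0) \<longrightarrow>
           (\<forall>z0. cmod z0 < \<delta> \<longrightarrow>
              (\<forall>u0\<in>wiener_algebra d \<omega> \<nu>. wiener_norm d \<omega> \<nu> u0 < \<delta> * cmod z0 ^ (p - 1) \<longrightarrow>
                 global_decay d \<omega> \<nu> p f {0..} at_top z0 u0) \<or>
              (\<forall>u0\<in>wiener_algebra d \<omega> \<nu>. wiener_norm d \<omega> \<nu> u0 < \<delta> * cmod z0 ^ (p - 1) \<longrightarrow>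
                 global_decay d \<omega> \<nu> p f {..0} at_bot z0 u0))"
proof -
  obtain a where a: "\<And>u. ((\<lambda>(m, n). a m n * u ^ m * cnj u ^ n) has_sum f u) UNIV"
    using assms(2) unfolding real_analytic_def by blast
  \<comment> \<open>Dominates the constants in the smallness conditions for the perturbation and for the scalar
    equation; it involves only \<open>p\<close> and the coefficients of \<open>f\<close>.\<close>
  define A where "A = 6 * remainder_const p a * 16 ^ p + 16 * power_majorant a 1 + 1"
  have nn: "0 \<le> 6 * remainder_const p a * 16 ^ p" "0 \<le> 16 * power_majorant a 1"
    using power_majorant_nonneg[of 2 a] power_majorant_nonneg[of 1 a] by (simp_all add: remainder_const_def)
  then have A: "0 < A" by (simp add: A_def)
  define \<delta> where "\<delta> = min (1 / 4 ^ p) (norm (f 0) / A)"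
  have \<delta>: "0 < \<delta>" using A assms(3) by (simp add: \<delta>_def)
  have "\<delta> \<le> 1 / 4 ^ p" by (simp add: \<delta>_def)
  then have \<delta>1: "4 ^ p * \<delta> \<le> 1" by (simp add: field_simps)
  have "\<delta> \<le> norm (f 0) / A" by (simp add: \<delta>_def)
  then have A\<delta>: "A * \<delta> \<le> norm (f 0)" using A by (simp add: field_simps)
  have le: "c * \<delta> \<le> norm (f 0)" if "c \<le> A" for c
    using order_trans[OF mult_right_mono[OF that less_imp_le[OF \<delta>]] A\<delta>] .
  have \<delta>2: "6 * remainder_const p a * 16 ^ p * \<delta> \<le> norm (f 0)" "16 * power_majorant a 1 * \<delta> \<le> norm (f 0)"
    by (rule le, use nn in \<open>simp add: A_def\<close>)+
  show ?thesis
  proof (intro exI[of _ \<delta>] conjI \<delta> allI impI)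
    fix d :: nat and \<nu> :: real and \<omega> :: "nat \<Rightarrow> real" and z0 :: complex
    assume "d \<ge> 1 \<and> \<nu> \<ge> 1 \<and> (\<forall>j<d. \<omega> j \<noteq> 0)" and z0: "cmod z0 < \<delta>"
    then interpret wiener_nls d \<omega> \<nu> p a f
      by unfold_locales (use assms(1) a in auto)
    define c where "c = - \<i> * of_nat (p - 1) * f 0 * z0 ^ (p - 1)"
    show "(\<forall>u0\<in>wiener_algebra d \<omega> \<nu>. wiener_norm d \<omega> \<nu> u0 < \<delta> * cmod z0 ^ (p - 1) \<longrightarrow>
                 global_decay d \<omega> \<nu> p f {0..} at_top z0 u0) \<or>
              (\<forall>u0\<in>wiener_algebra d \<omega> \<nu>. wiener_norm d \<omega> \<nu> u0 < \<delta> * cmod z0 ^ (p - 1) \<longrightarrow>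
                 global_decay d \<omega> \<nu> p f {..0} at_bot z0 u0)"
    proof (cases "z0 = 0")
      case True
      have "\<not> wiener_norm d \<omega> \<nu> u < \<delta> * cmod z0 ^ (p - 1)" for u
        using True assms(1) wiener_norm_nonneg[of u] by (simp add: not_less power_0_left)
      then show ?thesis by blast
    next
      case False
      show ?thesis
      proof (cases "0 \<le> Re c")
        case True
        then show ?thesis
          using global_decay_direction[of 1 "{0..}" at_top \<delta> z0] assms(3) \<delta> \<delta>1 \<delta>2 z0 False
          by (auto simp: c_def filterlim_ident atLeast_def)
      next
        case cneg: False
        have "- (of_real (- 1) * \<i>) * of_nat (p - 1) * f 0 * z0 ^ (p - 1) = - c"
          by (simp add: c_def)
        then have "0 \<le> Re (- (of_real (- 1) * \<i>) * of_nat (p - 1) * f 0 * z0 ^ (p - 1))"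
          using cneg by simp
        then show ?thesis
          using global_decay_direction[of "-1" "{..0}" at_bot \<delta> z0] assms(3) \<delta> \<delta>1 \<delta>2 z0 False
          by (auto simp: filterlim_uminus_at_top_at_bot atMost_def)
      qed
    qed
  qed
qed

end
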